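(* Let $\mathbb{K}$ be an algebraically closed field of characteristic zero. Let $X\subset\mathbb{P}^n$ be a non-degenerate rational curve of degree $d$ and arithmetic genus $g\leq d/2$. Assume that $X$ has only one singular point $Q$, and that $Q$ is a unibranch singularity. Let $\phi:\mathbb{P}^1\to X$ be the normalization map. Then the valuation corresponding to $Q$, namely $\mathfrak{v}_{\phi^{-1}(Q)}$, is Khovanskii-finite with respect to $X$.
   Context: A curve is an integral one-dimensional closed subscheme of projective space; it is non-degenerate if it is contained in no proper linear subspace. The point $Q$ being unibranch means that $\phi^{-1}(Q)$ is a single point of $\mathbb{P}^1$. Let $\mathbb{K}[x,y]_d$ be the space of degree $d$ binary forms. For a linear subspace $L\subset\mathbb{K}[x,y]_d$, $R(L)=\bigoplus_{k\geq0}L^k$, where $L^k$ is the span of all products $\ell_1\cdots\ell_k$ with $\ell_i\in L$; it is a graded $\mathbb{K}$-algebra with $L^k$ in degree $k$. The homogeneous coordinate ring of $X$ is $R(L)$, where $L\subset\mathbb{K}[x,y]_d$ is the space of pullbacks along $\phi$ of linear forms on $\mathbb{P}^n$. For $P=(\alpha:\beta)\in\mathbb{P}^1$, $\mathfrak{v}_P$ is the valuation on $R(L)$ with values in $\mathbb{Z}^2$ (ordered lexicographically) given by $\mathfrak{v}_P(f)=(k,\mathrm{ord}_P(f))$ for $0\neq f\in L^k$, where $\mathrm{ord}_P(f)$ is the highest power of $\beta x-\alpha y$ dividing $f$, and $\mathfrak{v}_P(f)=\min_{f_k\neq0}\mathfrak{v}_P(f_k)$ for $f=\sum_k f_k$ with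 $f_k\in L^k$. A valuation $\mathfrak{v}$ on a finitely generated graded $\mathbb{K}$-domain $S$ is Khovanskii-finite with respect to $S$ if it is homogeneous (i.e. $\mathfrak{v}(f)=\min_{f_k\ne 0}\mathfrak{v}(f_k)$ over the homogeneous parts $f_k$ of $f$), has full rank (the group generated by its values has rank equal to the Krull dimension of $S$), and its value semigroup $\mathfrak{v}(S\setminus\{0\})$ is finitely generated. It is Khovanskii-finite with respect to an embedded projective variety if it is so with respect to its homogeneous coordinate ring. *)

theory Defs
  imports
    "HOL-Library.Poly_Mapping"
    "HOL-Library.Product_Plus"
    "HOL-Library.Product_Lexorder"
    "HOL-Library.Extended_Nat"
    "HOL-Computational_Algebra.Polynomial"
    "HOL-Computational_Algebra.Fraction_Field"
    "HOL-Algebra.QuotRing"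
    "HOL-Algebra.Generated_Rings"
    "HOL-Algebra.Ring_Divisibility"
begin

instance prod :: (linordered_ab_group_add, linordered_ab_group_add) linordered_ab_group_add
  by standard (auto simp: less_eq_prod_def)


section \<open>Polynomials and rings\<close>

text \<open>Polynomials in countably many variables; \<open>K[x\<^sub>0, \<dots>, x\<^sub>n]\<close> is the subring \<open>mpolys n\<close>.
  In particular the binary forms of degree \<open>d\<close> are \<open>forms 1 d\<close>, with \<open>x = Var 0\<close> and \<open>y = Var 1\<close>.\<close>

type_synonym 'a mpoly = "(nat \<Rightarrow>\<^sub>0 nat) \<Rightarrow>\<^sub>0 'a"

definition Cst :: "'a::comm_ring_1 \<Rightarrow> 'a mpoly" where
  "Cst c = Poly_Mapping.single 0 c"

definition Var :: "nat \<Rightarrow> 'a::comm_ring_1 mpoly" where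
  "Var i = Poly_Mapping.single (Poly_Mapping.single i 1) 1"

definition mdeg :: "(nat \<Rightarrow>\<^sub>0 nat) \<Rightarrow> nat" where
  "mdeg m = (\<Sum>i\<in>Poly_Mapping.keys m. Poly_Mapping.lookup m i)"

definition mpolys :: "nat \<Rightarrow> 'a::comm_ring_1 mpoly set" where
  "mpolys n = {F. \<forall>m\<in>Poly_Mapping.keys F. Poly_Mapping.keys m \<subseteq> {..n}}"

definition forms :: "nat \<Rightarrow> nat \<Rightarrow> 'a::comm_ring_1 mpoly set" where
  "forms n k = {F \<in> mpolys n. \<forall>m\<in>Poly_Mapping.keys F. mdeg m = k}"

definition subst :: "('a::comm_ring_1 \<Rightarrow> 'b::comm_ring_1) \<Rightarrow> (nat \<Rightarrow> 'b) \<Rightarrow> 'a mpoly \<Rightarrow> 'b" where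
  "subst h s F = (\<Sum>m\<in>Poly_Mapping.keys F. h (Poly_Mapping.lookup F m) * (\<Prod>i\<in>Poly_Mapping.keys m. s i ^ Poly_Mapping.lookup m i))"

abbreviation eval :: "(nat \<Rightarrow> 'a) \<Rightarrow> 'a::comm_ring_1 mpoly \<Rightarrow> 'a" where
  "eval \<equiv> subst id"

abbreviation compose :: "(nat \<Rightarrow> 'a mpoly) \<Rightarrow> 'a::comm_ring_1 mpoly \<Rightarrow> 'a mpoly" where
  "compose \<equiv> subst Cst"

abbreviation scale :: "'a::comm_ring_1 \<Rightarrow> 'a mpoly \<Rightarrow> 'a mpoly" where
  "scale c F \<equiv> Cst c * F"

text \<open>The \<^emph>\<open>HOL-Algebra\<close> ring on a subring of a type-class ring.\<close>

definition ring_on :: "'r::comm_ring_1 set \<Rightarrow> 'r ring" where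
  "ring_on S = \<lparr>carrier = S, mult = (*), one = 1, zero = 0, add = (+)\<rparr>"

definition krull_dim :: "('r, 'm) ring_scheme \<Rightarrow> enat" where
  "krull_dim R = Sup {enat r | r.
     \<exists>p. (\<forall>i\<le>r. primeideal (p i) R) \<and> (\<forall>i<r. p i \<subset> p (Suc i))}"

definition regular_local_ring :: "('r, 'm) ring_scheme \<Rightarrow> bool" where
  "regular_local_ring R \<longleftrightarrow>
     cring R \<and> noetherian_ring R \<and> (\<exists>!M. maximalideal M R) \<and>
     (\<exists>A \<subseteq> carrier R. finite A \<and> enat (card A) = krull_dim R \<and> maximalideal (genideal R A) R)"


section \<open>Projective geometry\<close>

text \<open>Points of \<open>P\<^sup>n\<close> are given by homogeneous coordinate vectors, of which only the
  entries with index \<open>\<le> n\<close> are relevant.\<close>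

definition proj_space :: "nat \<Rightarrow> (nat \<Rightarrow> 'a::field) set" where
  "proj_space n = {q. \<exists>i\<le>n. q i \<noteq> 0}"

definition same_point :: "nat \<Rightarrow> (nat \<Rightarrow> 'a::field) \<Rightarrow> (nat \<Rightarrow> 'a) \<Rightarrow> bool" where
  "same_point n p q \<longleftrightarrow> (\<exists>c. c \<noteq> 0 \<and> (\<forall>i\<le>n. q i = c * p i))"

text \<open>An integral closed subscheme of \<open>P\<^sup>n\<close> is represented by its homogeneous ideal: a
  homogeneous prime ideal of \<open>K[x\<^sub>0, \<dots>, x\<^sub>n]\<close> other than the irrelevant one.\<close>

definition homogeneous_ideal :: "nat \<Rightarrow> 'a::field mpoly set \<Rightarrow> bool" where
  "homogeneous_ideal n I \<longleftrightarrow> ideal I (ring_on (mpolys n)) \<and>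
     (\<forall>F\<in>I. \<exists>c. (\<forall>k. c k \<in> I \<inter> forms n k) \<and> finite {k. c k \<noteq> 0} \<and> F = (\<Sum>k | c k \<noteq> 0. c k))"

definition integral_subscheme :: "nat \<Rightarrow> 'a::field mpoly set \<Rightarrow> bool" where
  "integral_subscheme n I \<longleftrightarrow>
     homogeneous_ideal n I \<and> primeideal I (ring_on (mpolys n)) \<and> (\<exists>i\<le>n. Var i \<notin> I)"

definition points :: "nat \<Rightarrow> 'a::field mpoly set \<Rightarrow> (nat \<Rightarrow> 'a) set" where
  "points n I = {q \<in> proj_space n. \<forall>F\<in>I. eval q F = 0}"

text \<open>Krull dimension of the underlying space. Irreducible closed subsets of the subscheme
  correspond to integral subschemes contained in it, i.e. to ideals containing \<open>I\<close>.\<close>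

definition scheme_dim :: "nat \<Rightarrow> 'a::field mpoly set \<Rightarrow> enat" where
  "scheme_dim n I = Sup {enat r | r.
     \<exists>p. (\<forall>i\<le>r. integral_subscheme n (p i) \<and> I \<subseteq> p i) \<and> (\<forall>i<r. p i \<subset> p (Suc i))}"

definition proj_curve :: "nat \<Rightarrow> 'a::field mpoly set \<Rightarrow> bool" where
  "proj_curve n I \<longleftrightarrow> integral_subscheme n I \<and> scheme_dim n I = 1"

definition nondegenerate :: "nat \<Rightarrow> 'a::field mpoly set \<Rightarrow> bool" where
  "nondegenerate n I \<longleftrightarrow> I \<inter> forms n 1 = {0}"

definition hilbert_function :: "nat \<Rightarrow> 'a::field mpoly set \<Rightarrow> nat \<Rightarrow> nat" where
  "hilbert_function n I k =
     vector_space.dim scale (forms n k :: 'a mpoly set) - vector_space.dim scale (I \<inter> forms n k)"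

definition hilbert_poly :: "nat \<Rightarrow> 'a::field mpoly set \<Rightarrow> rat poly" where
  "hilbert_poly n I =
     (THE p. eventually (\<lambda>k. poly p (of_nat k) = of_nat (hilbert_function n I k)) sequentially)"

definition scheme_degree :: "nat \<Rightarrow> 'a::field mpoly set \<Rightarrow> rat" where
  "scheme_degree n I =
     fact (Polynomial.degree (hilbert_poly n I)) * lead_coeff (hilbert_poly n I)"

definition arithmetic_genus :: "nat \<Rightarrow> 'a::field mpoly set \<Rightarrow> rat" where
  "arithmetic_genus n I =
     (- 1) ^ Polynomial.degree (hilbert_poly n I) * (poly (hilbert_poly n I) 0 - 1)"

text \<open>The local ring of \<open>P\<^sup>n\<close> at \<open>q\<close>, inside the fraction field, and the local ring of the
  subscheme as its quotient by the stalk of the ideal sheaf.\<close>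

definition local_ring_proj_space :: "nat \<Rightarrow> (nat \<Rightarrow> 'a::field) \<Rightarrow> 'a mpoly fract ring" where
  "local_ring_proj_space n q =
     ring_on {Fract F G | F G k. F \<in> forms n k \<and> G \<in> forms n k \<and> eval q G \<noteq> 0}"

definition ideal_stalk :: "nat \<Rightarrow> 'a::field mpoly set \<Rightarrow> (nat \<Rightarrow> 'a) \<Rightarrow> 'a mpoly fract set" where
  "ideal_stalk n I q =
     {Fract F G | F G k. F \<in> I \<inter> forms n k \<and> G \<in> forms n k \<and> eval q G \<noteq> 0}"

definition local_ring :: "nat \<Rightarrow> 'a::field mpoly set \<Rightarrow> (nat \<Rightarrow> 'a) \<Rightarrow> 'a mpoly fract set ring" where
  "local_ring n I q = local_ring_proj_space n q Quot ideal_stalk n I q"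

definition singular_point :: "nat \<Rightarrow> 'a::field mpoly set \<Rightarrow> (nat \<Rightarrow> 'a) \<Rightarrow> bool" where
  "singular_point n I q \<longleftrightarrow> q \<in> points n I \<and> \<not> regular_local_ring (local_ring n I q)"

text \<open>A morphism from \<open>P\<^sup>1\<close> to the subscheme \<open>I\<close> of \<open>P\<^sup>n\<close> is given by binary forms
  \<open>f 0, \<dots>, f n\<close> of the same degree without common zero.\<close>

definition morphism_from_P1 :: "nat \<Rightarrow> 'a::field mpoly set \<Rightarrow> (nat \<Rightarrow> 'a mpoly) \<Rightarrow> bool" where
  "morphism_from_P1 n I f \<longleftrightarrow>
     (\<exists>e. \<forall>i\<le>n. f i \<in> forms 1 e) \<and>
     (\<forall>p\<in>proj_space 1. \<exists>i\<le>n. eval p (f i) \<noteq> 0) \<and>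
     (\<forall>F\<in>I. compose f F = 0)"

definition image_point :: "(nat \<Rightarrow> 'a::field mpoly) \<Rightarrow> (nat \<Rightarrow> 'a) \<Rightarrow> (nat \<Rightarrow> 'a)" where
  "image_point f p = (\<lambda>i. eval p (f i))"

text \<open>\<open>(G 0 : G 1)\<close> is a rational map to \<open>P\<^sup>1\<close> inverse to \<open>f\<close> on both sides. The conditions
  \<open>\<noteq> 0\<close> and \<open>\<notin> I\<close> say that the two composites are defined as rational maps.\<close>

definition rational_inverse ::
  "nat \<Rightarrow> 'a::field mpoly set \<Rightarrow> (nat \<Rightarrow> 'a mpoly) \<Rightarrow> (nat \<Rightarrow> 'a mpoly) \<Rightarrow> bool" where
  "rational_inverse n I f G \<longleftrightarrow>
     (\<exists>m. G 0 \<in> forms n m \<and> G 1 \<in> forms n m) \<and>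
     (compose f (G 0) \<noteq> 0 \<or> compose f (G 1) \<noteq> 0) \<and>
     compose f (G 0) * Var 1 = compose f (G 1) * Var 0 \<and>
     (\<exists>i\<le>n. compose G (f i) \<notin> I) \<and>
     (\<forall>i\<le>n. \<forall>j\<le>n. compose G (f i) * Var j - compose G (f j) * Var i \<in> I)"

text \<open>The normalization of a curve is a finite birational morphism from a normal curve. Here the
  source \<open>P\<^sup>1\<close> is normal, and finiteness is automatic because a birational morphism of projective
  curves is nonconstant.\<close>

definition normalization_map :: "nat \<Rightarrow> 'a::field mpoly set \<Rightarrow> (nat \<Rightarrow> 'a mpoly) \<Rightarrow> bool" where
  "normalization_map n I f \<longleftrightarrow> morphism_from_P1 n I f \<and> (\<exists>G. rational_inverse n I f G)"


section \<open>Khovanskii-finite valuations\<close>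

definition decomposition :: "('r, 'm) ring_scheme \<Rightarrow> (nat \<Rightarrow> 'r set) \<Rightarrow> 'r \<Rightarrow> (nat \<Rightarrow> 'r) \<Rightarrow> bool" where
  "decomposition S A f c \<longleftrightarrow>
     (\<forall>k. c k \<in> A k) \<and> finite {k. c k \<noteq> \<zero>\<^bsub>S\<^esub>} \<and> f = finsum S c {k. c k \<noteq> \<zero>\<^bsub>S\<^esub>}"

definition hom_part :: "('r, 'm) ring_scheme \<Rightarrow> (nat \<Rightarrow> 'r set) \<Rightarrow> 'r \<Rightarrow> nat \<Rightarrow> 'r" where
  "hom_part S A f = (THE c. decomposition S A f c)"

text \<open>A finitely generated graded \<open>K\<close>-domain \<open>S\<close>, with structure map \<open>h\<close> and \<open>k\<close>-th graded piece
  \<open>A k\<close>.\<close>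

definition fg_graded_domain ::
  "('a::field \<Rightarrow> 'r) \<Rightarrow> ('r, 'm) ring_scheme \<Rightarrow> (nat \<Rightarrow> 'r set) \<Rightarrow> bool" where
  "fg_graded_domain h S A \<longleftrightarrow>
     domain S \<and> h \<in> ring_hom (ring_on UNIV) S \<and> range h \<subseteq> A 0 \<and>
     (\<forall>k. additive_subgroup (A k) S) \<and>
     (\<forall>i j. \<forall>f\<in>A i. \<forall>g\<in>A j. f \<otimes>\<^bsub>S\<^esub> g \<in> A (i + j)) \<and>
     (\<forall>f\<in>carrier S. \<exists>!c. decomposition S A f c) \<and>
     (\<exists>B \<subseteq> carrier S. finite B \<and> generate_ring S (range h \<union> B) = carrier S)"

definition is_valuation ::
  "('a::field \<Rightarrow> 'r) \<Rightarrow> ('r, 'm) ring_scheme \<Rightarrow> ('r \<Rightarrow> 'g::linordered_ab_group_add) \<Rightarrow> bool" where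
  "is_valuation h S v \<longleftrightarrow>
     (\<forall>f \<in> carrier S - {\<zero>\<^bsub>S\<^esub>}. \<forall>g \<in> carrier S - {\<zero>\<^bsub>S\<^esub>}.
        v (f \<otimes>\<^bsub>S\<^esub> g) = v f + v g \<and>
        (f \<oplus>\<^bsub>S\<^esub> g \<noteq> \<zero>\<^bsub>S\<^esub> \<longrightarrow> min (v f) (v g) \<le> v (f \<oplus>\<^bsub>S\<^esub> g))) \<and>
     (\<forall>c. c \<noteq> 0 \<longrightarrow> v (h c) = 0)"

definition value_set :: "('r, 'm) ring_scheme \<Rightarrow> ('r \<Rightarrow> 'g) \<Rightarrow> 'g set" where
  "value_set S v = v ` (carrier S - {\<zero>\<^bsub>S\<^esub>})"

definition homogeneous_valuation ::
  "('r, 'm) ring_scheme \<Rightarrow> (nat \<Rightarrow> 'r set) \<Rightarrow> ('r \<Rightarrow> 'g::linorder) \<Rightarrow> bool" where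
  "homogeneous_valuation S A v \<longleftrightarrow> (\<forall>f \<in> carrier S - {\<zero>\<^bsub>S\<^esub>}.
     v f = Min ((\<lambda>k. v (hom_part S A f k)) ` {k. hom_part S A f k \<noteq> \<zero>\<^bsub>S\<^esub>}))"

definition zscale :: "int \<Rightarrow> 'g::ab_group_add \<Rightarrow> 'g" where
  "zscale c x = (\<Sum>i<nat c. x) - (\<Sum>i<nat (- c). x)"

definition group_rank :: "'g::ab_group_add set \<Rightarrow> enat" where
  "group_rank G =
     Sup {enat (card B) | B. B \<subseteq> G \<and> finite B \<and> \<not> module.dependent zscale B}"

definition full_rank :: "('r, 'm) ring_scheme \<Rightarrow> ('r \<Rightarrow> 'g::ab_group_add) \<Rightarrow> bool" where
  "full_rank S v \<longleftrightarrow> group_rank (module.span zscale (value_set S v)) = krull_dim S"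

definition fg_semigroup :: "'g::semigroup_add set \<Rightarrow> bool" where
  "fg_semigroup T \<longleftrightarrow> (\<exists>B. finite B \<and> T = (\<lambda>U. \<forall>x\<in>U. \<forall>y\<in>U. x + y \<in> U) hull B)"

definition khovanskii_finite ::
  "('a::field \<Rightarrow> 'r) \<Rightarrow> ('r, 'm) ring_scheme \<Rightarrow> (nat \<Rightarrow> 'r set) \<Rightarrow>
   ('r \<Rightarrow> 'g::linordered_ab_group_add) \<Rightarrow> bool" where
  "khovanskii_finite h S A v \<longleftrightarrow>
     fg_graded_domain h S A \<and> is_valuation h S v \<and>
     homogeneous_valuation S A v \<and> full_rank S v \<and> fg_semigroup (value_set S v)"


section \<open>The algebra of a linear system of binary forms\<close>

definition pullback_forms :: "nat \<Rightarrow> (nat \<Rightarrow> 'a::field mpoly) \<Rightarrow> 'a mpoly set" where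
  "pullback_forms n f = compose f ` forms n 1"

definition subspace_power :: "'a::field mpoly set \<Rightarrow> nat \<Rightarrow> 'a mpoly set" where
  "subspace_power L k = module.span scale {\<Prod>i<k. l i | l. \<forall>i<k. l i \<in> L}"

text \<open>The direct sum of the powers \<open>L\<^sup>k\<close> is realised as \<open>\<Oplus>\<^sub>k L\<^sup>k u\<^sup>k\<close> in \<open>K[x, y][u]\<close>.\<close>

definition system_ring :: "'a::field mpoly set \<Rightarrow> 'a mpoly poly ring" where
  "system_ring L = ring_on {H. \<forall>k. Polynomial.coeff H k \<in> subspace_power L k}"

definition system_grading :: "'a::field mpoly set \<Rightarrow> nat \<Rightarrow> 'a mpoly poly set" where
  "system_grading L k = (\<lambda>F. Polynomial.monom F k) ` subspace_power L k"

definition ord_at :: "(nat \<Rightarrow> 'a::field) \<Rightarrow> 'a mpoly \<Rightarrow> nat" where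
  "ord_at p F = (GREATEST m. (scale (p 1) (Var 0) - scale (p 0) (Var 1)) ^ m dvd F)"

definition point_valuation :: "(nat \<Rightarrow> 'a::field) \<Rightarrow> 'a mpoly poly \<Rightarrow> int \<times> int" where
  "point_valuation p H =
     Min ((\<lambda>k. (int k, int (ord_at p (Polynomial.coeff H k)))) ` {k. Polynomial.coeff H k \<noteq> 0})"

text \<open>Khovanskii-finiteness with respect to the projective variety parametrised by \<open>f\<close>, whose
  homogeneous coordinate ring is identified with \<open>R(L)\<close> by pullback along \<open>f\<close>.\<close>

definition khovanskii_finite_embedded ::
  "nat \<Rightarrow> (nat \<Rightarrow> 'a::field mpoly) \<Rightarrow> ('a mpoly poly \<Rightarrow> 'g::linordered_ab_group_add) \<Rightarrow> bool" where
  "khovanskii_finite_embedded n f v \<longleftrightarrow>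
     khovanskii_finite (\<lambda>c. [:Cst c:])
       (system_ring (pullback_forms n f)) (system_grading (pullback_forms n f)) v"

end

theory Submission
  imports Defs
begin

text \<open>Write \<open>L\<close> for the space of pulled back linear forms and \<open>e\<close> for the degree of the forms in
  \<open>L\<close>. In degree \<open>k\<close> the values of the valuation are the orders of vanishing at \<open>P\<close> of the forms in
  \<open>L\<^sup>k\<close>, so the value semigroup lies in the cone of all \<open>(k, a)\<close> with \<open>0 \<le> a \<le> k e\<close>. A semigroup of
  lattice points in this cone is finitely generated as soon as it has a nonzero point on each edge
  (\<open>fg_semigroup_of_edges\<close>). The lower edge is met because some form in \<open>L\<close> does not vanish at \<open>P\<close>. To
  meet the upper edge, some power \<open>\<ell>\<^sup>k\<^sup>e\<close> of the linear form \<open>\<ell>\<close> that vanishes at \<open>P\<close> must lie in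
  \<open>L\<^sup>k\<close>.

  Move \<open>P\<close> to infinity. A form of degree \<open>k e\<close> becomes a polynomial of degree at most \<open>k e\<close> in a
  coordinate \<open>t\<close> on the complement of \<open>P\<close>, the space \<open>L\<^sup>k\<close> becomes a space \<open>W k\<close> of such polynomials,
  the order of vanishing at \<open>P\<close> becomes the defect of the degree from \<open>k e\<close> (\<open>ord_at_eq\<close>), and
  \<open>\<ell>\<^sup>k\<^sup>e\<close> becomes \<open>1\<close>. So the claim is that \<open>1 \<in> W k\<close> for some \<open>k \<ge> 1\<close>. Consider the conductor
  elements: those \<open>g \<in> W r\<close> with \<open>g h \<in> W (r + k)\<close> for all \<open>k \<ge> 1\<close> and all \<open>h\<close> of degree at most
  \<open>k e\<close>. Every point other than \<open>P\<close> is mapped to a point other than \<open>Q\<close>, where the curve is regular.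
  There the maximal ideal of the local ring is generated by one element; as the parametrization is
  birational, that element is a uniformizer of the projective line, and the local ring of the curve
  is the local ring of the line (\<open>regular_at_imp_local_denominator\<close>). Clearing finitely many
  denominators gives a conductor element that does not vanish at the given point. Hence the
  conductor elements have no common root, they generate the unit ideal of \<open>K[t]\<close>, and therefore
  \<open>1 \<in> W r\<close> for all large \<open>r\<close> (\<open>one_mem_of_regular\<close>).

  Two bounds on Krull dimensions enter: the local rings of the curve have dimension at most \<open>1\<close>,
  which turns regularity into the existence of one generator, and the ring \<open>R(L)\<close> has dimension at
  most \<open>2\<close>, which is the rank of the value group and the length of an explicit chain of primes.
  Both bounds come from the same principle. Elements
  \<open>x\<^sub>i\<close> of \<open>p\<^sub>i\<^sub>+\<^sub>1\<close> outside \<open>p\<^sub>i\<close>, for a chain of primes \<open>p\<^sub>0, p\<^sub>1, \<dots>\<close>, are algebraically independent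
  modulo \<open>p\<^sub>0\<close> (\<open>separating_elements_independent2\<close>), but there are more monomials in too many elements
  than the dimension of the spaces of binary forms permits.\<close>

hide_const (open) Coset.order Module.smult UnivPoly.coeff UnivPoly.monom Poly_Mapping.degree

section \<open>Graded spaces of polynomials in one variable\<close>

text \<open>A nonzero element of minimal degree divides all others, so a root of it would be a common root.\<close>

lemma one_mem_ideal_without_common_root:
  fixes I :: "'a::alg_closed_field poly set"
  assumes add: "\<And>p q. p \<in> I \<Longrightarrow> q \<in> I \<Longrightarrow> p + q \<in> I"
    and mult: "\<And>p q. p \<in> I \<Longrightarrow> q * p \<in> I"
    and no_root: "\<And>t. \<exists>p\<in>I. poly p t \<noteq> 0"
  shows "1 \<in> I"
proof -
  have "\<exists>p. p \<in> I \<and> p \<noteq> 0"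
    using no_root[of 0] by (metis poly_0)
  then obtain p0 where "p0 \<in> I \<and> p0 \<noteq> 0" ..
  from ex_has_least_nat[of "\<lambda>p. p \<in> I \<and> p \<noteq> 0", OF this, of degree]
  obtain g where g: "g \<in> I" "g \<noteq> 0"
    and min: "\<And>p. p \<in> I \<Longrightarrow> p \<noteq> 0 \<Longrightarrow> degree g \<le> degree p"
    by blast
  have "degree g = 0"
  proof (rule ccontr)
    assume "degree g \<noteq> 0"
    then obtain t where t: "poly g t = 0"
      using alg_closed_imp_poly_has_root[of g] by auto
    obtain p where p: "p \<in> I" "poly p t \<noteq> 0"
      using no_root by blast
    have "p + (- (p div g)) * g \<in> I"
      by (rule add[OF p(1) mult[OF g(1)]])
    also have "p + (- (p div g)) * g = p mod g"
      by (simp add: minus_div_mult_eq_mod[symmetric])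
    finally have "p mod g \<in> I" .
    then have "p mod g = 0"
      using min[of "p mod g"] degree_mod_less[of g p] g(2) by linarith
    then have "g dvd p"
      by (simp add: dvd_eq_mod_eq_0)
    then show False
      using p(2) t by (auto elim: dvdE)
  qed
  then obtain c where c: "g = [:c:]"
    by (metis degree_eq_zeroE)
  with g have "[:1 / c:] * g = 1"
    by (simp add: one_pCons)
  then show ?thesis
    using mult[OF g(1), of "[:1 / c:]"] by simp
qed

lemma order_power:
  fixes p :: "'a::idom poly"
  assumes "p ^ n \<noteq> 0"
  shows "order t (p ^ n) = n * order t p"
  using assms by (induction n) (auto simp: order_mult)

locale graded_polys =
  fixes e :: nat and W :: "nat \<Rightarrow> 'a::alg_closed_field poly set"
  assumes const: "\<And>c. [:c:] \<in> W 0"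
    and zero: "\<And>k. 0 \<in> W k"
    and add: "\<And>k p q. p \<in> W k \<Longrightarrow> q \<in> W k \<Longrightarrow> p + q \<in> W k"
    and mult: "\<And>j k p q. p \<in> W j \<Longrightarrow> q \<in> W k \<Longrightarrow> p * q \<in> W (j + k)"
    and degree_le: "\<And>k p. p \<in> W k \<Longrightarrow> degree p \<le> k * e"
begin

lemma smult_mem: "p \<in> W k \<Longrightarrow> [:c:] * p \<in> W k"
  using mult[OF const, of p k c] by simp

lemma sum_mem: "(\<And>i. i \<in> A \<Longrightarrow> f i \<in> W k) \<Longrightarrow> sum f A \<in> W k"
  by (induction A rule: infinite_finite_induct) (simp_all add: zero add)

lemma one_mem: "1 \<in> W 0"
  using const[of 1] by (simp add: one_pCons)

lemma power_mem: "p \<in> W k \<Longrightarrow> p ^ N \<in> W (N * k)"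
proof (induction N)
  case (Suc N)
  then show ?case
    using mult[OF Suc.prems Suc.IH] by simp
qed (simp add: one_mem)

text \<open>The elements \<open>a / b\<close> with \<open>a, b \<in> W k\<close> and \<open>b(t) \<noteq> 0\<close> form a local ring. The condition says that its
  maximal ideal is generated by one fraction with numerator \<open>T\<close>, with all denominators cleared; the
  equation between the degrees expresses that only fractions of degree \<open>0\<close> are involved.\<close>

definition regular_at :: "'a \<Rightarrow> bool" where
  "regular_at t \<longleftrightarrow> (\<exists>k\<^sub>0. \<exists>T\<in>W k\<^sub>0. poly T t = 0 \<and>
     (\<forall>k. \<forall>a\<in>W k. poly a t = 0 \<longrightarrow>
        (\<exists>j m. \<exists>G\<in>W j. \<exists>H\<in>W m. poly G t \<noteq> 0 \<and> k + j = k\<^sub>0 + m \<and> a * G = T * H)))"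

text \<open>As long as the cofactor still vanishes at \<open>t\<close>, another \<open>T\<close> can be split off. This lowers the order of
  vanishing at \<open>t\<close>, so it ends.\<close>

lemma factor_out_uniformizer:
  assumes T: "poly T t = 0"
    and gen: "\<And>k a. a \<in> W k \<Longrightarrow> poly a t = 0 \<Longrightarrow>
      \<exists>j m. \<exists>G\<in>W j. \<exists>H\<in>W m. poly G t \<noteq> 0 \<and> k + j = k\<^sub>0 + m \<and> a * G = T * H"
    and a: "a \<in> W k" "a \<noteq> 0"
  shows "\<exists>N j m. \<exists>G\<in>W j. \<exists>H\<in>W m. poly G t \<noteq> 0 \<and> poly H t \<noteq> 0 \<and>
    k + j = N * k\<^sub>0 + m \<and> a * G = T ^ N * H"
  using a
proof (induction "order t a" arbitrary: a k rule: less_induct)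
  case less
  show ?case
  proof (cases "poly a t = 0")
    case False
    show ?thesis
      by (rule exI[of _ 0], rule exI[of _ 0], rule exI[of _ k], rule bexI[of _ 1], rule bexI[of _ a])
        (use False less.prems one_mem in auto)
  next
    case True
    then obtain j m G H where G: "G \<in> W j" "poly G t \<noteq> 0" and H: "H \<in> W m"
      and idx: "k + j = k\<^sub>0 + m" and eq: "a * G = T * H"
      using gen less.prems by blast
    have "G \<noteq> 0"
      using G by auto
    then have nz: "a * G \<noteq> 0" "T \<noteq> 0" "H \<noteq> 0"
      using less.prems eq by auto
    have "order t a + order t G = order t T + order t H"
      using eq nz by (metis order_mult)
    moreover have "order t G = 0" "order t T > 0"
      using G T nz by (auto simp: order_root order_0I)
    ultimately have "order t H < order t a"
      by linarith
    then obtain N j' m' G' H' where G': "G' \<in> W j'" "poly G' t \<noteq> 0"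
      and H': "H' \<in> W m'" "poly H' t \<noteq> 0"
      and idx': "m + j' = N * k\<^sub>0 + m'" and eq': "H * G' = T ^ N * H'"
      using less.hyps[OF _ H nz(3)] by blast
    have "a * (G * G') = T ^ Suc N * H'"
    proof -
      have "a * (G * G') = a * G * G'"
        by (simp only: mult.assoc)
      also have "\<dots> = T * (H * G')"
        unfolding eq by (simp only: mult.assoc)
      finally show ?thesis
        unfolding eq' by (simp only: mult.assoc power_Suc)
    qed
    moreover have "k + (j + j') = Suc N * k\<^sub>0 + m'"
      using idx idx' by simp
    moreover have "poly (G * G') t \<noteq> 0"
      using G G' by simp
    ultimately show ?thesis
      using mult[OF G(1) G'(1)] H' by blast
  qed
qed

text \<open>The quotient of \<open>c t\<close> and \<open>c\<close> is the coordinate, so every polynomial is a fraction of elements of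
  \<open>W\<close>: expand \<open>h c\<^sup>n\<close> in the monomials \<open>(c t)\<^sup>i c\<^sup>n\<^sup>-\<^sup>i\<close>.\<close>

lemma power_mult_mem:
  assumes c: "c \<in> W m" "[:0, 1:] * c \<in> W m" and h: "degree h \<le> n"
  shows "h * c ^ n \<in> W (n * m)"
proof -
  have "h * c ^ n = (\<Sum>i\<le>n. monom (coeff h i) i) * c ^ n"
    using poly_as_sum_of_monoms'[OF h] by simp
  also have "\<dots> = (\<Sum>i\<le>n. [:coeff h i:] * (([:0, 1:] * c) ^ i * c ^ (n - i)))"
    unfolding sum_distrib_right
  proof (rule sum.cong)
    fix i assume "i \<in> {..n}"
    then have "c ^ n = c ^ i * c ^ (n - i)"
      by (simp flip: power_add)
    then have "monom (coeff h i) i * c ^ n = [:coeff h i:] * [:0, 1:] ^ i * (c ^ i * c ^ (n - i))"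
      by (simp add: monom_altdef)
    then show "monom (coeff h i) i * c ^ n = [:coeff h i:] * (([:0, 1:] * c) ^ i * c ^ (n - i))"
      by (simp only: power_mult_distrib mult.assoc)
  qed auto
  also have "\<dots> \<in> W (n * m)"
  proof (intro sum_mem smult_mem)
    fix i assume "i \<in> {..n}"
    then have "i * m + (n - i) * m = n * m"
      by (simp flip: distrib_right)
    then show "([:0, 1:] * c) ^ i * c ^ (n - i) \<in> W (n * m)"
      using mult[OF power_mem[OF c(2), of i] power_mem[OF c(1), of "n - i"]] by simp
  qed
  finally show ?thesis .
qed

text \<open>The local ring at a regular point is all of the local ring of the affine line at \<open>t\<close>. The
  orders at \<open>t\<close> of \<open>c\<close> and of \<open>c\<close> times the linear polynomial with root \<open>t\<close> differ by \<open>1\<close> and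
  both are multiples of the order of \<open>T\<close>, so \<open>T\<close> is a
  uniformizer. The function \<open>h / s\<^sup>k\<close> is regular at \<open>t\<close>. Writing it as a fraction of elements of \<open>W\<close>
  and these as powers of \<open>T\<close> times units, the exponent in the numerator is at least the one in the
  denominator, and the power of \<open>T\<close> cancels.\<close>

lemma regular_at_imp_local_denominator:
  assumes reg: "regular_at t"
    and c: "c \<in> W m" "[:0, 1:] * c \<in> W m" "c \<noteq> 0"
    and s: "s \<in> W 1" "poly s t \<noteq> 0"
    and h: "degree h \<le> k * e"
  shows "\<exists>r. \<exists>g\<in>W r. poly g t \<noteq> 0 \<and> g * h \<in> W (r + k)"
proof (cases "h = 0")
  case True
  then show ?thesis
    using one_mem by (intro exI[of _ 0] bexI[of _ 1]) (auto intro: zero)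
next
  case False
  obtain k\<^sub>0 T where T: "T \<in> W k\<^sub>0" "poly T t = 0"
    and gen: "\<And>k a. a \<in> W k \<Longrightarrow> poly a t = 0 \<Longrightarrow>
      \<exists>j m. \<exists>G\<in>W j. \<exists>H\<in>W m. poly G t \<noteq> 0 \<and> k + j = k\<^sub>0 + m \<and> a * G = T * H"
    using reg unfolding regular_at_def by blast
  have fac: "\<exists>N j m. \<exists>G\<in>W j. \<exists>H\<in>W m. poly G t \<noteq> 0 \<and> poly H t \<noteq> 0 \<and>
      k + j = N * k\<^sub>0 + m \<and> a * G = T ^ N * H" if "a \<in> W k" "a \<noteq> 0" for a k
    by (rule factor_out_uniformizer[OF T(2) _ that]) (rule gen)
  define c' where "c' = [:0, 1:] * c + [:- t:] * c"
  have c'_eq: "c' = [:- t, 1:] * c"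
    unfolding c'_def by (simp only: flip: distrib_right) simp
  have c': "c' \<in> W m" "c' \<noteq> 0"
    using add[OF c(2) smult_mem[OF c(1), of "- t"]] c(3)
    by (simp only: c'_def) (simp only: c'_eq mult_eq_0_iff c(3) simp_thms, simp)
  have "T \<noteq> 0"
  proof -
    have "poly c' t = 0"
      by (simp add: c'_eq)
    then obtain G H where "poly G t \<noteq> 0" "c' * G = T * H"
      using gen[OF c'(1)] by blast
    then show ?thesis
      using c'(2) by (metis mult_eq_0_iff poly_0)
  qed
  have ord: "order t a = N * order t T"
    if "a * G = T ^ N * H" "poly G t \<noteq> 0" "poly H t \<noteq> 0" "a \<noteq> 0" for a G H N
  proof -
    have "G \<noteq> 0" "H \<noteq> 0"
      using that by auto
    moreover from this have "a * G \<noteq> 0" "T ^ N * H \<noteq> 0"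
      using that \<open>T \<noteq> 0\<close> by auto
    ultimately have "order t a + order t G = order t (T ^ N) + order t H"
      using that(1) order_mult[of a G t] order_mult[of "T ^ N" H t] by simp
    also have "order t (T ^ N) = N * order t T"
      using \<open>T ^ N * H \<noteq> 0\<close> by (intro order_power) auto
    finally have "order t a + order t G = N * order t T + order t H" .
    then show ?thesis
      using that by (simp add: order_0I)
  qed
  have ordT: "order t T = 1"
  proof -
    have "order t c' = 1 + order t c"
      using c'(2) order_mult[of "[:-t,1:]" c t] order_power_n_n[of t 1] unfolding c'_eq by simp
    moreover have "order t T dvd order t a" if a: "a \<in> W m" "a \<noteq> 0" for a
    proof -
      obtain N j i G H where "G \<in> W j" "poly G t \<noteq> 0" "H \<in> W i" "poly H t \<noteq> 0"
        "a * G = T ^ N * H"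
        using fac[OF a] by blast
      then show ?thesis
        using ord[of a G N H] a(2) by simp
    qed
    ultimately have "order t T dvd 1 + order t c" "order t T dvd order t c"
      using c c' by metis+
    then show ?thesis
      using dvd_diff_nat[of "order t T" "1 + order t c" "order t c"] by simp
  qed
  define n a b where "n = k * e" and "a = h * c ^ n" and "b = s ^ k * c ^ n"
  have sk: "s ^ k \<in> W k"
    using power_mem[OF s(1), of k] by simp
  have a: "a \<in> W (n * m)" "a \<noteq> 0"
    unfolding a_def using power_mult_mem[OF c(1,2), of h n] h False c(3) by (simp_all add: n_def)
  have b: "b \<in> W (n * m)" "b \<noteq> 0"
    unfolding b_def using power_mult_mem[OF c(1,2), of "s ^ k" n] degree_le[OF sk] s c(3)
    by (simp_all add: n_def) auto
  obtain N j i G H where G: "G \<in> W j" "poly G t \<noteq> 0" and H: "H \<in> W i" "poly H t \<noteq> 0"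
    and idx: "n * m + j = N * k\<^sub>0 + i" and eq: "a * G = T ^ N * H"
    using fac[OF a] by blast
  obtain N' j' i' G' H' where G': "G' \<in> W j'" "poly G' t \<noteq> 0" and H': "H' \<in> W i'" "poly H' t \<noteq> 0"
    and idx': "n * m + j' = N' * k\<^sub>0 + i'" and eq': "b * G' = T ^ N' * H'"
    using fac[OF b] by blast
  have hb: "h * b = a * s ^ k"
    by (simp add: a_def b_def)
  have "order t (s ^ k) = 0"
    using s by (intro order_0I) simp
  moreover have "h * b \<noteq> 0" "a * s ^ k \<noteq> 0"
    using False a b s(2) by auto
  ultimately have "order t h + order t b = order t a"
    using order_mult[of h b t] order_mult[of a "s ^ k" t] by (simp add: hb)
  then have "N' \<le> N"
    using ord[OF eq] ord[OF eq'] G G' H H' a b ordT by simp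
  then have TN: "T ^ N = T ^ N' * T ^ (N - N')"
    by (simp flip: power_add)
  have "T ^ N' * (h * (H' * G)) = h * (b * G') * G"
    unfolding eq' by (simp only: mult_ac)
  also have "\<dots> = h * b * (G' * G)"
    by (simp only: mult_ac)
  also have "\<dots> = a * G * (s ^ k * G')"
    unfolding hb by (simp only: mult_ac)
  also have "\<dots> = T ^ N' * (T ^ (N - N') * H * (s ^ k * G'))"
    unfolding eq TN by (simp only: mult_ac)
  finally have eqn: "h * (H' * G) = T ^ (N - N') * H * (s ^ k * G')"
    using \<open>T \<noteq> 0\<close> by simp
  have "(N - N') * k\<^sub>0 + i + (k + j') = (i' + j) + k"
  proof -
    have "N * k\<^sub>0 = N' * k\<^sub>0 + (N - N') * k\<^sub>0"
      using \<open>N' \<le> N\<close> by (simp flip: distrib_right)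
    then show ?thesis
      using idx idx' by linarith
  qed
  then have "(H' * G) * h \<in> W (i' + j + k)"
    unfolding mult.commute[of "H' * G" h] eqn
    using mult[OF mult[OF power_mem[OF T(1), of "N - N'"] H(1)] mult[OF sk G'(1)]]
    by (simp only: ac_simps)
  moreover have "poly (H' * G) t \<noteq> 0"
    using H' G by simp
  ultimately show ?thesis
    using mult[OF H'(1) G(1)] by blast
qed

text \<open>The monomials of degree at most \<open>e\<close> span, and the product of their denominators works for all of
  them.\<close>

lemma common_denominator:
  assumes local: "\<And>h. degree h \<le> e \<Longrightarrow> \<exists>r. \<exists>g\<in>W r. poly g t \<noteq> 0 \<and> g * h \<in> W (r + 1)"
  shows "\<exists>r. \<exists>g\<in>W r. poly g t \<noteq> 0 \<and> (\<forall>h. degree h \<le> e \<longrightarrow> g * h \<in> W (r + 1))"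
proof -
  have "\<exists>r. \<exists>g\<in>W r. poly g t \<noteq> 0 \<and> (\<forall>i<n. g * monom 1 i \<in> W (r + 1))" if "n \<le> Suc e" for n
    using that
  proof (induction n)
    case 0
    show ?case
      using one_mem by (intro exI[of _ 0] bexI[of _ 1]) auto
  next
    case (Suc n)
    then obtain r g where g: "g \<in> W r" "poly g t \<noteq> 0" "\<And>i. i < n \<Longrightarrow> g * monom 1 i \<in> W (r + 1)"
      by auto
    obtain r' g' where g': "g' \<in> W r'" "poly g' t \<noteq> 0" "g' * monom 1 n \<in> W (r' + 1)"
      using local[of "monom 1 n"] Suc.prems by (auto simp: degree_monom_eq)
    have "g * g' * monom 1 i \<in> W (r + r' + 1)" if "i < Suc n" for i
    proof (cases "i = n")
      case True
      then show ?thesis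
        using mult[OF g(1) g'(3)] by (simp add: mult.assoc)
    next
      case False
      then have "g * monom 1 i \<in> W (r + 1)"
        using that g(3) by simp
      from mult[OF this g'(1)] show ?thesis
        by (simp add: mult_ac)
    qed
    then show ?case
      using mult[OF g(1) g'(1)] g(2) g'(2)
      by (intro exI[of _ "r + r'"] bexI[of _ "g * g'"]) auto
  qed
  then obtain r g where g: "g \<in> W r" "poly g t \<noteq> 0" "\<And>i. i < Suc e \<Longrightarrow> g * monom 1 i \<in> W (r + 1)"
    by blast
  have "g * h \<in> W (r + 1)" if "degree h \<le> e" for h
  proof -
    have "g * h = (\<Sum>i\<le>e. [:coeff h i:] * (g * monom 1 i))"
    proof -
      have "g * h = g * (\<Sum>i\<le>e. monom (coeff h i) i)"
        using poly_as_sum_of_monoms'[OF that] by simp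
      also have "\<dots> = (\<Sum>i\<le>e. [:coeff h i:] * (g * monom 1 i))"
        unfolding sum_distrib_left by (intro sum.cong refl) (simp add: smult_monom flip: mult_smult_right)
      finally show ?thesis .
    qed
    also have "\<dots> \<in> W (r + 1)"
      using g(3) by (intro sum_mem smult_mem) auto
    finally show ?thesis .
  qed
  then show ?thesis
    using g by blast
qed

text \<open>The sums, for arbitrary \<open>xs\<close>, form the ideal generated by \<open>W 1\<close>, and this ideal has no common root.\<close>

lemma one_eq_sum_of_multiples:
  assumes base: "\<And>t. \<exists>s\<in>W 1. poly s t \<noteq> 0"
  obtains xs where "fst ` set xs \<subseteq> W 1" "(\<Sum>(s, b)\<leftarrow>xs. s * b) = 1"
proof -
  define J where "J = (\<lambda>xs. \<Sum>(s, b)\<leftarrow>xs. s * b) ` {xs. fst ` set xs \<subseteq> W 1}"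
  have J_I: "(\<Sum>(s, b)\<leftarrow>xs. s * b) \<in> J" if "fst ` set xs \<subseteq> W 1" for xs
    unfolding J_def using that by blast
  have J_E: "\<exists>xs. fst ` set xs \<subseteq> W 1 \<and> p = (\<Sum>(s, b)\<leftarrow>xs. s * b)" if "p \<in> J" for p
    using that unfolding J_def by auto
  have "1 \<in> J"
  proof (rule one_mem_ideal_without_common_root)
    fix p q assume "p \<in> J" "q \<in> J"
    then obtain xs ys where "fst ` set xs \<subseteq> W 1" "p = (\<Sum>(s, b)\<leftarrow>xs. s * b)"
      and "fst ` set ys \<subseteq> W 1" "q = (\<Sum>(s, b)\<leftarrow>ys. s * b)"
      using J_E by meson
    then show "p + q \<in> J"
      using J_I[of "xs @ ys"] by (simp add: image_Un)
  next
    fix p q assume "p \<in> J"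
    then obtain xs where xs: "fst ` set xs \<subseteq> W 1" "p = (\<Sum>(s, b)\<leftarrow>xs. s * b)"
      using J_E by meson
    have "(\<Sum>(s, b)\<leftarrow>map (\<lambda>(s, b). (s, q * b)) xs. s * b) = q * (\<Sum>(s, b)\<leftarrow>xs. s * b)"
      by (induction xs) (auto simp: distrib_left mult.left_commute)
    moreover have "fst ` set (map (\<lambda>(s, b). (s, q * b)) xs) \<subseteq> W 1"
      using xs(1) by force
    ultimately show "q * p \<in> J"
      using J_I[of "map (\<lambda>(s, b). (s, q * b)) xs"] xs(2) by argo
  next
    fix t
    obtain s where "s \<in> W 1" "poly s t \<noteq> 0"
      using base by blast
    moreover from this have "s \<in> J"
      using J_I[of "[(s, 1)]"] by simp
    ultimately show "\<exists>p\<in>J. poly p t \<noteq> 0"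
      by blast
  qed
  then obtain xs where "fst ` set xs \<subseteq> W 1" "(\<Sum>(s, b)\<leftarrow>xs. s * b) = 1"
    using J_E[of 1] by metis
  then show thesis
    by (rule that)
qed

end

context graded_polys begin
text \<open>It suffices to have a common denominator for the polynomials of degree at most \<open>e\<close>, because a
  polynomial of degree at most \<open>(k + 1) e\<close> is a combination of elements of \<open>W 1\<close> with coefficients of
  degree at most \<open>k e\<close>. Start from any combination and replace the coefficients by their remainders
  modulo the element \<open>s1\<close> of full degree \<open>e\<close>. The quotients are collected in the coefficient of
  \<open>s1\<close>, whose product with \<open>s1\<close> has degree at most \<open>(k + 1) e\<close> because all other terms do.\<close>

lemma conductor_mem:
  assumes base: "\<And>t. \<exists>s\<in>W 1. poly s t \<noteq> 0"
    and s1: "s1 \<in> W 1" "degree s1 = e" and "e > 0"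
    and g: "g \<in> W r" "\<And>h. degree h \<le> e \<Longrightarrow> g * h \<in> W (r + 1)"
  shows "degree h \<le> Suc k * e \<Longrightarrow> g * h \<in> W (r + Suc k)"
proof (induction k arbitrary: h)
  case 0
  then have "degree h \<le> e"
    by simp
  from g(2)[OF this] show ?case
    by simp
next
  case (Suc k)
  obtain xs where xs: "fst ` set xs \<subseteq> W 1" and "(\<Sum>(s, b)\<leftarrow>xs. s * b) = 1"
    using one_eq_sum_of_multiples[OF assms(1)] .
  define N where "N = length xs"
  define s b where "s i = fst (xs ! i)" and "b i = snd (xs ! i)" for i
  have one: "1 = (\<Sum>i<N. s i * b i)"
    using \<open>_ = 1\<close> by (simp add: sum_list_sum_nth N_def s_def b_def case_prod_beta atLeast0LessThan)
  have s: "s i \<in> W 1" if "i < N" for i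
    using xs that by (auto simp: N_def s_def)
  define R where "R i = (b i * h) mod s1" for i
  define Q where "Q = (\<Sum>i<N. s i * ((b i * h) div s1))"
  have "s1 \<noteq> 0"
    using s1(2) \<open>e > 0\<close> by auto
  have R: "degree (R i) < e" for i
    using degree_mod_less'[of s1 "b i * h"] s1(2) \<open>e > 0\<close> \<open>s1 \<noteq> 0\<close>
    by (cases "R i = 0") (auto simp: R_def)
  have "h = (\<Sum>i<N. s i * b i) * h"
    using one by simp
  also have "\<dots> = (\<Sum>i<N. s i * (b i * h))"
    by (simp add: sum_distrib_right mult.assoc)
  also have "\<dots> = (\<Sum>i<N. s1 * (s i * ((b i * h) div s1)) + s i * R i)"
  proof (rule sum.cong)
    fix i
    have "b i * h = s1 * ((b i * h) div s1) + R i"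
      unfolding R_def by simp
    then have "s i * (b i * h) = s i * (s1 * ((b i * h) div s1) + R i)"
      by simp
    then show "s i * (b i * h) = s1 * (s i * ((b i * h) div s1)) + s i * R i"
      by (simp only: distrib_left mult.left_commute)
  qed simp
  also have "\<dots> = s1 * Q + (\<Sum>i<N. s i * R i)"
    by (simp add: Q_def sum.distrib sum_distrib_left)
  finally have h_eq: "h = s1 * Q + (\<Sum>i<N. s i * R i)" .
  have "degree (\<Sum>i<N. s i * R i) \<le> Suc (Suc k) * e"
  proof (rule degree_sum_le)
    fix i assume "i \<in> {..<N}"
    then have "degree (s i) \<le> e"
      using degree_le[OF s] by simp
    moreover have "e \<le> Suc k * e"
      by simp
    ultimately show "degree (s i * R i) \<le> Suc (Suc k) * e"
      using R[of i] degree_mult_le[of "s i" "R i"] unfolding mult_Suc by linarith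
  qed simp
  moreover have "s1 * Q = h - (\<Sum>i<N. s i * R i)"
    using h_eq by (simp add: algebra_simps)
  ultimately have "degree (s1 * Q) \<le> Suc (Suc k) * e"
    using degree_diff_le[OF Suc.prems] by simp
  then have "degree Q \<le> Suc k * e"
    using s1(2) \<open>s1 \<noteq> 0\<close> by (cases "Q = 0") (auto simp: degree_mult_eq)
  then have "g * Q \<in> W (r + Suc k)"
    by (rule Suc.IH)
  then have "s1 * (g * Q) \<in> W (r + Suc (Suc k))"
    using mult[OF s1(1)] by fastforce
  moreover have "(\<Sum>i<N. s i * (g * R i)) \<in> W (r + Suc (Suc k))"
  proof (rule sum_mem)
    fix i assume i: "i \<in> {..<N}"
    have "e \<le> Suc k * e"
      by simp
    then have "degree (R i) \<le> Suc k * e"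
      using R[of i] by linarith
    then show "s i * (g * R i) \<in> W (r + Suc (Suc k))"
      using mult[OF s Suc.IH[of "R i"], of i] i by simp
  qed
  moreover have "g * h = s1 * (g * Q) + (\<Sum>i<N. s i * (g * R i))"
    by (subst h_eq) (simp add: distrib_left sum_distrib_left mult.left_commute)
  ultimately show ?case
    by (simp only: add)
qed

lemma generic_degree_pos:
  assumes c: "[:0, 1:] * c \<in> W m" "c \<noteq> 0"
  shows "e > 0"
proof (rule ccontr)
  assume "\<not> e > 0"
  then have "degree ([:0, 1:] * c) = 0"
    using degree_le[OF c(1)] by simp
  then show False
    using c(2) by simp
qed

text \<open>The conductor elements have no common root, so \<open>1\<close> lies in the ideal that they generate.\<close>

theorem one_mem_of_regular:
  assumes base: "\<And>t. \<exists>s\<in>W 1. poly s t \<noteq> 0"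
    and s1: "s1 \<in> W 1" "degree s1 = e"
    and c: "c \<in> W m" "[:0, 1:] * c \<in> W m" "c \<noteq> 0"
    and reg: "\<And>t. regular_at t"
  shows "\<exists>k\<ge>1. 1 \<in> W k"
proof -
  have "e > 0"
    by (rule generic_degree_pos[OF c(2,3)])
  \<comment> \<open>Quantifying over all multiples makes this an ideal, and it contains every conductor element.\<close>
  define I where "I = {p. \<forall>h. \<exists>r0. \<forall>r\<ge>r0. p * h \<in> W r}"
  have I_E: "\<exists>r0. \<forall>r\<ge>r0. p * h \<in> W r" if "p \<in> I" for p h
    using that by (simp add: I_def)
  have I_I: "p \<in> I" if "\<And>h. \<exists>r0. \<forall>r\<ge>r0. p * h \<in> W r" for p
    using that by (simp add: I_def)
  have "1 \<in> I"
  proof (rule one_mem_ideal_without_common_root)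
    fix p q assume p: "p \<in> I" and q: "q \<in> I"
    show "p + q \<in> I"
    proof (rule I_I)
      fix h
      obtain r0 r1 where "\<forall>r\<ge>r0. p * h \<in> W r" "\<forall>r\<ge>r1. q * h \<in> W r"
        using I_E[OF p, of h] I_E[OF q, of h] by auto
      then have "\<forall>r\<ge>max r0 r1. (p + q) * h \<in> W r"
        by (simp add: distrib_right add)
      then show "\<exists>r0. \<forall>r\<ge>r0. (p + q) * h \<in> W r" ..
    qed
  next
    fix p q assume p: "p \<in> I"
    show "q * p \<in> I"
    proof (rule I_I)
      fix h
      have eq: "q * p * h = p * (q * h)"
        by (simp only: mult_ac)
      show "\<exists>r0. \<forall>r\<ge>r0. q * p * h \<in> W r"
        unfolding eq by (rule I_E[OF p])
    qed
  next
    fix t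
    obtain s where s: "s \<in> W 1" "poly s t \<noteq> 0"
      using base by blast
    have "\<exists>r. \<exists>g\<in>W r. poly g t \<noteq> 0 \<and> (\<forall>h. degree h \<le> e \<longrightarrow> g * h \<in> W (r + 1))"
    proof (rule common_denominator)
      fix h :: "'a poly"
      assume "degree h \<le> e"
      then show "\<exists>r. \<exists>g\<in>W r. poly g t \<noteq> 0 \<and> g * h \<in> W (r + 1)"
        using regular_at_imp_local_denominator[OF reg c s, of h 1] by simp
    qed
    then obtain r g where g: "g \<in> W r" "poly g t \<noteq> 0" "\<And>h. degree h \<le> e \<Longrightarrow> g * h \<in> W (r + 1)"
      by blast
    have "g \<in> I"
    proof (rule I_I)
      fix h :: "'a poly"
      have "g * h \<in> W r'" if "r' \<ge> Suc (r + degree h)" for r'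
      proof -
        define k where "k = r' - Suc r"
        have "degree h \<le> k * 1" "r' = r + Suc k"
          using that by (auto simp: k_def)
        moreover have "k * 1 \<le> Suc k * e"
          using \<open>e > 0\<close> by (intro mult_le_mono) auto
        ultimately show ?thesis
          using conductor_mem[OF base s1 \<open>e > 0\<close> g(1,3), of h k] by simp
      qed
      then have "\<forall>r'\<ge>Suc (r + degree h). g * h \<in> W r'"
        by simp
      then show "\<exists>r0. \<forall>r'\<ge>r0. g * h \<in> W r'" ..
    qed
    then show "\<exists>p\<in>I. poly p t \<noteq> 0"
      using g(2) by blast
  qed
  from I_E[OF this, of 1] obtain r0 where "\<forall>r\<ge>r0. 1 \<in> W r"
    by auto
  then have "1 \<in> W (max r0 1)"
    by simp
  then show ?thesis
    by (intro exI[of _ "max r0 1"] conjI max.cobounded2)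
qed

end

section \<open>Finitely generated semigroups in the plane\<close>

text \<open>Dickson's lemma in dimension two. Relative to one pair \<open>(a, b)\<close> of \<open>U\<close>, the pairs that are not above it
  lie in finitely many rows and columns, and each of these has a least element.\<close>

lemma finite_minimal_pairs:
  fixes U :: "(nat \<times> nat) set"
  shows "\<exists>F\<subseteq>U. finite F \<and> (\<forall>(q, k)\<in>U. \<exists>(q', k')\<in>F. q' \<le> q \<and> k' \<le> k)"
proof (cases "U = {}")
  case False
  then obtain a b where ab: "(a, b) \<in> U"
    by auto
  define f where "f q = (LEAST k. (q, k) \<in> U)" for q
  define g where "g k = (LEAST q. (q, k) \<in> U)" for k
  define F where "F = {(a, b)} \<union> (\<lambda>q. (q, f q)) ` {q. q < a \<and> (\<exists>k. (q, k) \<in> U)}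
    \<union> (\<lambda>k. (g k, k)) ` {k. k < b \<and> (\<exists>q. (q, k) \<in> U)}"
  have f: "(q, f q) \<in> U" "f q \<le> k" if "(q, k) \<in> U" for q k
    unfolding f_def using LeastI[of "\<lambda>k. (q, k) \<in> U" k] Least_le[of "\<lambda>k. (q, k) \<in> U" k] that by simp_all
  have g: "(g k, k) \<in> U" "g k \<le> q" if "(q, k) \<in> U" for q k
    unfolding g_def using LeastI[of "\<lambda>q. (q, k) \<in> U" q] Least_le[of "\<lambda>q. (q, k) \<in> U" q] that by simp_all
  have "F \<subseteq> U"
    using ab f g by (auto simp: F_def)
  moreover have "finite F"
    by (simp add: F_def)
  moreover have "\<exists>(q', k')\<in>F. q' \<le> q \<and> k' \<le> k" if qk: "(q, k) \<in> U" for q k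
  proof -
    consider "q < a" | "k < b" | "a \<le> q" "b \<le> k"
      by linarith
    then show ?thesis
    proof cases
      case 1
      then have "(q, f q) \<in> F"
        using qk by (auto simp: F_def)
      then show ?thesis
        using f(2)[OF qk] by (intro bexI[of _ "(q, f q)"]) auto
    next
      case 2
      then have "(g k, k) \<in> F"
        using qk by (auto simp: F_def)
      then show ?thesis
        using g(2)[OF qk] by (intro bexI[of _ "(g k, k)"]) auto
    next
      case 3
      then show ?thesis
        by (intro bexI[of _ "(a, b)"]) (auto simp: F_def)
    qed
  qed
  ultimately show ?thesis
    by (intro exI[of _ F]) auto
qed auto

text \<open>Let \<open>w = (k\<^sub>0, k\<^sub>0 e)\<close> be the point on the upper edge. Dividing the second coordinate by \<open>k\<^sub>0 e\<close> shows
  that every lattice point of the cone is \<open>(0, r)\<close> plus a combination of \<open>(1, 0)\<close> and \<open>w\<close> with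
  coefficients in the natural numbers and \<open>r < k\<^sub>0 e\<close>. For each of the finitely many \<open>r\<close>, the
  pairs of coefficients that give points of \<open>T\<close> lie above finitely many minimal ones. So a point of
  \<open>T\<close> is one of finitely many points of \<open>T\<close> plus copies of \<open>(1, 0)\<close> and \<open>w\<close>.\<close>

lemma fg_semigroup_of_edges:
  fixes T :: "(int \<times> int) set" and k\<^sub>0 e :: nat
  assumes sub: "\<And>x. x \<in> T \<Longrightarrow> \<exists>k a. x = (int k, int a) \<and> a \<le> k * e"
    and add: "\<And>x y. x \<in> T \<Longrightarrow> y \<in> T \<Longrightarrow> x + y \<in> T"
    and lower: "(1, 0) \<in> T" and upper: "(int k\<^sub>0, int (k\<^sub>0 * e)) \<in> T"
    and pos: "k\<^sub>0 > 0" "e > 0"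
  shows "fg_semigroup T"
proof -
  define M where "M = k\<^sub>0 * e"
  have "M > 0"
    using pos by (simp add: M_def)
  define pt where "pt r x = (int (snd x + fst x * k\<^sub>0), int (r + fst x * M))" for r :: nat and x :: "nat \<times> nat"
  define U where "U r = {x. pt r x \<in> T}" for r
  define F where "F r = (SOME F. F \<subseteq> U r \<and> finite F \<and> (\<forall>(q, k)\<in>U r. \<exists>(q', k')\<in>F. q' \<le> q \<and> k' \<le> k))" for r
  have F_some: "F r \<subseteq> U r \<and> finite (F r) \<and> (\<forall>(q, k)\<in>U r. \<exists>(q', k')\<in>F r. q' \<le> q \<and> k' \<le> k)" for r
    unfolding F_def by (rule someI_ex[OF finite_minimal_pairs])
  have F: "F r \<subseteq> U r" "finite (F r)" for r
    using F_some[of r] by simp_all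
  have F_min: "\<exists>q' k'. (q', k') \<in> F r \<and> q' \<le> q \<and> k' \<le> k" if "(q, k) \<in> U r" for r q k
    using F_some[of r] that by fast
  define w where "w = (int k\<^sub>0, int M)"
  define B where "B = {(1, 0), w} \<union> (\<Union>r<M. pt r ` F r)"
  have "pt r x \<in> T" if "x \<in> F r" for r x
    using F(1)[of r] that by (auto simp: U_def)
  then have B_T: "B \<subseteq> T"
    using lower upper unfolding B_def w_def M_def by blast
  have "finite B"
    using F(2) by (simp add: B_def)
  have gen: "T \<subseteq> V" if V: "B \<subseteq> V" "\<And>x y. x \<in> V \<Longrightarrow> y \<in> V \<Longrightarrow> x + y \<in> V" for V
  proof
    fix x assume x: "x \<in> T"
    then obtain k a where ka: "x = (int k, int a)" "a \<le> k * e"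
      using sub by blast
    define q r where "q = a div M" and "r = a mod M"
    have a: "a = r + q * M" "r < M"
      using \<open>M > 0\<close> by (auto simp: q_def r_def)
    have "q * k\<^sub>0 * e \<le> a"
      unfolding a(1) by (simp add: M_def mult.assoc)
    then have "q * k\<^sub>0 * e \<le> k * e"
      using ka(2) by (rule le_trans)
    then have k: "q * k\<^sub>0 \<le> k"
      using pos(2) by simp
    then have x_eq: "x = pt r (q, k - q * k\<^sub>0)"
      using ka(1) a(1) by (simp add: pt_def)
    then obtain q' k' where qk: "(q', k') \<in> F r" "q' \<le> q" "k' \<le> k - q * k\<^sub>0"
      using F_min[of q "k - q * k\<^sub>0" r] x unfolding U_def by blast
    have step1: "y + (int i, 0) \<in> V" if "y \<in> V" for y i
    proof (induction i)
      case (Suc i)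
      have "(1, 0) \<in> V"
        using V(1) by (auto simp: B_def)
      from V(2)[OF Suc this] have "y + (int i, 0) + (1, 0) \<in> V" .
      also have "y + (int i, 0) + (1, 0) = y + (int (Suc i), 0)"
        by (cases y) simp
      finally show ?case .
    qed (use that in \<open>simp flip: zero_prod_def\<close>)
    have step2: "y + (int (i * k\<^sub>0), int (i * M)) \<in> V" if "y \<in> V" for y i
    proof (induction i)
      case (Suc i)
      have "w \<in> V"
        using V(1) by (auto simp: B_def)
      from V(2)[OF Suc this] have "y + (int (i * k\<^sub>0), int (i * M)) + w \<in> V" .
      also have "y + (int (i * k\<^sub>0), int (i * M)) + w = y + (int (Suc i * k\<^sub>0), int (Suc i * M))"
        by (cases y) (simp add: w_def)
      finally show ?case .
    qed (use that in \<open>simp flip: zero_prod_def\<close>)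
    have "pt r (q', k') \<in> V"
      using V(1) qk(1) a(2) by (auto simp: B_def)
    from step2[OF step1[OF this, of "k - q * k\<^sub>0 - k'"], of "q - q'"]
    have "pt r (q', k') + (int (k - q * k\<^sub>0 - k'), 0) + (int ((q - q') * k\<^sub>0), int ((q - q') * M)) \<in> V" .
    also have "pt r (q', k') + (int (k - q * k\<^sub>0 - k'), 0) + (int ((q - q') * k\<^sub>0), int ((q - q') * M)) = x"
      unfolding x_eq pt_def using qk(2,3)
      by (simp add: of_nat_diff algebra_simps)
    finally show "x \<in> V" .
  qed
  have "T = (\<lambda>U. \<forall>x\<in>U. \<forall>y\<in>U. x + y \<in> U) hull B"
  proof
    show "T \<subseteq> (\<lambda>U. \<forall>x\<in>U. \<forall>y\<in>U. x + y \<in> U) hull B"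
      unfolding hull_def by (intro Inter_greatest gen) auto
    show "(\<lambda>U. \<forall>x\<in>U. \<forall>y\<in>U. x + y \<in> U) hull B \<subseteq> T"
      by (rule hull_minimal) (use B_T add in auto)
  qed
  with \<open>finite B\<close> show ?thesis
    unfolding fg_semigroup_def by blast
qed

section \<open>Rank of subgroups of the plane\<close>

lemma zscale_pair: "zscale c (a, b) = (c * a, c * b :: int)"
proof -
  have "(\<Sum>i<k. (a, b)) = (int k * a, int k * b)" for k
    by (induction k) (simp_all add: zero_prod_def algebra_simps)
  then show ?thesis
    by (cases "c \<ge> 0") (simp_all add: zscale_def)
qed

interpretation zmod: Modules.module "zscale :: int \<Rightarrow> int \<times> int \<Rightarrow> int \<times> int"
  by unfold_locales (auto simp: zscale_pair algebra_simps split_paired_all)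

text \<open>The three \<open>2 \<times> 2\<close> minors of three vectors are the coefficients of a relation between them. Two
  independent vectors have a nonzero minor, so the relation is nontrivial.\<close>

lemma group_rank_plane_le: "group_rank (A :: (int \<times> int) set) \<le> 2"
  unfolding group_rank_def
proof (rule Sup_least, clarify)
  fix B :: "(int \<times> int) set" assume B: "finite B" "\<not> module.dependent zscale B"
  have dep: False if "C \<subseteq> B" "finite C" "(\<Sum>x\<in>C. zscale (u x) x) = 0" "x \<in> C" "u x \<noteq> 0" for u C x
    using zmod.independentD[OF B(2) that(2,1,3,4)] that(5) by blast
  have det: "a * d \<noteq> b * c" if "(a, b) \<in> B" "(c, d) \<in> B" "(a, b) \<noteq> (c, d)" for a b c d
  proof
    assume eq: "a * d = b * c"
    have nz: "x \<noteq> 0" if "x \<in> B" for x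
      using dep[of "{x}" "\<lambda>_. 1" x] that by auto
    define u1 where "u1 x = (if x = (a, b) then c else - a)" for x :: "int \<times> int"
    define u2 where "u2 x = (if x = (a, b) then d else - b)" for x :: "int \<times> int"
    have "(\<Sum>x\<in>{(a, b), (c, d)}. zscale (u1 x) x) = 0" "(\<Sum>x\<in>{(a, b), (c, d)}. zscale (u2 x) x) = 0"
      using that(3) eq by (subst sum.insert; force simp: u1_def u2_def zscale_pair zero_prod_def mult.commute)+
    then have "u1 (c, d) = 0" "u2 (c, d) = 0"
      using dep[of "{(a, b), (c, d)}" u1 "(c, d)"] dep[of "{(a, b), (c, d)}" u2 "(c, d)"] that by auto
    then have "a = 0" "b = 0"
      using that(3) by (auto simp: u1_def u2_def)
    then show False
      using nz[OF that(1)] by (simp add: zero_prod_def)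
  qed
  have "card B \<le> 2"
  proof (rule ccontr)
    assume "\<not> card B \<le> 2"
    then obtain C where C: "C \<subseteq> B" "card C = 3"
      using obtain_subset_with_card_n[of 3 B] by (metis nat_le_linear not_less_eq_eq numeral_2_eq_2 numeral_3_eq_3)
    then obtain x y z where xyz: "C = {x, y, z}" "x \<noteq> y" "x \<noteq> z" "y \<noteq> z"
      by (auto simp: card_3_iff)
    obtain a b where x: "x = (a, b)" by (cases x)
    obtain c d where y: "y = (c, d)" by (cases y)
    obtain f g where z: "z = (f, g)" by (cases z)
    define u where "u w = (if w = x then c * g - d * f else if w = y then b * f - a * g else a * d - b * c)" for w
    have "(\<Sum>w\<in>C. zscale (u w) w) = 0"
      unfolding xyz(1) using xyz(2-) by (auto simp: u_def x y z zscale_pair zero_prod_def algebra_simps)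
    moreover have "u z \<noteq> 0"
      using det[of a b c d] xyz C(1) by (auto simp: u_def x y z)
    ultimately show False
      using dep[of C u z] xyz(1) C(1) by auto
  qed
  then show "enat (card B) \<le> 2"
    by (simp add: numeral_eq_enat)
qed

lemma group_rank_span_eq_2:
  fixes A :: "(int \<times> int) set"
  assumes "(1, 0) \<in> A" "(k, a) \<in> A" "a \<noteq> 0"
  shows "group_rank (module.span zscale A) = 2"
proof (rule antisym[OF group_rank_plane_le])
  let ?B = "{(1, 0), (k, a)}"
  have "?B \<subseteq> zmod.span A"
    using assms zmod.span_superset[of A] by auto
  moreover have "\<not> zmod.dependent ?B"
  proof
    assume "zmod.dependent ?B"
    then obtain t u v where t: "finite t" "t \<subseteq> ?B" "(\<Sum>v\<in>t. zscale (u v) v) = 0" "v \<in> t" "u v \<noteq> 0"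
      unfolding zmod.dependent_explicit by blast
    define u' where "u' x = (if x \<in> t then u x else 0)" for x
    have "(\<Sum>v\<in>?B. zscale (u' v) v) = (\<Sum>v\<in>t. zscale (u v) v)"
      using t(2) by (intro sum.mono_neutral_cong_right) (auto simp: u'_def zscale_pair zero_prod_def)
    then have "(u' (1, 0) + u' (k, a) * k, u' (k, a) * a) = 0"
      using assms(3) t(3) by (simp add: zscale_pair)
    then have "u' (1, 0) = 0" "u' (k, a) = 0"
      using assms(3) by (auto simp: zero_prod_def)
    then show False
      using t by (auto simp: u'_def)
  qed
  moreover have "card ?B = 2"
    using assms(3) by simp
  ultimately show "2 \<le> group_rank (zmod.span A)"
    unfolding group_rank_def by (intro Sup_upper2[of "enat 2"]) (auto simp: numeral_eq_enat intro!: exI[of _ ?B])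
qed

section \<open>Substitution into polynomials\<close>

definition monom_val :: "(nat \<Rightarrow> 'b::comm_ring_1) \<Rightarrow> (nat \<Rightarrow>\<^sub>0 nat) \<Rightarrow> 'b" where
  "monom_val s m = (\<Prod>i\<in>Poly_Mapping.keys m. s i ^ Poly_Mapping.lookup m i)"

lemma monom_val_superset:
  assumes "finite S" "Poly_Mapping.keys m \<subseteq> S"
  shows "monom_val s m = (\<Prod>i\<in>S. s i ^ Poly_Mapping.lookup m i)"
  unfolding monom_val_def using assms
  by (intro prod.mono_neutral_left) (auto simp: in_keys_iff)

lemma mdeg_superset:
  assumes "finite S" "Poly_Mapping.keys m \<subseteq> S"
  shows "mdeg m = (\<Sum>i\<in>S. Poly_Mapping.lookup m i)"
  unfolding mdeg_def using assms
  by (intro sum.mono_neutral_left) (auto simp: in_keys_iff)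

lemma keys_add_nat: "Poly_Mapping.keys (m + m' :: nat \<Rightarrow>\<^sub>0 nat) = Poly_Mapping.keys m \<union> Poly_Mapping.keys m'"
  by (auto simp: in_keys_iff lookup_add)

lemma monom_val_add: "monom_val s (m + m') = monom_val s m * monom_val s m'"
proof -
  let ?S = "Poly_Mapping.keys m \<union> Poly_Mapping.keys m'"
  have "monom_val s (m + m') = (\<Prod>i\<in>?S. s i ^ Poly_Mapping.lookup (m + m') i)"
    by (rule monom_val_superset) (auto simp: keys_add_nat)
  also have "\<dots> = (\<Prod>i\<in>?S. s i ^ Poly_Mapping.lookup m i) * (\<Prod>i\<in>?S. s i ^ Poly_Mapping.lookup m' i)"
    by (simp add: lookup_add power_add prod.distrib)
  also have "\<dots> = monom_val s m * monom_val s m'"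
    by (simp add: monom_val_superset[of ?S])
  finally show ?thesis .
qed

lemma mdeg_add: "mdeg (m + m') = mdeg m + mdeg m'"
proof -
  let ?S = "Poly_Mapping.keys m \<union> Poly_Mapping.keys m'"
  have "mdeg (m + m') = (\<Sum>i\<in>?S. Poly_Mapping.lookup (m + m') i)"
    by (rule mdeg_superset) (auto simp: keys_add_nat)
  also have "\<dots> = (\<Sum>i\<in>?S. Poly_Mapping.lookup m i) + (\<Sum>i\<in>?S. Poly_Mapping.lookup m' i)"
    by (simp add: lookup_add sum.distrib)
  also have "\<dots> = mdeg m + mdeg m'"
    by (simp add: mdeg_superset[of ?S])
  finally show ?thesis .
qed

lemma monom_val_0 [simp]: "monom_val s 0 = 1"
  by (simp add: monom_val_def)

lemma mdeg_0 [simp]: "mdeg 0 = 0"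
  by (simp add: mdeg_def)

lemma monom_val_single [simp]: "monom_val s (Poly_Mapping.single i k) = s i ^ k"
  by (cases "k = 0") (simp_all add: monom_val_def)

lemma mdeg_single [simp]: "mdeg (Poly_Mapping.single i k) = k"
  by (cases "k = 0") (simp_all add: mdeg_def)

lemma mpoly_eq_sum_single: "F = (\<Sum>m\<in>Poly_Mapping.keys F. Poly_Mapping.single m (Poly_Mapping.lookup F m))"
proof (rule poly_mapping_eqI)
  fix k
  have "Poly_Mapping.lookup (\<Sum>m\<in>Poly_Mapping.keys F. Poly_Mapping.single m (Poly_Mapping.lookup F m)) k
    = (\<Sum>m\<in>Poly_Mapping.keys F. if m = k then Poly_Mapping.lookup F k else 0)"
    unfolding lookup_sum by (rule sum.cong) (auto simp: lookup_single when_def)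
  also have "\<dots> = Poly_Mapping.lookup F k"
    by (auto simp: in_keys_iff)
  finally show "Poly_Mapping.lookup F k = Poly_Mapping.lookup
    (\<Sum>m\<in>Poly_Mapping.keys F. Poly_Mapping.single m (Poly_Mapping.lookup F m)) k" ..
qed

lemma single_eq_Cst_mult: "Poly_Mapping.single m c = Cst c * Poly_Mapping.single m 1"
  by (simp add: Cst_def mult_single)

lemma Cst_0 [simp]: "Cst 0 = 0" and Cst_1 [simp]: "Cst 1 = 1"
  by (simp_all add: Cst_def)

lemma Cst_add: "Cst (a + b) = Cst a + Cst b"
  by (simp add: Cst_def single_add)

lemma Cst_mult: "Cst (a * b) = Cst a * Cst b"
  by (simp add: Cst_def mult_single)

lemma Cst_minus: "Cst (- a) = - Cst a"
  by (simp add: Cst_def single_uminus)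

lemma Cst_eq_0_iff [simp]: "Cst c = 0 \<longleftrightarrow> c = 0"
  using inj_single[of "0 :: nat \<Rightarrow>\<^sub>0 nat"] by (metis Cst_0 Cst_def inj_def)

locale scalar_hom =
  fixes h :: "'a::comm_ring_1 \<Rightarrow> 'b::comm_ring_1"
  assumes h_add: "h (a + b) = h a + h b"
    and h_mult: "h (a * b) = h a * h b"
    and h_1: "h 1 = 1"
begin

lemma h_0: "h 0 = 0"
  using h_add[of 0 0] by simp

lemma subst_superset:
  assumes "finite S" "Poly_Mapping.keys F \<subseteq> S"
  shows "subst h s F = (\<Sum>m\<in>S. h (Poly_Mapping.lookup F m) * monom_val s m)"
  unfolding subst_def monom_val_def[symmetric] using assms
  by (intro sum.mono_neutral_left) (auto simp: in_keys_iff h_0)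

lemma subst_add: "subst h s (F + G) = subst h s F + subst h s G"
proof -
  let ?S = "Poly_Mapping.keys F \<union> Poly_Mapping.keys G"
  have "subst h s (F + G) = (\<Sum>m\<in>?S. h (Poly_Mapping.lookup (F + G) m) * monom_val s m)"
    by (rule subst_superset) (auto simp: keys_add)
  also have "\<dots> = subst h s F + subst h s G"
    by (simp add: lookup_add h_add distrib_right sum.distrib subst_superset[of ?S])
  finally show ?thesis .
qed

lemma subst_0 [simp]: "subst h s 0 = 0"
  by (simp add: subst_def)

lemma subst_minus: "subst h s (- F) = - subst h s F"
  using subst_add[of s F "- F"] by (simp add: eq_neg_iff_add_eq_0 add.commute)

lemma subst_diff: "subst h s (F - G) = subst h s F - subst h s G"
  using subst_add[of s F "- G"] by (simp add: subst_minus)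

lemma subst_sum: "subst h s (sum f A) = (\<Sum>i\<in>A. subst h s (f i))"
  by (induction A rule: infinite_finite_induct) (simp_all add: subst_add)

lemma subst_single: "subst h s (Poly_Mapping.single m c) = h c * monom_val s m"
  by (cases "c = 0") (simp_all add: subst_def monom_val_def h_0)

lemma subst_Cst [simp]: "subst h s (Cst c) = h c"
  by (simp add: Cst_def subst_single)

lemma subst_1 [simp]: "subst h s 1 = 1"
  using subst_Cst[of s 1] by (simp add: h_1)

lemma subst_Var [simp]: "subst h s (Var i) = s i"
  by (simp add: Var_def subst_single h_1)

lemma subst_mult: "subst h s (F * G) = subst h s F * subst h s G"
proof -
  let ?f = "\<lambda>F m. Poly_Mapping.single m (Poly_Mapping.lookup F m)"
  have "subst h s (F * G) = subst h s ((\<Sum>m\<in>Poly_Mapping.keys F. ?f F m) * (\<Sum>m\<in>Poly_Mapping.keys G. ?f G m))"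
    using mpoly_eq_sum_single[of F] mpoly_eq_sum_single[of G] by simp
  also have "\<dots> = (\<Sum>m\<in>Poly_Mapping.keys F. \<Sum>m'\<in>Poly_Mapping.keys G. subst h s (?f F m * ?f G m'))"
    by (simp add: sum_product subst_sum)
  also have "\<dots> = (\<Sum>m\<in>Poly_Mapping.keys F. \<Sum>m'\<in>Poly_Mapping.keys G. subst h s (?f F m) * subst h s (?f G m'))"
    by (intro sum.cong refl) (simp add: mult_single subst_single h_mult monom_val_add mult_ac)
  also have "\<dots> = subst h s (\<Sum>m\<in>Poly_Mapping.keys F. ?f F m) * subst h s (\<Sum>m\<in>Poly_Mapping.keys G. ?f G m)"
    by (simp add: sum_product subst_sum)
  also have "\<dots> = subst h s F * subst h s G"
    using mpoly_eq_sum_single[of F] mpoly_eq_sum_single[of G] by simp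
  finally show ?thesis .
qed

lemma subst_power: "subst h s (F ^ k) = subst h s F ^ k"
  by (induction k) (simp_all add: subst_mult)

lemma subst_prod: "subst h s (prod f A) = (\<Prod>i\<in>A. subst h s (f i))"
  by (induction A rule: infinite_finite_induct) (simp_all add: subst_mult)

lemma subst_compose: "subst h s (compose t F) = subst h (\<lambda>i. subst h s (t i)) F"
  by (simp add: subst_def[of Cst] subst_sum subst_mult subst_prod subst_power)
    (simp add: subst_def)

text \<open>An induction principle for forms: a property that depends on a degree, holds for constants and
  variables, and passes to sums and products holds for all forms, with \<open>h\<close> and \<open>s\<close> the inclusions.\<close>

lemma subst_mem_graded:
  assumes F: "F \<in> forms n k"
    and zero: "\<And>k. 0 \<in> W k" and add: "\<And>k p q. p \<in> W k \<Longrightarrow> q \<in> W k \<Longrightarrow> p + q \<in> W k"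
    and mult: "\<And>j k p q. p \<in> W j \<Longrightarrow> q \<in> W k \<Longrightarrow> p * q \<in> W (j + k)"
    and h: "\<And>c. h c \<in> W 0" and s: "\<And>i. i \<le> n \<Longrightarrow> s i \<in> W 1"
  shows "subst h s F \<in> W k"
proof -
  have sum_mem: "sum f A \<in> W k" if "\<And>i. i \<in> A \<Longrightarrow> f i \<in> W k" for f :: "(nat \<Rightarrow>\<^sub>0 nat) \<Rightarrow> 'b" and A k
    using that by (induction A rule: infinite_finite_induct) (simp_all add: zero add)
  have one: "1 \<in> W 0"
    using h[of 1] by (simp add: h_1)
  have pow: "p ^ j \<in> W j" if "p \<in> W 1" for p j
  proof (induction j)
    case (Suc j)
    then show ?case
      using mult[OF that Suc] by simp
  qed (simp add: one)
  have mon: "(\<Prod>i\<in>A. s i ^ l i) \<in> W (\<Sum>i\<in>A. l i)" if "finite A" "A \<subseteq> {..n}" for A l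
    using that
  proof (induction A)
    case (insert i A)
    then show ?case
      using mult[OF pow[OF s[of i], of "l i"]] by simp
  qed (simp add: one)
  show ?thesis
    unfolding subst_def
  proof (rule sum_mem)
    fix m assume m: "m \<in> Poly_Mapping.keys F"
    then have "Poly_Mapping.keys m \<subseteq> {..n}" "mdeg m = k"
      using F by (auto simp: forms_def mpolys_def)
    with mon[of "Poly_Mapping.keys m" "Poly_Mapping.lookup m"]
    have "(\<Prod>i\<in>Poly_Mapping.keys m. s i ^ Poly_Mapping.lookup m i) \<in> W k"
      by (simp add: mdeg_def)
    from mult[OF h this] show "h (Poly_Mapping.lookup F m) *
        (\<Prod>i\<in>Poly_Mapping.keys m. s i ^ Poly_Mapping.lookup m i) \<in> W k"
      by simp
  qed
qed

end

interpretation Cst: scalar_hom Cst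
  by unfold_locales (simp_all add: Cst_add Cst_mult)

interpretation id: scalar_hom id
  by unfold_locales simp_all

interpretation pconst: scalar_hom "\<lambda>c::'a::comm_ring_1. [:c:]"
  by unfold_locales (simp_all add: one_pCons)

lemma monom_val_Var: "monom_val Var m = Poly_Mapping.single m 1"
proof -
  have "(\<Prod>i\<in>A. (Var i :: 'a mpoly) ^ l i) = Poly_Mapping.single (\<Sum>i\<in>A. Poly_Mapping.single i (l i)) 1"
    if "finite A" for A and l :: "nat \<Rightarrow> nat"
    using that
  proof (induction A)
    case (insert i A)
    have "(Var i :: 'a mpoly) ^ k = Poly_Mapping.single (Poly_Mapping.single i k) 1" for k
      by (induction k) (simp_all add: Var_def mult_single single_add[symmetric])
    then show ?case
      using insert by (simp add: mult_single)
  qed simp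
  then show ?thesis
    unfolding monom_val_def using mpoly_eq_sum_single[of m] by simp
qed

lemma compose_Var [simp]: "compose Var F = F"
  using mpoly_eq_sum_single[of F]
  by (simp add: Cst.subst_superset[of "Poly_Mapping.keys F"] monom_val_Var single_eq_Cst_mult[symmetric])

section \<open>Forms\<close>

lemma mpolys_0 [simp]: "0 \<in> mpolys n"
  and forms_0 [simp]: "0 \<in> forms n k"
  by (simp_all add: mpolys_def forms_def)

lemma mpolys_add: "F \<in> mpolys n \<Longrightarrow> G \<in> mpolys n \<Longrightarrow> F + G \<in> mpolys n"
  using keys_add[of F G] by (auto simp: mpolys_def)

lemma forms_add: "F \<in> forms n k \<Longrightarrow> G \<in> forms n k \<Longrightarrow> F + G \<in> forms n k"
  using keys_add[of F G] mpolys_add[of F n G] by (auto simp: forms_def)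

lemma keys_uminus: "Poly_Mapping.keys (- F :: 'a::comm_ring_1 mpoly) = Poly_Mapping.keys F"
  by (auto simp: in_keys_iff)

lemma mpolys_uminus: "F \<in> mpolys n \<Longrightarrow> - F \<in> mpolys n"
  by (simp add: mpolys_def keys_uminus)

lemma forms_uminus: "F \<in> forms n k \<Longrightarrow> - F \<in> forms n k"
  by (simp add: forms_def mpolys_uminus keys_uminus)

lemma mpolys_mult:
  assumes "F \<in> mpolys n" "G \<in> mpolys n"
  shows "F * G \<in> mpolys n"
proof -
  have "Poly_Mapping.keys m \<subseteq> {..n}" if m: "m \<in> Poly_Mapping.keys (F * G)" for m
  proof -
    obtain a b where "m = a + b" "a \<in> Poly_Mapping.keys F" "b \<in> Poly_Mapping.keys G"
      using keys_mult[of F G] m by blast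
    then show ?thesis
      using assms by (simp add: keys_add_nat mpolys_def)
  qed
  then show ?thesis
    by (simp add: mpolys_def)
qed

lemma forms_mult:
  assumes "F \<in> forms n j" "G \<in> forms n k"
  shows "F * G \<in> forms n (j + k)"
proof -
  have "mdeg m = j + k" if m: "m \<in> Poly_Mapping.keys (F * G)" for m
  proof -
    obtain a b where "m = a + b" "a \<in> Poly_Mapping.keys F" "b \<in> Poly_Mapping.keys G"
      using keys_mult[of F G] m by blast
    then show ?thesis
      using assms by (simp add: mdeg_add forms_def)
  qed
  then show ?thesis
    using assms mpolys_mult by (auto simp: forms_def)
qed

lemma forms_Cst [simp]: "Cst c \<in> forms n 0"
  by (cases "c = 0") (simp_all add: forms_def mpolys_def Cst_def)

lemma forms_1 [simp]: "1 \<in> forms n 0"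
  using forms_Cst[of 1 n] by simp

lemma forms_Var: "i \<le> n \<Longrightarrow> Var i \<in> forms n 1"
  by (simp add: forms_def mpolys_def Var_def)

lemma forms_imp_mpolys: "F \<in> forms n k \<Longrightarrow> F \<in> mpolys n"
  by (simp add: forms_def)

lemma forms_scale: "F \<in> forms n k \<Longrightarrow> Cst c * F \<in> forms n k"
  using forms_mult[OF forms_Cst] by fastforce

lemma forms_sum: "(\<And>i. i \<in> A \<Longrightarrow> f i \<in> forms n k) \<Longrightarrow> sum f A \<in> forms n k"
  by (induction A rule: infinite_finite_induct) (simp_all add: forms_add)

lemma forms_power: "F \<in> forms n k \<Longrightarrow> F ^ j \<in> forms n (j * k)"
proof (induction j)
  case (Suc j)
  then show ?case
    using forms_mult[OF Suc.prems Suc.IH[OF Suc.prems]] by simp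
qed simp

lemma mpolys_1 [simp]: "1 \<in> mpolys n"
  using forms_1 by (rule forms_imp_mpolys)

lemma mpolys_power: "F \<in> mpolys n \<Longrightarrow> F ^ j \<in> mpolys n"
  by (induction j) (simp_all add: mpolys_mult)

lemma compose_mem_forms:
  assumes "F \<in> forms n k" "\<And>i. i \<le> n \<Longrightarrow> s i \<in> forms n' e"
  shows "compose s F \<in> forms n' (k * e)"
  by (rule Cst.subst_mem_graded[OF assms(1), where W = "\<lambda>k. forms n' (k * e)"])
    (use assms(2) forms_mult in \<open>auto simp: distrib_right intro: forms_add\<close>)

lemma forms_0_eq_Cst:
  assumes "F \<in> forms n 0"
  shows "F = Cst (Poly_Mapping.lookup F 0)"
proof (rule poly_mapping_eqI)
  fix m
  show "Poly_Mapping.lookup F m = Poly_Mapping.lookup (Cst (Poly_Mapping.lookup F 0)) m"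
  proof (cases "m = 0")
    case False
    then obtain i where i: "i \<in> Poly_Mapping.keys m"
      by (metis keys_eq_empty ex_in_conv)
    then have "Poly_Mapping.lookup m i \<le> mdeg m"
      unfolding mdeg_def by (intro member_le_sum) auto
    with i have "mdeg m \<noteq> 0"
      by (simp add: in_keys_iff)
    with assms have "m \<notin> Poly_Mapping.keys F"
      by (auto simp: forms_def)
    with False show ?thesis
      by (simp add: Cst_def lookup_single in_keys_iff)
  qed (simp add: Cst_def)
qed

section \<open>Dehomogenization at a point of the projective line\<close>

text \<open>The points of the projective line other than \<open>P\<close> are the \<open>v + t P\<close>. The normalization of \<open>v\<close> says
  that the linear form \<open>lin\<close>, which vanishes at \<open>P\<close>, is \<open>1\<close> on this line; \<open>lin'\<close> is the
  coordinate \<open>t\<close> on it.\<close>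

locale dehomogenization =
  fixes P v :: "nat \<Rightarrow> 'a::field"
  assumes Pv: "P 1 * v 0 - P 0 * v 1 = 1"
begin

definition dehom :: "'a mpoly \<Rightarrow> 'a poly" where
  "dehom = subst (\<lambda>c. [:c:]) (\<lambda>i. [:v i, P i:])"

definition lin :: "'a mpoly" where
  "lin = scale (P 1) (Var 0) - scale (P 0) (Var 1)"

definition lin' :: "'a mpoly" where
  "lin' = scale (v 0) (Var 1) - scale (v 1) (Var 0)"

definition homogenize :: "nat \<Rightarrow> 'a poly \<Rightarrow> 'a mpoly" where
  "homogenize m p = (\<Sum>i\<le>m. Cst (coeff p i) * lin' ^ i * lin ^ (m - i))"

lemma dehom_simps [simp]:
  "dehom 0 = 0" "dehom 1 = 1" "dehom (Cst c) = [:c:]" "dehom (Var i) = [:v i, P i:]"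
  "dehom (F + G) = dehom F + dehom G" "dehom (F - G) = dehom F - dehom G" "dehom (- F) = - dehom F"
  "dehom (F * G) = dehom F * dehom G" "dehom (F ^ k) = dehom F ^ k"
  by (simp_all add: dehom_def pconst.subst_add pconst.subst_diff pconst.subst_minus
      pconst.subst_mult pconst.subst_power)

lemma dehom_sum: "dehom (sum f A) = (\<Sum>i\<in>A. dehom (f i))"
  by (simp add: dehom_def pconst.subst_sum)

lemma dehom_lin: "dehom lin = 1"
  using Pv by (simp add: lin_def one_pCons mult.commute)

lemma Var_eq: "Var i = Cst (v i) * lin + Cst (P i) * lin'" if "i \<le> 1" for i
proof -
  have 1: "Cst (P 1) * Cst (v 0) - Cst (P 0) * Cst (v 1) = (1 :: 'a mpoly)"
    using arg_cong[OF Pv, of Cst] by (simp add: Cst_mult Cst.subst_diff Cst_add Cst_minus diff_conv_add_uminus del: add_uminus_conv_diff)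
  have "Cst (v 0) * lin + Cst (P 0) * lin' = (Cst (P 1) * Cst (v 0) - Cst (P 0) * Cst (v 1)) * Var 0"
    "Cst (v 1) * lin + Cst (P 1) * lin' = (Cst (P 1) * Cst (v 0) - Cst (P 0) * Cst (v 1)) * Var 1"
    by (simp_all add: lin_def lin'_def algebra_simps)
  then show ?thesis
    using that unfolding 1 by (cases "i = 0") (auto simp: le_Suc_eq)
qed

lemma homogenize_add: "homogenize m (p + q) = homogenize m p + homogenize m q"
  by (simp add: homogenize_def Cst_add distrib_right sum.distrib)

lemma homogenize_0 [simp]: "homogenize m 0 = 0"
  by (simp add: homogenize_def)

lemma homogenize_sum: "homogenize m (sum f A) = (\<Sum>i\<in>A. homogenize m (f i))"
  by (induction A rule: infinite_finite_induct) (simp_all add: homogenize_add)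

lemma homogenize_monom: "i \<le> m \<Longrightarrow> homogenize m (monom c i) = Cst c * lin' ^ i * lin ^ (m - i)"
proof -
  assume i: "i \<le> m"
  have "homogenize m (monom c i) = (\<Sum>j\<le>m. if j = i then Cst c * lin' ^ i * lin ^ (m - i) else 0)"
    unfolding homogenize_def by (rule sum.cong) auto
  also have "\<dots> = Cst c * lin' ^ i * lin ^ (m - i)"
    using i by simp
  finally show ?thesis .
qed

lemma homogenize_mult:
  assumes "degree p \<le> m" "degree q \<le> m'"
  shows "homogenize (m + m') (p * q) = homogenize m p * homogenize m' q"
proof -
  have p: "p = (\<Sum>i\<le>m. monom (coeff p i) i)" and q: "q = (\<Sum>i\<le>m'. monom (coeff q i) i)"
    using assms by (simp_all add: poly_as_sum_of_monoms')
  have "homogenize (m + m') (p * q) = homogenize (m + m') ((\<Sum>i\<le>m. monom (coeff p i) i) * (\<Sum>i\<le>m'. monom (coeff q i) i))"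
    using p q by simp
  also have "\<dots> = (\<Sum>i\<le>m. \<Sum>j\<le>m'. homogenize (m + m') (monom (coeff p i * coeff q j) (i + j)))"
    by (simp add: sum_product homogenize_sum mult_monom)
  also have "\<dots> = (\<Sum>i\<le>m. \<Sum>j\<le>m'. (Cst (coeff p i) * lin' ^ i * lin ^ (m - i)) *
      (Cst (coeff q j) * lin' ^ j * lin ^ (m' - j)))"
  proof (intro sum.cong refl)
    fix i j assume "i \<in> {..m}" "j \<in> {..m'}"
    then have "m + m' - (i + j) = (m - i) + (m' - j)" "i + j \<le> m + m'"
      by auto
    then show "homogenize (m + m') (monom (coeff p i * coeff q j) (i + j)) =
        (Cst (coeff p i) * lin' ^ i * lin ^ (m - i)) * (Cst (coeff q j) * lin' ^ j * lin ^ (m' - j))"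
      by (simp only: homogenize_monom Cst_mult power_add mult_ac)
  qed
  also have "\<dots> = homogenize m p * homogenize m' q"
    by (simp add: homogenize_def sum_product)
  finally show ?thesis .
qed

text \<open>True for the two variables, and inherited by sums and products.\<close>

lemma forms_dehom:
  assumes "F \<in> forms 1 m"
  shows "degree (dehom F) \<le> m \<and> homogenize m (dehom F) = F"
proof -
  let ?W = "\<lambda>m. {F. degree (dehom F) \<le> m \<and> homogenize m (dehom F) = F}"
  have "compose Var F \<in> ?W m"
  proof (rule Cst.subst_mem_graded[OF assms])
    fix k p q assume "p \<in> ?W k" "q \<in> ?W k"
    then show "p + q \<in> ?W k"
      by (simp add: homogenize_add degree_add_le)
  next
    fix j k p q assume "p \<in> ?W j" "q \<in> ?W k"
    then show "p * q \<in> ?W (j + k)"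
      using degree_mult_le[of "dehom p" "dehom q"] by (simp add: homogenize_mult)
  next
    fix i :: nat assume i: "i \<le> 1"
    have "homogenize 1 (dehom (Var i)) = Cst (v i) * lin + Cst (P i) * lin'"
      by (simp add: homogenize_def)
    then have "homogenize 1 (dehom (Var i)) = Var i"
      unfolding Var_eq[OF i, symmetric] .
    then show "Var i \<in> ?W 1"
      by simp
  qed (simp_all add: homogenize_def)
  then show ?thesis
    by simp
qed

lemma degree_dehom: "F \<in> forms 1 m \<Longrightarrow> degree (dehom F) \<le> m"
  using forms_dehom by blast

lemma dehom_eq_0_iff: "F \<in> forms 1 m \<Longrightarrow> dehom F = 0 \<longleftrightarrow> F = 0"
  using forms_dehom[of F m] by auto

lemma poly_dehom: "poly (dehom F) t = eval (\<lambda>i. v i + t * P i) F"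
proof -
  have "poly (dehom F) t = (\<Sum>m\<in>Poly_Mapping.keys F. Poly_Mapping.lookup F m *
     (\<Prod>i\<in>Poly_Mapping.keys m. (v i + t * P i) ^ Poly_Mapping.lookup m i))"
    by (simp add: dehom_def subst_def poly_sum poly_prod poly_power)
  then show ?thesis
    by (simp add: subst_def)
qed

lemma eval_lin: "eval P lin = 0" and eval_lin': "eval P lin' = 1"
  using Pv by (simp_all add: lin_def lin'_def id.subst_diff id.subst_mult mult.commute)

lemma eval_P:
  assumes F: "F \<in> forms 1 m"
  shows "eval P F = coeff (dehom F) m"
proof -
  have "eval P F = eval P (homogenize m (dehom F))"
    using forms_dehom[OF F] by simp
  also have "\<dots> = (\<Sum>i\<le>m. coeff (dehom F) i * 0 ^ (m - i))"
    by (simp add: homogenize_def id.subst_sum id.subst_mult id.subst_power eval_lin eval_lin')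
  also have "\<dots> = (\<Sum>i\<le>m. if i = m then coeff (dehom F) m else 0)"
    by (rule sum.cong) (auto simp: power_0_left)
  finally show ?thesis
    by simp
qed

lemma lin_nonzero: "lin \<noteq> 0"
  using dehom_lin by auto

text \<open>Writing \<open>F\<close> as a polynomial in \<open>lin\<close> and \<open>lin'\<close>, the coefficients of high powers of \<open>lin'\<close> vanish, so
  the missing degree is a power of \<open>lin\<close>. The cofactor is nonzero at \<open>P\<close>, because its value there is the
  leading coefficient of the dehomogenization.\<close>

lemma ord_at_eq:
  assumes F: "F \<in> forms 1 m" "F \<noteq> 0"
  shows "ord_at P F = m - degree (dehom F)"
proof -
  define p where "p = dehom F"
  define d where "d = degree p"
  have d: "d \<le> m"
    using degree_dehom[OF F(1)] by (simp add: d_def p_def)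
  have "p \<noteq> 0"
    using F dehom_eq_0_iff by (auto simp: p_def)
  define E where "E = homogenize d p"
  have "F = (\<Sum>i\<le>m. Cst (coeff p i) * lin' ^ i * lin ^ (m - i))"
    using forms_dehom[OF F(1)] by (simp add: homogenize_def p_def)
  also have "\<dots> = (\<Sum>i\<le>d. Cst (coeff p i) * lin' ^ i * lin ^ (m - i))"
    using d by (intro sum.mono_neutral_right) (auto simp: d_def coeff_eq_0)
  also have "\<dots> = lin ^ (m - d) * E"
    unfolding E_def homogenize_def sum_distrib_left
  proof (rule sum.cong[OF refl])
    fix i assume "i \<in> {..d}"
    with d have "m - i = (m - d) + (d - i)"
      by auto
    then show "Cst (coeff p i) * lin' ^ i * lin ^ (m - i) =
        lin ^ (m - d) * (Cst (coeff p i) * lin' ^ i * lin ^ (d - i))"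
      by (simp only: power_add mult_ac)
  qed
  finally have F_eq: "F = lin ^ (m - d) * E" .
  have "eval P E = (\<Sum>i\<le>d. coeff p i * 0 ^ (d - i))"
    by (simp add: E_def homogenize_def id.subst_sum id.subst_mult id.subst_power eval_lin eval_lin')
  also have "\<dots> = (\<Sum>i\<le>d. if i = d then coeff p d else 0)"
    by (rule sum.cong) (auto simp: power_0_left)
  finally have E: "eval P E \<noteq> 0"
    using \<open>p \<noteq> 0\<close> by (simp add: d_def)
  show ?thesis
    unfolding ord_at_def lin_def[symmetric] p_def[symmetric] d_def[symmetric]
  proof (rule Greatest_equality)
    show "lin ^ (m - d) dvd F"
      unfolding F_eq by simp
  next
    fix j assume "lin ^ j dvd F"
    show "j \<le> m - d"
    proof (rule ccontr)
      assume "\<not> j \<le> m - d"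
      then have "lin ^ (m - d) * lin dvd lin ^ j"
        using le_imp_power_dvd[of "Suc (m - d)" j lin] by (simp add: mult.commute)
      with \<open>lin ^ j dvd F\<close> have "lin ^ (m - d) * lin dvd lin ^ (m - d) * E"
        unfolding F_eq by (rule dvd_trans[rotated])
      then have "lin dvd E"
        using lin_nonzero by simp
      then have "eval P E = 0"
        by (auto simp: id.subst_mult eval_lin elim!: dvdE)
      with E show False ..
    qed
  qed
qed

end

lemma dehomogenization_exists:
  assumes "P \<in> proj_space 1"
  shows "\<exists>v. dehomogenization P v"
proof (cases "P 1 = 0")
  case True
  then have "P 0 \<noteq> 0"
    using assms by (auto simp: proj_space_def le_Suc_eq)
  with True show ?thesis
    by (intro exI[of _ "\<lambda>i. - inverse (P 0)"]) (simp add: dehomogenization_def)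
next
  case False
  then show ?thesis
    by (intro exI[of _ "\<lambda>i. if i = 0 then inverse (P 1) else 0"]) (simp add: dehomogenization_def)
qed

section \<open>Linear relations\<close>

text \<open>Each equation eliminates at most one unknown, so that at least one remains to be chosen freely.\<close>

lemma homogeneous_system_solution:
  fixes a :: "'i \<Rightarrow> 'j \<Rightarrow> 'a::field"
  assumes "finite J" "finite I" "card J < card I"
  shows "\<exists>c. (\<exists>i\<in>I. c i \<noteq> 0) \<and> (\<forall>j\<in>J. (\<Sum>i\<in>I. c i * a i j) = 0)"
  using assms
proof (induction J arbitrary: I a rule: finite_induct)
  case empty
  then obtain i where "i \<in> I"
    by fastforce
  then show ?case
    by (intro exI[of _ "\<lambda>_. 1"]) auto
next
  case (insert j J)
  show ?case
  proof (cases "\<exists>i0\<in>I. a i0 j \<noteq> 0")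
    case False
    have "card J < card I"
      using insert by simp
    from insert.IH[OF insert.prems(1) this, of a] False show ?thesis
      by auto
  next
    case True
    then obtain i0 where i0: "i0 \<in> I" "a i0 j \<noteq> 0"
      by blast
    define a' where "a' i k = a i k - a i j / a i0 j * a i0 k" for i k
    have "card J < card (I - {i0})"
      using insert i0 by simp
    with insert.IH[of "I - {i0}" a'] insert.prems
    obtain c where c: "\<exists>i\<in>I - {i0}. c i \<noteq> 0"
      and c0: "\<And>k. k \<in> J \<Longrightarrow> (\<Sum>i\<in>I - {i0}. c i * a' i k) = 0"
      by auto
    define S where "S = (\<Sum>i\<in>I - {i0}. c i * a i j)"
    define c' where "c' = c(i0 := - S / a i0 j)"
    have sum: "(\<Sum>i\<in>I. c' i * a i k) = - S / a i0 j * a i0 k + (\<Sum>i\<in>I - {i0}. c i * a i k)" for k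
      unfolding sum.remove[OF insert.prems(1) i0(1)] by (simp add: c'_def)
    have "(\<Sum>i\<in>I. c' i * a i k) = 0" if "k \<in> J" for k
    proof -
      have "0 = (\<Sum>i\<in>I - {i0}. c i * a i k - c i * a i j * (a i0 k / a i0 j))"
        unfolding c0[OF that, symmetric] a'_def by (intro sum.cong refl) (simp add: algebra_simps)
      also have "\<dots> = (\<Sum>i\<in>I - {i0}. c i * a i k) - S * (a i0 k / a i0 j)"
        by (simp only: sum_subtractf S_def sum_distrib_right)
      finally show ?thesis
        unfolding sum by (simp add: field_simps)
    qed
    moreover have "(\<Sum>i\<in>I. c' i * a i j) = 0"
      unfolding sum S_def[symmetric] using i0(2) by simp
    moreover have "\<exists>i\<in>I. c' i \<noteq> 0"
      using c by (auto simp: c'_def)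
    ultimately show ?thesis
      by (intro exI[of _ c']) auto
  qed
qed

lemma poly_linear_relation:
  fixes f :: "'i \<Rightarrow> 'a::field poly"
  assumes "finite I" "Suc M < card I" "\<And>i. i \<in> I \<Longrightarrow> degree (f i) \<le> M"
  shows "\<exists>c. (\<exists>i\<in>I. c i \<noteq> 0) \<and> (\<Sum>i\<in>I. [:c i:] * f i) = 0"
proof -
  obtain c where c: "\<exists>i\<in>I. c i \<noteq> 0" "\<And>k. k \<in> {..M} \<Longrightarrow> (\<Sum>i\<in>I. c i * coeff (f i) k) = 0"
    using homogeneous_system_solution[of "{..M}" I "\<lambda>i. coeff (f i)"] assms by auto
  have "coeff (\<Sum>i\<in>I. [:c i:] * f i) k = 0" for k
  proof (cases "k \<le> M")
    case True
    then show ?thesis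
      using c(2) by (simp add: coeff_sum)
  next
    case False
    then have "coeff (f i) k = 0" if "i \<in> I" for i
      using assms(3)[OF that] by (intro coeff_eq_0) simp
    then show ?thesis
      by (simp add: coeff_sum)
  qed
  then have "(\<Sum>i\<in>I. [:c i:] * f i) = 0"
    by (simp add: poly_eq_iff)
  with c(1) show ?thesis
    by blast
qed

section \<open>Subrings and chains of primes\<close>

locale subring_set =
  fixes S :: "'r::comm_ring_1 set"
  assumes S_0 [simp]: "0 \<in> S" and S_1 [simp]: "1 \<in> S"
    and S_add: "a \<in> S \<Longrightarrow> b \<in> S \<Longrightarrow> a + b \<in> S"
    and S_mult: "a \<in> S \<Longrightarrow> b \<in> S \<Longrightarrow> a * b \<in> S"
    and S_minus: "a \<in> S \<Longrightarrow> - a \<in> S"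
begin

lemma cring_ring_on: "cring (ring_on S)"
proof (rule cringI)
  show "abelian_group (ring_on S)"
  proof (rule abelian_groupI)
    fix x assume "x \<in> carrier (ring_on S)"
    then show "\<exists>y\<in>carrier (ring_on S). y \<oplus>\<^bsub>ring_on S\<^esub> x = \<zero>\<^bsub>ring_on S\<^esub>"
      by (intro bexI[of _ "- x"]) (simp_all add: ring_on_def S_minus)
  qed (simp_all add: ring_on_def S_add add_ac)
  show "Group.comm_monoid (ring_on S)"
    by (rule comm_monoidI) (simp_all add: ring_on_def S_mult mult_ac)
qed (simp add: ring_on_def distrib_right)

lemma power_mem: "a \<in> S \<Longrightarrow> a ^ k \<in> S"
  by (induction k) (simp_all add: S_mult)

lemma sum_mem: "(\<And>i. i \<in> A \<Longrightarrow> f i \<in> S) \<Longrightarrow> sum f A \<in> S"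
  by (induction A rule: infinite_finite_induct) (simp_all add: S_add)

definition is_ideal :: "'r set \<Rightarrow> bool" where
  "is_ideal I \<longleftrightarrow> I \<subseteq> S \<and> 0 \<in> I \<and> (\<forall>a\<in>I. \<forall>b\<in>I. a + b \<in> I) \<and> (\<forall>a\<in>I. \<forall>b\<in>S. a * b \<in> I)"

lemma ideal_iff: "ideal I (ring_on S) \<longleftrightarrow> is_ideal I"
proof
  assume "ideal I (ring_on S)"
  then interpret ideal I "ring_on S" .
  show "is_ideal I"
    unfolding is_ideal_def
    using a_subset additive_subgroup.zero_closed[OF additive_subgroup_axioms]
      additive_subgroup.a_closed[OF additive_subgroup_axioms] I_r_closed
    by (auto simp: ring_on_def)
next
  assume I: "is_ideal I"
  interpret cring "ring_on S"
    by (rule cring_ring_on)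
  have minus: "- a \<in> I" if "a \<in> I" for a
    using I that S_minus[OF S_1] unfolding is_ideal_def by (metis mult_minus1_right)
  have inv: "\<ominus>\<^bsub>ring_on S\<^esub> a = - a" if "a \<in> S" for a
    using that by (intro minus_equality) (simp_all add: ring_on_def S_minus)
  show "ideal I (ring_on S)"
  proof (rule idealI)
    show "ring (ring_on S)"
      by unfold_locales
    show "subgroup I (add_monoid (ring_on S))"
    proof (rule add.subgroupI)
      show "I \<subseteq> carrier (ring_on S)" "I \<noteq> {}"
        using I by (auto simp: is_ideal_def ring_on_def)
      fix a b assume "a \<in> I" "b \<in> I"
      then show "a \<oplus>\<^bsub>ring_on S\<^esub> b \<in> I"
        using I by (simp add: ring_on_def is_ideal_def)
    next
      fix a assume a: "a \<in> I"
      then have "a \<in> S"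
        using I by (auto simp: is_ideal_def)
      with minus[OF a] show "\<ominus>\<^bsub>ring_on S\<^esub> a \<in> I"
        by (simp add: inv)
    qed
  qed (use I in \<open>auto simp: ring_on_def is_ideal_def mult.commute\<close>)
qed

lemma primeideal_iff:
  "primeideal I (ring_on S) \<longleftrightarrow> is_ideal I \<and> 1 \<notin> I \<and> (\<forall>a\<in>S. \<forall>b\<in>S. a * b \<in> I \<longrightarrow> a \<in> I \<or> b \<in> I)"
proof -
  have "S \<noteq> I \<longleftrightarrow> 1 \<notin> I" if "is_ideal I"
    using that unfolding is_ideal_def by (metis S_1 mult_1 subsetI subset_antisym)
  then show ?thesis
    using ideal_iff[of I] cring_ring_on
    unfolding primeideal_def primeideal_axioms_def by (auto simp: ring_on_def)
qed

lemma prime_power: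
  assumes "primeideal I (ring_on S)" "a \<in> S" "a ^ k \<in> I"
  shows "a \<in> I"
  using assms(3)
proof (induction k)
  case (Suc k)
  then show ?case
    using assms(1,2) power_mem[OF assms(2), of k] unfolding primeideal_iff by auto
qed (use assms(1) in \<open>simp add: primeideal_iff\<close>)

text \<open>The sum is \<open>x\<^sup>l\<close> times \<open>b l + x r\<close> for some \<open>r\<close>. The first factor is not in \<open>P\<close>, so the second is
  in \<open>P\<close> and hence in \<open>P'\<close>, as is \<open>x r\<close>.\<close>

lemma lowest_coefficient_mem:
  assumes P: "primeideal P (ring_on S)" and P': "primeideal P' (ring_on S)" and "P \<subseteq> P'"
    and x: "x \<in> P'" "x \<notin> P" and b: "\<And>i. b i \<in> S"
    and low: "\<And>i. i < l \<Longrightarrow> b i = 0" and "l \<le> N" and sum: "(\<Sum>i\<le>N. b i * x ^ i) \<in> P"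
  shows "b l \<in> P'"
proof -
  have xS: "x \<in> S"
    using P' x(1) by (auto simp: primeideal_iff is_ideal_def)
  define r where "r = (\<Sum>i\<in>{Suc l..N}. b i * x ^ (i - Suc l))"
  have r: "r \<in> S"
    unfolding r_def using b xS by (intro sum_mem S_mult power_mem)
  have "(\<Sum>i\<le>N. b i * x ^ i) = (\<Sum>i\<in>{l..N}. b i * x ^ i)"
    by (rule sum.mono_neutral_right) (auto simp: low)
  also have "\<dots> = b l * x ^ l + (\<Sum>i\<in>{Suc l..N}. b i * x ^ i)"
    using \<open>l \<le> N\<close> by (simp add: sum.atLeast_Suc_atMost)
  also have "(\<Sum>i\<in>{Suc l..N}. b i * x ^ i) = x ^ l * (x * r)"
    unfolding r_def sum_distrib_left
  proof (rule sum.cong[OF refl])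
    fix i assume "i \<in> {Suc l..N}"
    then have "i = l + Suc (i - Suc l)"
      by simp
    then have "x ^ i = x ^ l * (x * x ^ (i - Suc l))"
      by (metis power_add power_Suc)
    then show "b i * x ^ i = x ^ l * (x * (b i * x ^ (i - Suc l)))"
      by (simp add: mult_ac)
  qed
  finally have "(\<Sum>i\<le>N. b i * x ^ i) = x ^ l * (b l + x * r)"
    by (simp add: algebra_simps)
  moreover have "x ^ l \<in> S" "b l + x * r \<in> S"
    using xS r b by (auto intro: power_mem S_add S_mult)
  moreover have "x ^ l \<notin> P"
    using prime_power[OF P xS] x(2) by blast
  ultimately have "b l + x * r \<in> P"
    using P sum unfolding primeideal_iff by metis
  then have "b l + x * r \<in> P'"
    using \<open>P \<subseteq> P'\<close> by blast
  moreover have "x * - r \<in> P'"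
    using P' x(1) S_minus[OF r] unfolding primeideal_iff is_ideal_def by blast
  ultimately have "(b l + x * r) + x * - r \<in> P'"
    using P' unfolding primeideal_iff is_ideal_def by blast
  then show ?thesis
    by simp
qed

text \<open>In a nontrivial polynomial relation modulo \<open>P0\<close>, the lowest coefficient with respect to \<open>x\<close> is a
  nontrivial relation for \<open>y\<close> modulo \<open>P1\<close>, whose lowest coefficient is a nonzero constant in \<open>P2\<close>.\<close>

lemma separating_elements_independent2:
  assumes P: "primeideal P0 (ring_on S)" "primeideal P1 (ring_on S)" "primeideal P2 (ring_on S)"
    and sub: "P0 \<subseteq> P1" "P1 \<subseteq> P2"
    and x: "x \<in> P1" "x \<notin> P0" and y: "y \<in> P2" "y \<notin> P1"
    and u: "scalar_hom (u :: 'a::field \<Rightarrow> 'r)" "\<And>c. u c \<in> S"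
    and sum: "(\<Sum>i\<le>N. \<Sum>j\<le>N. u (c i j) * x ^ i * y ^ j) \<in> P0"
    and ij: "i \<le> N" "j \<le> N"
  shows "c i j = 0"
proof (rule ccontr)
  assume nz: "c i j \<noteq> 0"
  interpret u: scalar_hom u
    by (rule u(1))
  have xS: "x \<in> S" and yS: "y \<in> S"
    using P x(1) y(1) by (auto simp: primeideal_iff is_ideal_def)
  define l where "l = (LEAST l. \<exists>j\<le>N. c l j \<noteq> 0)"
  have l_ex: "\<exists>j\<le>N. c l j \<noteq> 0"
    unfolding l_def by (rule LeastI[of "\<lambda>l. \<exists>j\<le>N. c l j \<noteq> 0" i]) (use nz ij in auto)
  have l_low: "c l' j = 0" if "l' < l" "j \<le> N" for l' j
    using not_less_Least[of l' "\<lambda>l. \<exists>j\<le>N. c l j \<noteq> 0"] that unfolding l_def by blast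
  have "l \<le> i"
    unfolding l_def by (rule Least_le) (use nz ij in auto)
  have "(\<Sum>i\<le>N. (\<Sum>j\<le>N. u (c i j) * y ^ j) * x ^ i) \<in> P0"
    using sum by (simp add: sum_distrib_right sum_distrib_left mult_ac)
  then have 1: "(\<Sum>j\<le>N. u (c l j) * y ^ j) \<in> P1"
    using \<open>l \<le> i\<close> ij u(2) yS l_low
    by (intro lowest_coefficient_mem[OF P(1,2) sub(1) x, where b = "\<lambda>i. \<Sum>j\<le>N. u (c i j) * y ^ j" and N = N])
      (auto intro!: sum_mem S_mult power_mem sum.neutral simp: u.h_0)
  define k where "k = (LEAST k. k \<le> N \<and> c l k \<noteq> 0)"
  have k: "k \<le> N" "c l k \<noteq> 0"
    using LeastI_ex[OF l_ex] unfolding k_def by auto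
  have k_low: "c l k' = 0" if "k' < k" for k'
    using not_less_Least[of k' "\<lambda>k. k \<le> N \<and> c l k \<noteq> 0"] that k unfolding k_def by fastforce
  have "u (c l k) \<in> P2"
    by (rule lowest_coefficient_mem[OF P(2,3) sub(2) y, where b = "\<lambda>j. u (c l j)" and N = N])
      (use 1 k k_low u(2) in \<open>auto simp: u.h_0\<close>)
  then have "u (c l k) * u (inverse (c l k)) \<in> P2"
    using P(3) u(2) unfolding primeideal_iff is_ideal_def by blast
  moreover have "u (c l k) * u (inverse (c l k)) = 1"
    using k by (simp add: u.h_mult[symmetric] u.h_1)
  ultimately show False
    using P(3) by (simp add: primeideal_iff)
qed

text \<open>The same descent with one more step.\<close>

lemma separating_elements_independent3:
  assumes P: "primeideal P0 (ring_on S)" "primeideal P1 (ring_on S)" "primeideal P2 (ring_on S)"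
      "primeideal P3 (ring_on S)"
    and sub: "P0 \<subseteq> P1" "P1 \<subseteq> P2" "P2 \<subseteq> P3"
    and x: "x \<in> P1" "x \<notin> P0" and y: "y \<in> P2" "y \<notin> P1" and z: "z \<in> P3" "z \<notin> P2"
    and u: "scalar_hom (u :: 'a::field \<Rightarrow> 'r)" "\<And>c. u c \<in> S"
    and sum: "(\<Sum>i\<le>N. \<Sum>j\<le>N. \<Sum>k\<le>N. u (c i j k) * x ^ i * y ^ j * z ^ k) \<in> P0"
    and ij: "i \<le> N" "j \<le> N" "k \<le> N"
  shows "c i j k = 0"
proof (rule ccontr)
  assume nz: "c i j k \<noteq> 0"
  interpret u: scalar_hom u
    by (rule u(1))
  have xS: "x \<in> S" and yS: "y \<in> S" and zS: "z \<in> S"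
    using P x(1) y(1) z(1) by (auto simp: primeideal_iff is_ideal_def)
  define l where "l = (LEAST l. \<exists>j\<le>N. \<exists>k\<le>N. c l j k \<noteq> 0)"
  have l_ex: "\<exists>j\<le>N. \<exists>k\<le>N. c l j k \<noteq> 0"
    unfolding l_def by (rule LeastI[of "\<lambda>l. \<exists>j\<le>N. \<exists>k\<le>N. c l j k \<noteq> 0" i]) (use nz ij in auto)
  have l_low: "c l' j k = 0" if "l' < l" "j \<le> N" "k \<le> N" for l' j k
    using not_less_Least[of l' "\<lambda>l. \<exists>j\<le>N. \<exists>k\<le>N. c l j k \<noteq> 0"] that unfolding l_def by blast
  have "l \<le> i"
    unfolding l_def by (rule Least_le) (use nz ij in auto)
  have "(\<Sum>i\<le>N. (\<Sum>j\<le>N. \<Sum>k\<le>N. u (c i j k) * y ^ j * z ^ k) * x ^ i) \<in> P0"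
    using sum by (simp add: sum_distrib_right sum_distrib_left mult_ac)
  then have "(\<Sum>j\<le>N. \<Sum>k\<le>N. u (c l j k) * y ^ j * z ^ k) \<in> P1"
    using \<open>l \<le> i\<close> ij u(2) yS zS l_low
    by (intro lowest_coefficient_mem[OF P(1,2) sub(1) x,
          where b = "\<lambda>i. \<Sum>j\<le>N. \<Sum>k\<le>N. u (c i j k) * y ^ j * z ^ k" and N = N])
      (auto intro!: sum_mem S_mult power_mem sum.neutral simp: u.h_0)
  from separating_elements_independent2[OF P(2-4) sub(2,3) y z u this] l_ex show False
    by blast
qed

end

section \<open>Quotients of subrings and Krull dimension\<close>

context subring_set begin

lemma carrier_ring_on [simp]: "carrier (ring_on S) = S"
  by (simp add: ring_on_def)

abbreviation coset :: "'r set \<Rightarrow> 'r \<Rightarrow> 'r set" where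
  "coset I a \<equiv> I +>\<^bsub>ring_on S\<^esub> a"

abbreviation quotient :: "'r set \<Rightarrow> 'r set ring" where
  "quotient I \<equiv> ring_on S Quot I"

lemma coset_eq: "coset I a = (\<lambda>i. i + a) ` I"
  by (auto simp: a_r_coset_def' ring_on_def)

lemma coset_eq_iff:
  assumes I: "is_ideal I"
  shows "coset I a = coset I b \<longleftrightarrow> a - b \<in> I"
proof
  assume "coset I a = coset I b"
  moreover have "a \<in> coset I a"
    unfolding coset_eq using I by (force simp: is_ideal_def)
  ultimately show "a - b \<in> I"
    unfolding coset_eq by auto
next
  have *: "coset I a \<subseteq> coset I b" if ab: "a - b \<in> I" for a b
    unfolding coset_eq
  proof safe
    fix i assume "i \<in> I"
    then have "i + (a - b) \<in> I"
      using I ab by (simp add: is_ideal_def)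
    then have "i + (a - b) + b \<in> (\<lambda>i. i + b) ` I"
      by (rule imageI)
    then show "i + a \<in> (\<lambda>i. i + b) ` I"
      by simp
  qed
  assume ab: "a - b \<in> I"
  moreover have "b - a \<in> I"
  proof -
    have "(a - b) * - 1 \<in> I"
      using ab I S_minus[OF S_1] unfolding is_ideal_def by blast
    then show ?thesis
      by simp
  qed
  ultimately show "coset I a = coset I b"
    using * by blast
qed

lemma carrier_quotient: "carrier (quotient I) = coset I ` S"
  unfolding FactRing_def by (auto simp: A_RCOSETS_def' ring_on_def)

lemma coset_mult:
  assumes "is_ideal I" "a \<in> S" "b \<in> S"
  shows "coset I a \<otimes>\<^bsub>quotient I\<^esub> coset I b = coset I (a * b)"
  using ideal.rcoset_mult_add[of I "ring_on S" a b] assms ideal_iff[of I]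
  by (simp add: FactRing_def ring_on_def)

lemma cring_quotient: "is_ideal I \<Longrightarrow> cring (quotient I)"
  by (simp add: ideal.quotient_is_cring cring_ring_on ideal_iff)

definition vimage_coset :: "'r set \<Rightarrow> 'r set set \<Rightarrow> 'r set" where
  "vimage_coset I M = {a \<in> S. coset I a \<in> M}"

lemma ideal_vimage_coset:
  assumes "is_ideal I" "ideal M (quotient I)"
  shows "is_ideal (vimage_coset I M)"
  using ring_hom_ring.ideal_vimage[OF ideal.rcos_ring_hom_ring assms(2)] assms(1)
  by (simp add: ideal_iff vimage_coset_def)

lemma primeideal_vimage_coset:
  assumes "is_ideal I" "primeideal M (quotient I)"
  shows "primeideal (vimage_coset I M) (ring_on S)"
  using ring_hom_ring.primeideal_vimage[OF ideal.rcos_ring_hom_ring cring_ring_on assms(2)] assms(1)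
  by (simp add: ideal_iff vimage_coset_def)

lemma subset_vimage_coset:
  assumes I: "is_ideal I" and M: "ideal M (quotient I)"
  shows "I \<subseteq> vimage_coset I M"
proof
  fix a assume a: "a \<in> I"
  have "coset I a = coset I 0"
    unfolding coset_eq_iff[OF I] using a by simp
  also have "\<dots> = I"
    by (simp add: coset_eq)
  also have "\<dots> = \<zero>\<^bsub>quotient I\<^esub>"
    by (simp add: FactRing_def)
  also have "\<dots> \<in> M"
    using M by (simp add: ideal_def additive_subgroup.zero_closed)
  finally show "a \<in> vimage_coset I M"
    using a I by (auto simp: vimage_coset_def is_ideal_def)
qed

lemma vimage_coset_strict_mono:
  assumes M: "ideal M' (quotient I)" and "M \<subset> M'"
  shows "vimage_coset I M \<subset> vimage_coset I M'"
proof -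
  obtain z where z: "z \<in> M'" "z \<notin> M"
    using assms by blast
  then have "z \<in> carrier (quotient I)"
    using ideal.Icarr[OF M] by blast
  then obtain a where "a \<in> S" "z = coset I a"
    unfolding carrier_quotient by blast
  with z assms show ?thesis
    unfolding vimage_coset_def by blast
qed

lemma krull_dim_quotient_le_1:
  assumes I: "is_ideal I"
    and u: "scalar_hom (u :: 'a::field \<Rightarrow> 'r)" "\<And>c. u c \<in> S"
    and dep: "\<And>x y. x \<in> S \<Longrightarrow> y \<in> S \<Longrightarrow> \<exists>N c. (\<exists>i\<le>N. \<exists>j\<le>N. c i j \<noteq> 0) \<and>
      (\<Sum>i\<le>N. \<Sum>j\<le>N. u (c i j) * x ^ i * y ^ j) \<in> I"
  shows "krull_dim (quotient I) \<le> 1"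
  unfolding krull_dim_def
proof (rule Sup_least, clarify)
  fix r p
  assume p: "\<forall>i\<le>r. primeideal (p i) (quotient I)" and chain: "\<forall>i<r. p i \<subset> p (Suc i)"
  show "enat r \<le> 1"
  proof (rule ccontr)
    assume "\<not> enat r \<le> 1"
    then have "2 \<le> r"
      by (simp add: one_enat_def)
    define q where "q i = vimage_coset I (p i)" for i
    have id: "ideal (p i) (quotient I)" if "i \<le> r" for i
      using p that by (simp add: primeideal.axioms(1))
    have q: "primeideal (q i) (ring_on S)" if "i \<le> r" for i
      unfolding q_def using p that by (intro primeideal_vimage_coset[OF I]) simp
    have strict: "q i \<subset> q (Suc i)" if "i < r" for i
      unfolding q_def using id[of "Suc i"] chain that by (intro vimage_coset_strict_mono) auto
    have I0: "I \<subseteq> q 0"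
      unfolding q_def using id[of 0] by (intro subset_vimage_coset[OF I]) simp
    have lt: "q 0 \<subset> q 1" "q 1 \<subset> q 2"
      using strict[of 0] strict[of 1] \<open>2 \<le> r\<close> by (simp_all add: numeral_2_eq_2)
    obtain x where x: "x \<in> q 1" "x \<notin> q 0"
      using psubset_imp_ex_mem[OF lt(1)] by blast
    obtain y where y: "y \<in> q 2" "y \<notin> q 1"
      using psubset_imp_ex_mem[OF lt(2)] by blast
    note sub = lt[THEN psubset_imp_subset]
    have pr: "primeideal (q 0) (ring_on S)" "primeideal (q 1) (ring_on S)" "primeideal (q 2) (ring_on S)"
      using q \<open>2 \<le> r\<close> by simp_all
    have "x \<in> S" "y \<in> S"
      using x y by (auto simp: q_def vimage_coset_def)
    then obtain N c where c: "\<exists>i\<le>N. \<exists>j\<le>N. c i j \<noteq> 0"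
      "(\<Sum>i\<le>N. \<Sum>j\<le>N. u (c i j) * x ^ i * y ^ j) \<in> I"
      using dep[of x y] by blast
    have "(\<Sum>i\<le>N. \<Sum>j\<le>N. u (c i j) * x ^ i * y ^ j) \<in> q 0"
      using c(2) I0 by blast
    from separating_elements_independent2[OF pr sub x y u this] c(1) show False
      by blast
  qed
qed

lemma krull_dim_le_2:
  assumes u: "scalar_hom (u :: 'a::field \<Rightarrow> 'r)" "\<And>c. u c \<in> S"
    and dep: "\<And>x y z. x \<in> S \<Longrightarrow> y \<in> S \<Longrightarrow> z \<in> S \<Longrightarrow> \<exists>N c. (\<exists>i\<le>N. \<exists>j\<le>N. \<exists>k\<le>N. c i j k \<noteq> 0) \<and>
      (\<Sum>i\<le>N. \<Sum>j\<le>N. \<Sum>k\<le>N. u (c i j k) * x ^ i * y ^ j * z ^ k) = 0"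
  shows "krull_dim (ring_on S) \<le> 2"
  unfolding krull_dim_def
proof (rule Sup_least, clarify)
  fix r q
  assume q: "\<forall>i\<le>r. primeideal (q i) (ring_on S)" and chain: "\<forall>i<r. q i \<subset> q (Suc i)"
  show "enat r \<le> 2"
  proof (rule ccontr)
    assume "\<not> enat r \<le> 2"
    then have "3 \<le> r"
      by (simp add: numeral_eq_enat)
    have lt: "q 0 \<subset> q 1" "q 1 \<subset> q 2" "q 2 \<subset> q 3"
      using chain[rule_format, of 0] chain[rule_format, of 1] chain[rule_format, of 2] \<open>3 \<le> r\<close>
      by (simp_all add: eval_nat_numeral)
    obtain x where x: "x \<in> q 1" "x \<notin> q 0"
      using psubset_imp_ex_mem[OF lt(1)] by blast
    obtain y where y: "y \<in> q 2" "y \<notin> q 1"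
      using psubset_imp_ex_mem[OF lt(2)] by blast
    obtain z where z: "z \<in> q 3" "z \<notin> q 2"
      using psubset_imp_ex_mem[OF lt(3)] by blast
    note sub = lt[THEN psubset_imp_subset]
    have pr: "primeideal (q 0) (ring_on S)" "primeideal (q 1) (ring_on S)" "primeideal (q 2) (ring_on S)"
      "primeideal (q 3) (ring_on S)"
      using q \<open>3 \<le> r\<close> by simp_all
    have "x \<in> S" "y \<in> S" "z \<in> S"
      using x y z pr by (auto simp: primeideal_iff is_ideal_def)
    then obtain N c where c: "\<exists>i\<le>N. \<exists>j\<le>N. \<exists>k\<le>N. c i j k \<noteq> 0"
      "(\<Sum>i\<le>N. \<Sum>j\<le>N. \<Sum>k\<le>N. u (c i j k) * x ^ i * y ^ j * z ^ k) = 0"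
      using dep[of x y z] by blast
    have "(\<Sum>i\<le>N. \<Sum>j\<le>N. \<Sum>k\<le>N. u (c i j k) * x ^ i * y ^ j * z ^ k) \<in> q 0"
      unfolding c(2) using pr(1) by (simp add: primeideal_iff is_ideal_def)
    from separating_elements_independent3[OF pr sub x y z u this] c(1) show False
      by blast
  qed
qed

text \<open>The preimage of \<open>M\<close> in \<open>S\<close> is a proper ideal, so it contains no unit and lies in \<open>N\<close>; maximality of
  \<open>M\<close> gives equality.\<close>

lemma maximalideal_quotient_eq:
  assumes I: "is_ideal I" and N: "is_ideal N" "I \<subseteq> N" "1 \<notin> N"
    and unit: "\<And>a. a \<in> S - N \<Longrightarrow> \<exists>b\<in>S. a * b = 1"
    and M: "maximalideal M (quotient I)"
  shows "M = coset I ` N"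
proof -
  interpret M: maximalideal M "quotient I"
    by (rule M)
  have "is_ideal (vimage_coset I M)"
    by (rule ideal_vimage_coset[OF I M.ideal_axioms])
  have "1 \<notin> vimage_coset I M"
  proof
    assume "1 \<in> vimage_coset I M"
    then have "1 * a \<in> vimage_coset I M" if "a \<in> S" for a
      using \<open>is_ideal (vimage_coset I M)\<close> that unfolding is_ideal_def by blast
    then have "carrier (quotient I) \<subseteq> M"
      by (auto simp: carrier_quotient vimage_coset_def)
    then show False
      using M.I_notcarr M.a_subset by blast
  qed
  have sub: "vimage_coset I M \<subseteq> N"
  proof (rule ccontr)
    assume "\<not> vimage_coset I M \<subseteq> N"
    then obtain a where a: "a \<in> vimage_coset I M" "a \<in> S - N"
      by (auto simp: vimage_coset_def)
    obtain b where "b \<in> S" "a * b = 1"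
      using unit[OF a(2)] by blast
    with a(1) \<open>is_ideal (vimage_coset I M)\<close> have "1 \<in> vimage_coset I M"
      unfolding is_ideal_def by force
    with \<open>1 \<notin> vimage_coset I M\<close> show False ..
  qed
  have "M \<subseteq> coset I ` N"
  proof
    fix z assume "z \<in> M"
    then obtain a where "a \<in> S" "z = coset I a"
      using M.a_subset unfolding carrier_quotient by blast
    with \<open>z \<in> M\<close> sub show "z \<in> coset I ` N"
      by (auto simp: vimage_coset_def)
  qed
  moreover have "ideal (coset I ` N) (quotient I)"
  proof -
    interpret cring "ring_on S"
      by (rule cring_ring_on)
    show ?thesis
      by (rule ring_ideal_imp_quot_ideal) (simp_all add: ideal_iff I N)
  qed
  moreover have "coset I ` N \<subseteq> carrier (quotient I)"
    unfolding carrier_quotient using N by (auto simp: is_ideal_def)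
  moreover have "coset I ` N \<noteq> carrier (quotient I)"
  proof
    assume "coset I ` N = carrier (quotient I)"
    then have "coset I 1 \<in> coset I ` N"
      unfolding carrier_quotient by simp
    then obtain a where a: "a \<in> N" "coset I 1 = coset I a"
      by (rule imageE)
    then have "1 - a \<in> N"
      using coset_eq_iff[OF I] N(2) by blast
    then have "1 - a + a \<in> N"
      using a N(1) unfolding is_ideal_def by blast
    with N(3) show False
      by simp
  qed
  ultimately show ?thesis
    using M.I_maximal[of "coset I ` N"] by blast
qed

end

interpretation mp: subring_set "mpolys n :: 'a::comm_ring_1 mpoly set" for n
  by unfold_locales (simp_all add: mpolys_add mpolys_mult mpolys_uminus)

section \<open>Parametrized rational curves\<close>

locale rational_curve =
  fixes n e m :: nat and X :: "'a::field mpoly set" and \<phi> G :: "nat \<Rightarrow> 'a mpoly"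
  assumes X: "primeideal X (ring_on (mpolys n))"
    and \<phi>: "\<And>i. i \<le> n \<Longrightarrow> \<phi> i \<in> forms 1 e"
    and no_base_point: "\<And>p. p \<in> proj_space 1 \<Longrightarrow> \<exists>i\<le>n. eval p (\<phi> i) \<noteq> 0"
    and vanish: "\<And>F. F \<in> X \<Longrightarrow> compose \<phi> F = 0"
    and G: "G 0 \<in> forms n m" "G 1 \<in> forms n m"
    and G_nonzero: "compose \<phi> (G 0) \<noteq> 0 \<or> compose \<phi> (G 1) \<noteq> 0"
    and G_\<phi>: "compose \<phi> (G 0) * Var 1 = compose \<phi> (G 1) * Var 0"
    and \<phi>_G_defined: "\<exists>i\<le>n. compose G (\<phi> i) \<notin> X"
    and \<phi>_G: "\<And>i j. i \<le> n \<Longrightarrow> j \<le> n \<Longrightarrow> compose G (\<phi> i) * Var j - compose G (\<phi> j) * Var i \<in> X"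
begin

lemma X_ideal: "mp.is_ideal n X"
  using X by (simp add: mp.primeideal_iff)

lemma X_add: "F \<in> X \<Longrightarrow> H \<in> X \<Longrightarrow> F + H \<in> X"
  using X_ideal by (simp add: mp.is_ideal_def)

lemma X_0: "0 \<in> X"
  using X_ideal by (simp add: mp.is_ideal_def)

lemma X_mult: "F \<in> X \<Longrightarrow> H \<in> mpolys n \<Longrightarrow> F * H \<in> X"
  using X_ideal by (simp add: mp.is_ideal_def)

lemma X_minus: "F \<in> X \<Longrightarrow> - F \<in> X"
  using X_mult[of F "- 1"] by (simp add: mpolys_uminus)

lemma X_prime: "F \<in> mpolys n \<Longrightarrow> H \<in> mpolys n \<Longrightarrow> F * H \<in> X \<Longrightarrow> F \<in> X \<or> H \<in> X"
  using X by (simp add: mp.primeideal_iff)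

lemma compose_\<phi>_forms: "F \<in> forms n k \<Longrightarrow> compose \<phi> F \<in> forms 1 (k * e)"
  by (rule compose_mem_forms[OF _ \<phi>])

text \<open>The forms \<open>y i = compose G (\<phi> i)\<close> are the coordinates of the composition of the curve's
  rational inverse with the parametrization, which is the identity of the curve. So modulo \<open>X\<close> they are
  proportional to the variables, and up to powers of \<open>y l\<close> and \<open>Var l\<close> the form \<open>F\<close> is congruent to
  \<open>F(y)\<close>, which is zero since it factors through \<open>compose \<phi> F\<close>. As \<open>X\<close> is prime and \<open>y l\<close> is not
  in \<open>X\<close>, the form \<open>F\<close> is in \<open>X\<close>.\<close>

lemma compose_\<phi>_eq_0_imp:
  assumes F: "F \<in> forms n k" and 0: "compose \<phi> F = 0"
  shows "F \<in> X"
proof -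
  define y where "y i = compose G (\<phi> i)" for i
  have y: "y i \<in> mpolys n" if "i \<le> n" for i
  proof -
    have "compose G (\<phi> i) \<in> forms n (e * m)"
      by (rule compose_mem_forms[OF \<phi>[OF that]]) (use G in \<open>auto simp: le_Suc_eq\<close>)
    then show ?thesis
      unfolding y_def by (rule forms_imp_mpolys)
  qed
  obtain l where l: "l \<le> n" "y l \<notin> X"
    using \<phi>_G_defined by (auto simp: y_def)
  have Vl: "Var l \<in> mpolys n"
    using forms_Var[OF l(1)] by (rule forms_imp_mpolys)
  let ?W = "\<lambda>k. {F \<in> mpolys n. compose y F \<in> mpolys n \<and> F * y l ^ k - Var l ^ k * compose y F \<in> X}"
  have "compose Var F \<in> ?W k"
  proof (rule Cst.subst_mem_graded[OF F])
    fix k A B assume "A \<in> ?W k" "B \<in> ?W k"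
    then show "A + B \<in> ?W k"
      using X_add[of "A * y l ^ k - Var l ^ k * compose y A" "B * y l ^ k - Var l ^ k * compose y B"]
      by (simp add: mpolys_add Cst.subst_add algebra_simps)
  next
    fix j k A B assume A: "A \<in> ?W j" and B: "B \<in> ?W k"
    have "(A * y l ^ j - Var l ^ j * compose y A) * (B * y l ^ k) \<in> X"
      using A B by (intro X_mult mpolys_mult mpolys_power y l) auto
    moreover have "(B * y l ^ k - Var l ^ k * compose y B) * (Var l ^ j * compose y A) \<in> X"
      using A B by (intro X_mult mpolys_mult mpolys_power Vl) auto
    ultimately have "(A * y l ^ j - Var l ^ j * compose y A) * (B * y l ^ k)
        + (B * y l ^ k - Var l ^ k * compose y B) * (Var l ^ j * compose y A) \<in> X"
      by (rule X_add)
    also have "(A * y l ^ j - Var l ^ j * compose y A) * (B * y l ^ k)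
        + (B * y l ^ k - Var l ^ k * compose y B) * (Var l ^ j * compose y A)
        = A * B * y l ^ (j + k) - Var l ^ (j + k) * compose y (A * B)"
      by (simp add: Cst.subst_mult power_add algebra_simps)
    finally show "A * B \<in> ?W (j + k)"
      using A B by (simp add: mpolys_mult Cst.subst_mult)
  next
    fix i assume i: "i \<le> n"
    have "- (compose G (\<phi> i) * Var l - compose G (\<phi> l) * Var i) \<in> X"
      by (rule X_minus[OF \<phi>_G[OF i l(1)]])
    then show "Var i \<in> ?W 1"
      using y[OF i] forms_imp_mpolys[OF forms_Var[OF i]] by (simp add: y_def algebra_simps)
  qed (simp_all add: X_0 forms_imp_mpolys[OF forms_Cst])
  then have "F * y l ^ k - Var l ^ k * compose y F \<in> X"
    by simp
  moreover have "compose y F = 0"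
    using 0 unfolding y_def Cst.subst_compose[symmetric] by simp
  ultimately have "F * y l ^ k \<in> X"
    by simp
  then have "F \<in> X \<or> y l ^ k \<in> X"
    using F y l by (intro X_prime mpolys_power) (auto intro: forms_imp_mpolys)
  then show ?thesis
    using mp.prime_power[OF X y[OF l(1)]] l(2) by blast
qed

section \<open>The local ring at a point of the curve\<close>

definition fractions :: "(nat \<Rightarrow> 'a) \<Rightarrow> 'a mpoly fract set" where
  "fractions q = {Fract F G | F G k. F \<in> forms n k \<and> G \<in> forms n k \<and> eval q G \<noteq> 0}"

definition vanishing_fractions :: "(nat \<Rightarrow> 'a) \<Rightarrow> 'a mpoly fract set" where
  "vanishing_fractions q = {Fract F G | F G k. F \<in> forms n k \<and> G \<in> forms n k \<and> eval q F = 0 \<and> eval q G \<noteq> 0}"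

lemma eval_nonzero: "eval q F \<noteq> 0 \<Longrightarrow> F \<noteq> 0"
  by auto

lemma fractionsI: "F \<in> forms n k \<Longrightarrow> H \<in> forms n k \<Longrightarrow> eval q H \<noteq> 0 \<Longrightarrow> Fract F H \<in> fractions q"
  unfolding fractions_def by blast

lemma stalkI: "F \<in> X \<Longrightarrow> F \<in> forms n k \<Longrightarrow> H \<in> forms n k \<Longrightarrow> eval q H \<noteq> 0 \<Longrightarrow> Fract F H \<in> ideal_stalk n X q"
  unfolding ideal_stalk_def by blast

lemma vanishing_fractionsI:
  "F \<in> forms n k \<Longrightarrow> H \<in> forms n k \<Longrightarrow> eval q F = 0 \<Longrightarrow> eval q H \<noteq> 0 \<Longrightarrow> Fract F H \<in> vanishing_fractions q"
  unfolding vanishing_fractions_def by blast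

lemma fractionsE:
  assumes "a \<in> fractions q"
  obtains F H k where "a = Fract F H" "F \<in> forms n k" "H \<in> forms n k" "eval q H \<noteq> 0" "H \<noteq> 0"
  using assms eval_nonzero unfolding fractions_def by blast

lemma stalkE:
  assumes "a \<in> ideal_stalk n X q"
  obtains F H k where "a = Fract F H" "F \<in> X" "F \<in> forms n k" "H \<in> forms n k" "eval q H \<noteq> 0" "H \<noteq> 0"
  using assms eval_nonzero unfolding ideal_stalk_def by blast

lemma vanishing_fractionsE:
  assumes "a \<in> vanishing_fractions q"
  obtains F H k where "a = Fract F H" "F \<in> forms n k" "H \<in> forms n k" "eval q F = 0" "eval q H \<noteq> 0" "H \<noteq> 0"
  using assms eval_nonzero unfolding vanishing_fractions_def by blast

lemma fract_add_forms:
  assumes "F \<in> forms n j" "H \<in> forms n j" "eval q H \<noteq> 0" "F' \<in> forms n k" "H' \<in> forms n k" "eval q H' \<noteq> 0"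
  shows "Fract F H + Fract F' H' = Fract (F * H' + F' * H) (H * H')"
    "F * H' + F' * H \<in> forms n (j + k)" "H * H' \<in> forms n (j + k)" "eval q (H * H') \<noteq> 0"
proof -
  show "Fract F H + Fract F' H' = Fract (F * H' + F' * H) (H * H')"
    using assms by (intro add_fract) (auto dest: eval_nonzero)
  show "F * H' + F' * H \<in> forms n (j + k)"
    using forms_mult[OF assms(1,5)] forms_mult[OF assms(4,2)] by (auto intro: forms_add simp: add.commute)
  show "H * H' \<in> forms n (j + k)"
    by (rule forms_mult[OF assms(2,5)])
  show "eval q (H * H') \<noteq> 0"
    using assms by (simp add: id.subst_mult)
qed

sublocale fr: subring_set "fractions q" for q
proof unfold_locales
  show "0 \<in> fractions q"
    using fractionsI[of 0 0 1 q] by (simp add: Zero_fract_def)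
  show "1 \<in> fractions q"
    using fractionsI[of 1 0 1 q] by (simp add: One_fract_def)
next
  fix a b assume "a \<in> fractions q" "b \<in> fractions q"
  then obtain F H j F' H' k where *: "a = Fract F H" "F \<in> forms n j" "H \<in> forms n j" "eval q H \<noteq> 0"
    "b = Fract F' H'" "F' \<in> forms n k" "H' \<in> forms n k" "eval q H' \<noteq> 0"
    by (elim fractionsE)
  then show "a + b \<in> fractions q"
    using fract_add_forms[of F j H q F' k H'] by (auto intro: fractionsI)
  have "Fract (F * F') (H * H') \<in> fractions q"
    using * by (intro fractionsI[of _ "j + k"] forms_mult) (simp_all add: id.subst_mult)
  then show "a * b \<in> fractions q"
    using * by simp
next
  fix a assume "a \<in> fractions q"
  then obtain F H k where "a = Fract F H" "F \<in> forms n k" "H \<in> forms n k" "eval q H \<noteq> 0"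
    by (elim fractionsE)
  then show "- a \<in> fractions q"
    using fractionsI[of "- F" k H q] by (simp add: forms_uminus)
qed

lemma local_ring_eq: "local_ring n X q = fr.quotient q (ideal_stalk n X q)"
  by (simp add: local_ring_def local_ring_proj_space_def fractions_def)

lemma stalk_ideal: "fr.is_ideal q (ideal_stalk n X q)"
  unfolding fr.is_ideal_def
proof (intro conjI ballI)
  show "ideal_stalk n X q \<subseteq> fractions q"
    by (auto elim!: stalkE intro: fractionsI)
  show "0 \<in> ideal_stalk n X q"
    using stalkI[of 0 0 1 q] by (simp add: X_0 Zero_fract_def)
next
  fix a b assume "a \<in> ideal_stalk n X q" "b \<in> ideal_stalk n X q"
  then obtain F H j F' H' k where *: "a = Fract F H" "F \<in> forms n j" "H \<in> forms n j" "eval q H \<noteq> 0"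
    "b = Fract F' H'" "F' \<in> forms n k" "H' \<in> forms n k" "eval q H' \<noteq> 0" and X: "F \<in> X" "F' \<in> X"
    by (elim stalkE)
  have "F * H' + F' * H \<in> X"
    using * X by (intro X_add X_mult) (auto intro: forms_imp_mpolys)
  then show "a + b \<in> ideal_stalk n X q"
    using fract_add_forms[of F j H q F' k H'] * by (auto intro: stalkI)
next
  fix a b assume "a \<in> ideal_stalk n X q" "b \<in> fractions q"
  then obtain F H j F' H' k where *: "a = Fract F H" "F \<in> forms n j" "H \<in> forms n j" "eval q H \<noteq> 0"
    "b = Fract F' H'" "F' \<in> forms n k" "H' \<in> forms n k" "eval q H' \<noteq> 0" and X: "F \<in> X"
    by (elim stalkE fractionsE)
  have "Fract (F * F') (H * H') \<in> ideal_stalk n X q"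
    using * X by (intro stalkI[of _ "j + k"] forms_mult X_mult) (auto simp: id.subst_mult intro: forms_imp_mpolys)
  then show "a * b \<in> ideal_stalk n X q"
    using * by simp
qed

lemma vanishing_ideal: "fr.is_ideal q (vanishing_fractions q)"
  unfolding fr.is_ideal_def
proof (intro conjI ballI)
  show "vanishing_fractions q \<subseteq> fractions q"
    by (auto elim!: vanishing_fractionsE intro: fractionsI)
  show "0 \<in> vanishing_fractions q"
    using vanishing_fractionsI[of 0 0 1 q] by (simp add: Zero_fract_def)
next
  fix a b assume "a \<in> vanishing_fractions q" "b \<in> vanishing_fractions q"
  then obtain F H j F' H' k where *: "a = Fract F H" "F \<in> forms n j" "H \<in> forms n j" "eval q H \<noteq> 0"
    "b = Fract F' H'" "F' \<in> forms n k" "H' \<in> forms n k" "eval q H' \<noteq> 0" and 0: "eval q F = 0" "eval q F' = 0"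
    by (elim vanishing_fractionsE)
  have "eval q (F * H' + F' * H) = 0"
    using 0 by (simp add: id.subst_mult id.subst_add)
  then show "a + b \<in> vanishing_fractions q"
    using fract_add_forms[of F j H q F' k H'] * by (auto intro: vanishing_fractionsI)
next
  fix a b assume "a \<in> vanishing_fractions q" "b \<in> fractions q"
  then obtain F H j F' H' k where *: "a = Fract F H" "F \<in> forms n j" "H \<in> forms n j" "eval q H \<noteq> 0"
    "b = Fract F' H'" "F' \<in> forms n k" "H' \<in> forms n k" "eval q H' \<noteq> 0" and 0: "eval q F = 0"
    by (elim vanishing_fractionsE fractionsE)
  have "Fract (F * F') (H * H') \<in> vanishing_fractions q"
    using * 0 by (intro vanishing_fractionsI[of _ "j + k"] forms_mult) (simp_all add: id.subst_mult)
  then show "a * b \<in> vanishing_fractions q"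
    using * by simp
qed

lemma stalk_subset_vanishing:
  assumes "q \<in> points n X"
  shows "ideal_stalk n X q \<subseteq> vanishing_fractions q"
  using assms by (auto simp: points_def elim!: stalkE intro: vanishing_fractionsI)

lemma Fract_mem_vanishing_iff:
  assumes "F \<in> forms n k" "H \<in> forms n k" "eval q H \<noteq> 0"
  shows "Fract F H \<in> vanishing_fractions q \<longleftrightarrow> eval q F = 0"
proof
  assume "Fract F H \<in> vanishing_fractions q"
  then obtain F' H' k' where *: "Fract F H = Fract F' H'" "eval q F' = 0" "eval q H' \<noteq> 0" "H' \<noteq> 0"
    by (elim vanishing_fractionsE)
  moreover have "H \<noteq> 0"
    using assms(3) by auto
  ultimately have "F * H' = F' * H"
    by (simp add: eq_fract)
  then have "eval q F * eval q H' = eval q F' * eval q H"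
    by (metis id.subst_mult)
  with * show "eval q F = 0"
    by simp
qed (use assms vanishing_fractionsI in blast)

lemma unit_fractions:
  assumes "a \<in> fractions q - vanishing_fractions q"
  shows "\<exists>b\<in>fractions q. a * b = 1"
proof -
  obtain F H k where *: "a = Fract F H" "F \<in> forms n k" "H \<in> forms n k" "eval q H \<noteq> 0" "H \<noteq> 0"
    using assms by (auto elim: fractionsE)
  then have "eval q F \<noteq> 0"
    using assms vanishing_fractionsI by blast
  then have "Fract H F \<in> fractions q"
    using * by (auto intro: fractionsI)
  moreover have "F \<noteq> 0"
    using \<open>eval q F \<noteq> 0\<close> by auto
  then have "a * Fract H F = 1"
    using * by (simp add: One_fract_def eq_fract mult.commute)
  ultimately show ?thesis
    by blast
qed

lemma one_not_vanishing: "1 \<notin> vanishing_fractions q"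
  using Fract_mem_vanishing_iff[of 1 0 1 q] by (simp add: One_fract_def)

lemma maximalideal_local_ring:
  assumes "q \<in> points n X" "maximalideal M (local_ring n X q)"
  shows "M = fr.coset q (ideal_stalk n X q) ` vanishing_fractions q"
  using assms unfolding local_ring_eq
  by (intro fr.maximalideal_quotient_eq stalk_ideal vanishing_ideal stalk_subset_vanishing
      one_not_vanishing unit_fractions) auto

text \<open>Bring two elements to a common denominator, all numerators and denominators being forms of degree
  \<open>D\<close>. Their monomials with both exponents at most \<open>N\<close> become, after pullback, binary forms of degree
  \<open>2 N D e\<close>. For large \<open>N\<close> these are more than the dimension of the space, and a linear relation between
  them is an algebraic relation in the local ring.\<close>

lemma krull_dim_local_ring_le_1:
  fixes P v :: "nat \<Rightarrow> 'a"
  assumes dehom: "dehomogenization P v"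
  shows "krull_dim (local_ring n X q) \<le> 1"
  unfolding local_ring_eq
proof (rule fr.krull_dim_quotient_le_1[OF stalk_ideal])
  let ?u = "\<lambda>c. Fract (Cst c) (1 :: 'a mpoly)"
  show "scalar_hom ?u"
    by unfold_locales (simp_all add: Cst_add Cst_mult One_fract_def)
  interpret u: scalar_hom ?u
    by unfold_locales (simp_all add: Cst_add Cst_mult One_fract_def)
  show "?u c \<in> fractions q" for c
    by (rule fractionsI[of _ 0]) simp_all
  fix x y assume "x \<in> fractions q" "y \<in> fractions q"
  then obtain F H j F' H' k where x: "x = Fract F H" "F \<in> forms n j" "H \<in> forms n j" "eval q H \<noteq> 0" "H \<noteq> 0"
    and y: "y = Fract F' H'" "F' \<in> forms n k" "H' \<in> forms n k" "eval q H' \<noteq> 0" "H' \<noteq> 0"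
    by (elim fractionsE)
  define D where "D = j + k"
  define A B C where "A = F * H'" and "B = F' * H" and "C = H * H'"
  have ABC: "A \<in> forms n D" "B \<in> forms n D" "C \<in> forms n D"
    unfolding A_def B_def C_def D_def
    using forms_mult[OF x(2) y(3)] forms_mult[OF y(2) x(3)] forms_mult[OF x(3) y(3)]
    by (simp_all only: add.commute)
  have C: "eval q C \<noteq> 0" "C \<noteq> 0"
    using x y by (auto simp: C_def id.subst_mult)
  have xA: "x = Fract A C" and yB: "y = Fract B C"
    using x y by (simp_all add: A_def B_def C_def eq_fract mult_ac)
  interpret dehomogenization P v
    by (rule dehom)
  define E where "E = D * e"
  \<comment> \<open>With this choice \<open>2 N E + 1 < (N + 1)\<^sup>2\<close>.\<close>
  define N where "N = 2 * E + 1"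
  define f where "f ij = A ^ fst ij * B ^ snd ij * C ^ (2 * N - fst ij - snd ij)" for ij
  have f: "f ij \<in> forms n (2 * N * D)" if "ij \<in> {..N} \<times> {..N}" for ij
  proof -
    have "fst ij * D + snd ij * D + (2 * N - fst ij - snd ij) * D = 2 * N * D"
      using that unfolding distrib_right[symmetric] by auto
    then show ?thesis
      unfolding f_def using forms_mult[OF forms_mult[OF forms_power forms_power] forms_power] ABC
      by metis
  qed
  have deg: "degree (dehom (compose \<phi> (f ij))) \<le> 2 * N * E" if "ij \<in> {..N} \<times> {..N}" for ij
    using degree_dehom[OF compose_\<phi>_forms[OF f[OF that]]] by (simp add: E_def mult.assoc)
  have "Suc (2 * N * E) < (N + 1) * (N + 1)"
    by (simp add: N_def algebra_simps)
  then have card: "Suc (2 * N * E) < card ({..N} \<times> {..N})"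
    by simp
  have "\<exists>c. (\<exists>ij\<in>{..N} \<times> {..N}. c ij \<noteq> 0) \<and>
      (\<Sum>ij\<in>{..N} \<times> {..N}. [:c ij:] * dehom (compose \<phi> (f ij))) = 0"
    by (rule poly_linear_relation[OF _ card]) (simp, rule deg)
  then obtain c where c: "\<exists>ij\<in>{..N} \<times> {..N}. c ij \<noteq> 0"
    and rel: "(\<Sum>ij\<in>{..N} \<times> {..N}. [:c ij:] * dehom (compose \<phi> (f ij))) = 0"
    by blast
  define Z where "Z = (\<Sum>ij\<in>{..N} \<times> {..N}. Cst (c ij) * f ij)"
  have Z: "Z \<in> forms n (2 * N * D)"
    unfolding Z_def using f by (intro forms_sum forms_scale)
  have "dehom (compose \<phi> Z) = (\<Sum>ij\<in>{..N} \<times> {..N}. [:c ij:] * dehom (compose \<phi> (f ij)))"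
    unfolding Z_def Cst.subst_sum dehom_sum Cst.subst_mult by simp
  then have "compose \<phi> Z = 0"
    using dehom_eq_0_iff[OF compose_\<phi>_forms[OF Z]] rel by simp
  then have "Z \<in> X"
    by (rule compose_\<phi>_eq_0_imp[OF Z])
  have pow: "Fract a b ^ i = Fract (a ^ i) (b ^ i)" for a b :: "'a mpoly" and i
    by (induction i) (simp_all add: One_fract_def)
  have fsum: "(\<Sum>i\<in>I. Fract (g i) b) = Fract (\<Sum>i\<in>I. g i) b" if "b \<noteq> 0"
    for g :: "nat \<times> nat \<Rightarrow> 'a mpoly" and b I
    using that by (induction I rule: infinite_finite_induct) 
      (simp_all add: eq_fract Zero_fract_def distrib_right[symmetric] mult.assoc)
  have "(\<Sum>i\<le>N. \<Sum>j\<le>N. ?u (c (i, j)) * x ^ i * y ^ j) =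
      (\<Sum>ij\<in>{..N} \<times> {..N}. ?u (c ij) * x ^ fst ij * y ^ snd ij)"
    by (simp add: sum.cartesian_product case_prod_beta)
  also have "\<dots> = (\<Sum>ij\<in>{..N} \<times> {..N}. Fract (Cst (c ij) * f ij) (C ^ (2 * N)))"
  proof (rule sum.cong[OF refl])
    fix ij assume "ij \<in> {..N} \<times> {..N}"
    then have "2 * N = (2 * N - fst ij - snd ij) + (fst ij + snd ij)"
      by auto
    then have "C ^ (2 * N) = C ^ (2 * N - fst ij - snd ij) * (C ^ fst ij * C ^ snd ij)"
      by (metis power_add)
    then show "?u (c ij) * x ^ fst ij * y ^ snd ij = Fract (Cst (c ij) * f ij) (C ^ (2 * N))"
      using C(2) by (simp add: xA yB pow eq_fract f_def mult_ac)
  qed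
  also have "\<dots> = Fract Z (C ^ (2 * N))"
    using C(2) by (simp add: fsum Z_def)
  also have "\<dots> \<in> ideal_stalk n X q"
    using C by (intro stalkI[OF \<open>Z \<in> X\<close> Z] forms_power ABC) (simp add: id.subst_power)
  finally show "\<exists>N c. (\<exists>i\<le>N. \<exists>j\<le>N. c i j \<noteq> 0) \<and>
      (\<Sum>i\<le>N. \<Sum>j\<le>N. ?u (c i j) * x ^ i * y ^ j) \<in> ideal_stalk n X q"
    using c by (intro exI[of _ N] exI[of _ "\<lambda>i j. c (i, j)"]) auto
qed

text \<open>The hypothesis is the equality of two fractions in the local ring of the curve. Clearing
  denominators brings in the denominator \<open>D\<close> of the difference.\<close>

lemma stalk_diffE:
  assumes "Fract F H - Fract F' H' \<in> ideal_stalk n X q" "H \<noteq> 0" "H' \<noteq> 0"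
    and "H \<in> mpolys n" "H' \<in> mpolys n"
  obtains k D where "D \<in> forms n k" "eval q D \<noteq> 0" "(F * H' - F' * H) * D \<in> X"
proof -
  have "Fract (F * H' - F' * H) (H * H') \<in> ideal_stalk n X q"
    using assms(1-3) by simp
  then obtain E D k where *: "Fract (F * H' - F' * H) (H * H') = Fract E D" "E \<in> X" "D \<in> forms n k"
    "eval q D \<noteq> 0" "D \<noteq> 0"
    by (elim stalkE)
  then have "(F * H' - F' * H) * D = E * (H * H')"
    using assms(2,3) by (simp add: eq_fract)
  then have "(F * H' - F' * H) * D \<in> X"
    using X_mult[OF *(2) mpolys_mult[OF assms(4,5)]] by simp
  with * that show thesis
    by blast
qed

text \<open>By regularity and the bound on the dimension, the maximal ideal is generated by at most one element.
  It consists of the fractions with numerator vanishing at \<open>q\<close>, so each of these is a multiple of the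
  generator, and \<open>T\<close> is the numerator of the generator, or zero if there is none.\<close>

lemma regular_local_ring_uniformizer:
  fixes P v :: "nat \<Rightarrow> 'a"
  assumes dehom: "dehomogenization P v"
    and q: "q \<in> points n X" and reg: "regular_local_ring (local_ring n X q)"
  shows "\<exists>k\<^sub>0. \<exists>T\<in>forms n k\<^sub>0. eval q T = 0 \<and> (\<forall>k. \<forall>F\<in>forms n k. eval q F = 0 \<longrightarrow>
    (\<exists>j m. \<exists>A\<in>forms n j. \<exists>B\<in>forms n m. eval q A \<noteq> 0 \<and> k + j = k\<^sub>0 + m \<and> F * A - T * B \<in> X))"
proof -
  let ?J = "ideal_stalk n X q" and ?R = "local_ring n X q"
  obtain A where A: "A \<subseteq> carrier ?R" "finite A" "enat (card A) = krull_dim ?R"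
    "maximalideal (genideal ?R A) ?R"
    using reg unfolding regular_local_ring_def by blast
  have M: "genideal ?R A = fr.coset q ?J ` vanishing_fractions q"
    by (rule maximalideal_local_ring[OF q A(4)])
  have "enat (card A) \<le> 1"
    using krull_dim_local_ring_le_1[OF dehom] A(3) by simp
  then have "card A \<le> 1"
    by (simp add: one_enat_def)
  interpret R: cring ?R
    unfolding local_ring_eq by (rule fr.cring_quotient[OF stalk_ideal])
  obtain i where i: "i \<le> n" "q i \<noteq> 0"
    using q by (auto simp: points_def proj_space_def)
  \<comment> \<open>Powers of a variable that does not vanish at \<open>q\<close> serve as denominators.\<close>
  have den: "Var i ^ k \<in> forms n k" "eval q (Var i ^ k) \<noteq> 0" "Var i ^ k \<noteq> (0 :: 'a mpoly)" for k
  proof -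
    show *: "eval q (Var i ^ k) \<noteq> 0"
      using i by (simp add: id.subst_power)
    then show "Var i ^ k \<noteq> (0 :: 'a mpoly)"
      by (rule eval_nonzero)
    show "Var i ^ k \<in> forms n k"
      using forms_power[OF forms_Var[OF i(1)], of k] by simp
  qed
  have mem_M: "fr.coset q ?J (Fract F (Var i ^ k)) \<in> genideal ?R A" if "F \<in> forms n k" "eval q F = 0" for F k
    unfolding M by (intro imageI vanishing_fractionsI[OF that(1) den(1) that(2) den(2)])
  consider "A = {}" | z where "A = {z}"
    using \<open>card A \<le> 1\<close> A(2) by (metis card_1_singletonE card_0_eq le_Suc_eq le_zero_eq One_nat_def)
  then show ?thesis
  proof cases
    case 1
    have "\<exists>j m. \<exists>A\<in>forms n j. \<exists>B\<in>forms n m. eval q A \<noteq> 0 \<and> k + j = 0 + m \<and> F * A - 0 * B \<in> X"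
      if F: "F \<in> forms n k" "eval q F = 0" for k F
    proof -
      have "genideal ?R A \<subseteq> {\<zero>\<^bsub>?R\<^esub>}"
        unfolding 1 by (rule R.genideal_minimal[OF R.zeroideal]) simp
      with mem_M[OF F] have "fr.coset q ?J (Fract F (Var i ^ k)) = \<zero>\<^bsub>?R\<^esub>"
        by blast
      also have "\<dots> = fr.coset q ?J 0"
        by (simp add: local_ring_eq fr.coset_eq FactRing_def)
      finally have "Fract F (Var i ^ k) - 0 \<in> ?J"
        unfolding fr.coset_eq_iff[OF stalk_ideal] .
      then have "Fract F (Var i ^ k) - Fract 0 1 \<in> ?J"
        by (simp add: Zero_fract_def)
      then obtain j D where D: "D \<in> forms n j" "eval q D \<noteq> 0" "(F * 1 - 0 * Var i ^ k) * D \<in> X"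
        by (rule stalk_diffE) (use den[of k] in \<open>auto intro: forms_imp_mpolys\<close>)
      show ?thesis
        by (rule exI[of _ j], rule exI[of _ "k + j"], rule bexI[of _ D], rule bexI[of _ 0])
          (use D in simp_all)
    qed
    then show ?thesis
      by (intro exI[of _ 0] bexI[of _ 0]) auto
  next
    case (2 z)
    have z: "z \<in> carrier ?R"
      using A(1) 2 by simp
    then have "z \<in> genideal ?R A"
      unfolding 2 by (rule R.genideal_self')
    then obtain t where t: "z = fr.coset q ?J t" "t \<in> vanishing_fractions q"
      unfolding M by (rule imageE)
    from t(2) obtain T D\<^sub>0 k\<^sub>0 where T: "t = Fract T D\<^sub>0" "T \<in> forms n k\<^sub>0" "D\<^sub>0 \<in> forms n k\<^sub>0"
      "eval q T = 0" "eval q D\<^sub>0 \<noteq> 0" "D\<^sub>0 \<noteq> 0"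
      by (rule vanishing_fractionsE)
    have "\<exists>j m. \<exists>A\<in>forms n j. \<exists>B\<in>forms n m. eval q A \<noteq> 0 \<and> k + j = k\<^sub>0 + m \<and> F * A - T * B \<in> X"
      if F: "F \<in> forms n k" "eval q F = 0" for k F
    proof -
      have "fr.coset q ?J (Fract F (Var i ^ k)) \<in> cgenideal ?R z"
        using mem_M[OF F] unfolding 2 R.cgenideal_eq_genideal[OF z] .
      then obtain w where w: "w \<in> carrier ?R" "fr.coset q ?J (Fract F (Var i ^ k)) = w \<otimes>\<^bsub>?R\<^esub> z"
        unfolding cgenideal_def by blast
      from w(1) obtain b where b: "w = fr.coset q ?J b" "b \<in> fractions q"
        unfolding local_ring_eq fr.carrier_quotient by (rule imageE)
      from b(2) obtain B D\<^sub>2 l where B: "b = Fract B D\<^sub>2" "B \<in> forms n l" "D\<^sub>2 \<in> forms n l"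
        "eval q D\<^sub>2 \<noteq> 0" "D\<^sub>2 \<noteq> 0"
        by (rule fractionsE)
      have "t \<in> fractions q"
        using T by (simp add: fractionsI)
      then have "fr.coset q ?J (Fract F (Var i ^ k)) = fr.coset q ?J (b * t)"
        unfolding w(2) b(1) t(1) local_ring_eq by (rule fr.coset_mult[OF stalk_ideal b(2)])
      then have "Fract F (Var i ^ k) - Fract (B * T) (D\<^sub>2 * D\<^sub>0) \<in> ?J"
        unfolding fr.coset_eq_iff[OF stalk_ideal] by (simp add: B(1) T(1))
      then obtain r D where D: "D \<in> forms n r" "eval q D \<noteq> 0"
        "(F * (D\<^sub>2 * D\<^sub>0) - B * T * Var i ^ k) * D \<in> X"
        by (rule stalk_diffE)
          (use den[of k] B T in \<open>auto intro!: mpolys_mult intro: forms_imp_mpolys\<close>)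
      have "F * (D\<^sub>2 * D\<^sub>0 * D) - T * (B * Var i ^ k * D) \<in> X"
        using D(3) by (simp add: algebra_simps)
      moreover have "k + (l + k\<^sub>0 + r) = k\<^sub>0 + (l + k + r)"
        by simp
      moreover have "eval q (D\<^sub>2 * D\<^sub>0 * D) \<noteq> 0"
        using B T D by (simp add: id.subst_mult)
      moreover have "D\<^sub>2 * D\<^sub>0 * D \<in> forms n (l + k\<^sub>0 + r)" "B * Var i ^ k * D \<in> forms n (l + k + r)"
        by (rule forms_mult[OF forms_mult[OF B(3) T(3)] D(1)] forms_mult[OF forms_mult[OF B(2) den(1)] D(1)])+
      ultimately show ?thesis
        by blast
    qed
    then show ?thesis
      using T(2,4) by blast
  qed
qed

end

section \<open>The curve in an affine coordinate\<close>

locale pointed_rational_curve = rational_curve n e m X \<phi> G + dehomogenization P v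
  for n e m :: nat and X :: "'a::alg_closed_field mpoly set" and \<phi> G :: "nat \<Rightarrow> 'a mpoly"
    and P v :: "nat \<Rightarrow> 'a"
begin

text \<open>The dehomogenized powers \<open>L\<^sup>k\<close>, described as pullbacks of the forms of degree \<open>k\<close>.\<close>

definition W :: "nat \<Rightarrow> 'a poly set" where
  "W k = (\<lambda>F. dehom (compose \<phi> F)) ` forms n k"

lemma W_I: "F \<in> forms n k \<Longrightarrow> dehom (compose \<phi> F) \<in> W k"
  by (simp add: W_def)

lemma W_E:
  assumes "p \<in> W k"
  obtains F where "F \<in> forms n k" "p = dehom (compose \<phi> F)"
  using assms by (auto simp: W_def)

sublocale W: graded_polys e W
proof
  show "[:c:] \<in> W 0" for c
    using W_I[OF forms_Cst, of c] by simp
  show "0 \<in> W k" for k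
    using W_I[OF forms_0, of k] by simp
  show "p + q \<in> W k" if pq: "p \<in> W k" "q \<in> W k" for p q k
  proof -
    obtain A B where "A \<in> forms n k" "p = dehom (compose \<phi> A)" "B \<in> forms n k" "q = dehom (compose \<phi> B)"
      using pq by (elim W_E)
    then show ?thesis
      using W_I[OF forms_add, of A k B] by (simp add: Cst.subst_add)
  qed
  show "p * q \<in> W (j + k)" if pq: "p \<in> W j" "q \<in> W k" for p q j k
  proof -
    obtain A B where "A \<in> forms n j" "p = dehom (compose \<phi> A)" "B \<in> forms n k" "q = dehom (compose \<phi> B)"
      using pq by (elim W_E)
    then show ?thesis
      using W_I[OF forms_mult, of A j B k] by (simp add: Cst.subst_mult)
  qed
  show "degree p \<le> k * e" if "p \<in> W k" for p k
    using that by (elim W_E) (simp only: degree_dehom[OF compose_\<phi>_forms])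
qed

text \<open>Up to proportionality these are the points other than \<open>P\<close>.\<close>

definition affine_point :: "'a \<Rightarrow> nat \<Rightarrow> 'a" where
  "affine_point t = (\<lambda>i. v i + t * P i)"

lemma affine_point_det: "P 1 * affine_point t 0 - P 0 * affine_point t 1 = 1"
  using Pv by (simp add: affine_point_def algebra_simps)

lemma affine_point_proj: "affine_point t \<in> proj_space 1"
proof -
  have "affine_point t 0 \<noteq> 0 \<or> affine_point t 1 \<noteq> 0"
    using affine_point_det[of t] by auto
  then show ?thesis
    unfolding proj_space_def by (auto intro: exI[of _ "0::nat"] exI[of _ "1::nat"])
qed

lemma affine_point_neq_P: "\<not> same_point 1 (affine_point t) P"
proof
  assume "same_point 1 (affine_point t) P"
  then obtain c where "P 0 = c * affine_point t 0" "P 1 = c * affine_point t 1"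
    by (auto simp: same_point_def)
  then show False
    using affine_point_det[of t] by simp
qed

lemma eval_image_point: "eval (image_point \<phi> p) F = eval p (compose \<phi> F)"
  by (simp add: id.subst_compose image_point_def)

lemma poly_dehom_compose: "poly (dehom (compose \<phi> F)) t = eval (image_point \<phi> (affine_point t)) F"
  by (simp add: poly_dehom eval_image_point affine_point_def)

lemma image_point_mem:
  assumes "p \<in> proj_space 1"
  shows "image_point \<phi> p \<in> points n X"
  using no_base_point[OF assms]
  by (simp add: points_def proj_space_def eval_image_point vanish) (simp add: image_point_def)

text \<open>Pulling back turns congruences modulo \<open>X\<close> into equations between polynomials in \<open>t\<close>.\<close>

lemma regular_at_affine_point:
  assumes "regular_local_ring (local_ring n X (image_point \<phi> (affine_point t)))"
  shows "W.regular_at t"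
proof -
  define q where "q = image_point \<phi> (affine_point t)"
  have "q \<in> points n X"
    unfolding q_def by (rule image_point_mem[OF affine_point_proj])
  from regular_local_ring_uniformizer[OF dehomogenization_axioms this]
  obtain k\<^sub>0 T where T: "T \<in> forms n k\<^sub>0" "eval q T = 0"
    and gen: "\<And>k F. F \<in> forms n k \<Longrightarrow> eval q F = 0 \<Longrightarrow>
      \<exists>j m. \<exists>A\<in>forms n j. \<exists>B\<in>forms n m. eval q A \<noteq> 0 \<and> k + j = k\<^sub>0 + m \<and> F * A - T * B \<in> X"
    using assms unfolding q_def by blast
  have ev: "eval q F = poly (dehom (compose \<phi> F)) t" for F
    by (simp add: q_def poly_dehom_compose)
  have "\<exists>j m. \<exists>G\<in>W j. \<exists>H\<in>W m. poly G t \<noteq> 0 \<and> k + j = k\<^sub>0 + m \<and> a * G = dehom (compose \<phi> T) * H"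
    if a: "a \<in> W k" "poly a t = 0" for k a
  proof -
    obtain F where F: "F \<in> forms n k" "a = dehom (compose \<phi> F)"
      using a(1) by (rule W_E)
    obtain j m A B where AB: "A \<in> forms n j" "B \<in> forms n m" "eval q A \<noteq> 0" "k + j = k\<^sub>0 + m"
      "F * A - T * B \<in> X"
      using gen[OF F(1)] a(2) unfolding ev F(2) by blast
    have "compose \<phi> F * compose \<phi> A - compose \<phi> T * compose \<phi> B = 0"
      using vanish[OF AB(5)] by (simp add: Cst.subst_diff Cst.subst_mult)
    then have "dehom (compose \<phi> F * compose \<phi> A) = dehom (compose \<phi> T * compose \<phi> B)"
      by simp
    then have "a * dehom (compose \<phi> A) = dehom (compose \<phi> T) * dehom (compose \<phi> B)"
      unfolding F(2) by simp
    then show ?thesis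
      using AB(3,4) W_I[OF AB(1)] W_I[OF AB(2)] unfolding ev by blast
  qed
  then show ?thesis
    unfolding W.regular_at_def using W_I[OF T(1)] T(2) unfolding ev by blast
qed

text \<open>The rational inverse pulls back to two forms proportional to the coordinates of the projective line,
  with a common factor whose dehomogenization is \<open>c\<close>. In the affine coordinate the linear forms \<open>lin\<close>
  and \<open>lin'\<close> are \<open>1\<close> and \<open>t\<close>, so \<open>c\<close> and \<open>c t\<close> are combinations of the two.\<close>

lemma birational_element:
  "\<exists>c. c \<in> W m \<and> [:0, 1:] * c \<in> W m \<and> c \<noteq> 0"
proof -
  define a b where "a = dehom (compose \<phi> (G 0))" and "b = dehom (compose \<phi> (G 1))"
  define x y where "x = [:v 0, P 0:]" and "y = [:v 1, P 1:]"
  have ab: "a * y = b * x"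
    using arg_cong[OF G_\<phi>, of dehom] by (simp add: a_def b_def x_def y_def)
  have nz: "a \<noteq> 0 \<or> b \<noteq> 0"
    using G_nonzero dehom_eq_0_iff[OF compose_\<phi>_forms[OF G(1)]] dehom_eq_0_iff[OF compose_\<phi>_forms[OF G(2)]]
    by (simp add: a_def b_def)
  have mem: "a \<in> W m" "b \<in> W m"
    unfolding a_def b_def by (rule W_I[OF G(1)], rule W_I[OF G(2)])
  have xy: "[:P 1:] * x + [:- P 0:] * y = 1" "[:- v 1:] * x + [:v 0:] * y = [:0, 1:]"
    using Pv by (simp_all add: x_def y_def one_pCons algebra_simps)
  define c where "c = [:P 1:] * a + [:- P 0:] * b"
  have "c * x = [:P 1:] * (a * x) + [:- P 0:] * (b * x)"
    by (simp only: c_def distrib_right mult.assoc)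
  also have "\<dots> = a * ([:P 1:] * x + [:- P 0:] * y)"
    unfolding ab[symmetric] by (simp only: distrib_left mult.left_commute)
  finally have cx: "c * x = a"
    unfolding xy by simp
  have "c * y = [:P 1:] * (a * y) + [:- P 0:] * (b * y)"
    by (simp only: c_def distrib_right mult.assoc)
  also have "\<dots> = b * ([:P 1:] * x + [:- P 0:] * y)"
    unfolding ab by (simp only: distrib_left mult.left_commute)
  finally have cy: "c * y = b"
    unfolding xy by simp
  have "[:0, 1:] * c = [:- v 1:] * (c * x) + [:v 0:] * (c * y)"
    unfolding xy(2)[symmetric] by (simp only: distrib_right mult.assoc mult.commute[of c])
  then have "[:0, 1:] * c = [:- v 1:] * a + [:v 0:] * b"
    unfolding cx cy .
  moreover have "[:- v 1:] * a + [:v 0:] * b \<in> W m" "c \<in> W m"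
    unfolding c_def by (intro W.add W.smult_mem mem)+
  moreover have "c \<noteq> 0"
    using nz cx cy by auto
  ultimately show ?thesis
    by (intro exI[of _ c]) simp
qed

lemma e_pos: "e > 0"
proof -
  obtain c where "[:0, 1:] * c \<in> W m" "c \<noteq> 0"
    using birational_element by blast
  then show ?thesis
    by (rule W.generic_degree_pos)
qed

lemma no_base_point_W: "\<exists>s\<in>W 1. poly s t \<noteq> 0"
proof -
  obtain i where i: "i \<le> n" "eval (affine_point t) (\<phi> i) \<noteq> 0"
    using no_base_point[OF affine_point_proj] by blast
  then have "poly (dehom (compose \<phi> (Var i))) t \<noteq> 0"
    by (simp add: poly_dehom affine_point_def)
  then show ?thesis
    using W_I[OF forms_Var[OF i(1)]] by blast
qed

lemma P_proj: "P \<in> proj_space 1"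
proof -
  have "P 0 \<noteq> 0 \<or> P 1 \<noteq> 0"
    using Pv by auto
  then show ?thesis
    unfolding proj_space_def by (auto intro: exI[of _ "0::nat"] exI[of _ "1::nat"])
qed

text \<open>Not vanishing at \<open>P\<close> means full degree in the affine coordinate.\<close>

lemma full_degree_element: "\<exists>i\<le>n. eval P (\<phi> i) \<noteq> 0 \<and> dehom (\<phi> i) \<in> W 1 \<and> degree (dehom (\<phi> i)) = e"
proof -
  obtain i where i: "i \<le> n" "eval P (\<phi> i) \<noteq> 0"
    using no_base_point[OF P_proj] by blast
  have "coeff (dehom (\<phi> i)) e \<noteq> 0"
    using eval_P[OF \<phi>[OF i(1)]] i(2) by simp
  then have "degree (dehom (\<phi> i)) = e"
    using degree_dehom[OF \<phi>[OF i(1)]] by (intro antisym le_degree)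
  moreover have "dehom (\<phi> i) \<in> W 1"
    using W_I[OF forms_Var[OF i(1)]] by simp
  ultimately show ?thesis
    using i by blast
qed

theorem one_mem_W:
  assumes "\<And>t. regular_local_ring (local_ring n X (image_point \<phi> (affine_point t)))"
  shows "\<exists>k\<ge>1. 1 \<in> W k"
proof -
  obtain c where c: "c \<in> W m" "[:0, 1:] * c \<in> W m" "c \<noteq> 0"
    using birational_element by blast
  obtain i where i: "dehom (\<phi> i) \<in> W 1" "degree (dehom (\<phi> i)) = e"
    using full_degree_element by blast
  show ?thesis
    by (rule W.one_mem_of_regular[OF no_base_point_W i c regular_at_affine_point[OF assms]])
qed

end

section \<open>The algebra of a linear system\<close>

interpretation mscale: Modules.module "\<lambda>c (F :: 'a::field mpoly). Cst c * F"
  by unfold_locales (simp_all add: algebra_simps Cst_add Cst_mult)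

lemma prod_concat:
  fixes l l' :: "nat \<Rightarrow> 'b::comm_monoid_mult"
  shows "(\<Prod>i<j. l i) * (\<Prod>i<k. l' i) = (\<Prod>i<j + k. if i < j then l i else l' (i - j))"
  by (induction k) (simp_all add: mult.assoc[symmetric])

lemma subspace_power_mult:
  assumes F: "F \<in> subspace_power L j" and H: "H \<in> subspace_power L k"
  shows "F * H \<in> subspace_power L (j + k)"
proof -
  let ?G = "\<lambda>k. {\<Prod>i<k. l i | l. \<forall>i<k. l i \<in> L}"
  have gen: "A * B \<in> ?G (j + k)" if AB: "A \<in> ?G j" "B \<in> ?G k" for A B
  proof -
    obtain l l' where l: "A = (\<Prod>i<j. l i)" "\<forall>i<j. l i \<in> L" "B = (\<Prod>i<k. l' i)" "\<forall>i<k. l' i \<in> L"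
      using AB by blast
    show ?thesis
      unfolding l(1,3) prod_concat using l(2,4)
      by (intro CollectI exI[of _ "\<lambda>i. if i < j then l i else l' (i - j)"]) auto
  qed
  have 1: "F * B \<in> mscale.span (?G (j + k))" if B: "B \<in> ?G k" for B
    using F unfolding subspace_power_def
  proof (induction rule: mscale.span_induct_alt)
    case (step c A y)
    have "A * B \<in> mscale.span (?G (j + k))"
      by (rule mscale.span_base[OF gen[OF step(1) B]])
    then have "Cst c * (A * B) + y * B \<in> mscale.span (?G (j + k))"
      by (rule mscale.span_add[OF mscale.span_scale step(2)])
    then show ?case
      by (simp add: algebra_simps)
  qed (simp add: mscale.span_zero)
  show ?thesis
    using H unfolding subspace_power_def
  proof (induction rule: mscale.span_induct_alt)
    case (step c A y)
    have "Cst c * (F * A) + F * y \<in> mscale.span (?G (j + k))"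
      by (rule mscale.span_add[OF mscale.span_scale[OF 1[OF step(1)]] step(2)])
    then show ?case
      by (simp add: algebra_simps)
  qed (simp add: mscale.span_zero)
qed

text \<open>A product of \<open>k\<close> pullbacks is the pullback of the product. Conversely a form of degree \<open>k\<close> is a
  combination of products of \<open>k\<close> variables.\<close>

lemma subspace_power_pullback:
  "subspace_power (pullback_forms n \<phi>) k = compose \<phi> ` forms n k"
proof
  let ?L = "pullback_forms n \<phi>"
  have "mscale.subspace (compose \<phi> ` forms n k)"
    unfolding mscale.subspace_def
  proof (intro conjI ballI allI)
    show "0 \<in> compose \<phi> ` forms n k"
      by (rule image_eqI[of _ _ 0]) simp_all
  next
    fix A B assume "A \<in> compose \<phi> ` forms n k" "B \<in> compose \<phi> ` forms n k"
    then obtain F H where "A = compose \<phi> F" "F \<in> forms n k" "B = compose \<phi> H" "H \<in> forms n k"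
      by blast
    then show "A + B \<in> compose \<phi> ` forms n k"
      by (intro image_eqI[of _ _ "F + H"]) (simp_all add: Cst.subst_add forms_add)
  next
    fix c A assume "A \<in> compose \<phi> ` forms n k"
    then obtain F where "A = compose \<phi> F" "F \<in> forms n k"
      by blast
    then show "Cst c * A \<in> compose \<phi> ` forms n k"
      by (intro image_eqI[of _ _ "Cst c * F"]) (simp_all add: Cst.subst_mult forms_scale)
  qed
  moreover have "(\<Prod>i<k. l i) \<in> compose \<phi> ` forms n k" if "\<forall>i<k. l i \<in> ?L" for l
    using that
  proof (induction k)
    case 0
    show ?case
      by (rule image_eqI[of _ _ 1]) simp_all
  next
    case (Suc k)
    then obtain F H where "(\<Prod>i<k. l i) = compose \<phi> F" "F \<in> forms n k" "l k = compose \<phi> H" "H \<in> forms n 1"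
      unfolding pullback_forms_def by (metis (no_types, lifting) imageE less_Suc_eq)
    then show ?case
      using forms_mult[of F n k H 1] by (intro image_eqI[of _ _ "F * H"]) (simp_all add: Cst.subst_mult)
  qed
  ultimately show "subspace_power ?L k \<subseteq> compose \<phi> ` forms n k"
    unfolding subspace_power_def by (intro mscale.span_minimal) auto
next
  show "compose \<phi> ` forms n k \<subseteq> subspace_power (pullback_forms n \<phi>) k"
  proof
    fix A assume "A \<in> compose \<phi> ` forms n k"
    then obtain F where F: "F \<in> forms n k" "A = compose \<phi> F"
      by blast
    show "A \<in> subspace_power (pullback_forms n \<phi>) k"
      unfolding F(2)
    proof (rule Cst.subst_mem_graded[OF F(1)])
      show "0 \<in> subspace_power (pullback_forms n \<phi>) k" for k
        unfolding subspace_power_def by (rule mscale.span_zero)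
      show "p + q \<in> subspace_power (pullback_forms n \<phi>) k"
        if "p \<in> subspace_power (pullback_forms n \<phi>) k" "q \<in> subspace_power (pullback_forms n \<phi>) k" for k p q
        using that unfolding subspace_power_def by (rule mscale.span_add)
      show "p * q \<in> subspace_power (pullback_forms n \<phi>) (j + k)"
        if "p \<in> subspace_power (pullback_forms n \<phi>) j" "q \<in> subspace_power (pullback_forms n \<phi>) k" for j k p q
        using that by (rule subspace_power_mult)
      show "Cst c \<in> subspace_power (pullback_forms n \<phi>) 0" for c
      proof -
        have "Cst c * 1 \<in> subspace_power (pullback_forms n \<phi>) 0"
          unfolding subspace_power_def by (intro mscale.span_scale mscale.span_base) simp
        then show ?thesis
          by simp
      qed
      show "\<phi> i \<in> subspace_power (pullback_forms n \<phi>) 1" if "i \<le> n" for i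
      proof -
        have "\<phi> i \<in> pullback_forms n \<phi>"
          unfolding pullback_forms_def using forms_Var[OF that] by (intro image_eqI[of _ _ "Var i"]) simp_all
        then show ?thesis
          unfolding subspace_power_def
          by (intro mscale.span_base CollectI exI[of _ "\<lambda>_. \<phi> i"]) simp
      qed
    qed
  qed
qed

context subring_set
begin

lemma finsum_ring_on:
  assumes "finite A" "\<And>i. i \<in> A \<Longrightarrow> f i \<in> S"
  shows "finsum (ring_on S) f A = sum f A"
proof -
  interpret cring "ring_on S"
    by (rule cring_ring_on)
  show ?thesis
    using assms
  proof (induction A)
    case empty
    show ?case
      unfolding finsum_empty by (simp add: ring_on_def)
  next
    case (insert i A)
    then have "finsum (ring_on S) f (insert i A) = f i \<oplus>\<^bsub>ring_on S\<^esub> finsum (ring_on S) f A"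
      by (intro finsum_insert) auto
    then show ?case
      using insert by (simp add: ring_on_def)
  qed
qed

lemma additive_subgroup_ring_on:
  assumes "A \<subseteq> S" "A \<noteq> {}" "\<And>a b. a \<in> A \<Longrightarrow> b \<in> A \<Longrightarrow> a + b \<in> A" "\<And>a. a \<in> A \<Longrightarrow> - a \<in> A"
  shows "additive_subgroup A (ring_on S)"
proof -
  interpret cring "ring_on S"
    by (rule cring_ring_on)
  have inv: "\<ominus>\<^bsub>ring_on S\<^esub> a = - a" if "a \<in> S" for a
    using that by (intro minus_equality) (simp_all add: ring_on_def S_minus)
  show ?thesis
  proof (rule additive_subgroup.intro, rule add.subgroupI)
    fix a assume "a \<in> A"
    with assms show "\<ominus>\<^bsub>ring_on S\<^esub> a \<in> A"
      using inv[of a] by auto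
  qed (use assms in \<open>auto simp: ring_on_def\<close>)
qed

end

lemma domain_ring_on:
  assumes "subring_set (S :: 'r::idom set)"
  shows "domain (ring_on S)"
proof (rule domain.intro[OF subring_set.cring_ring_on[OF assms]])
  show "domain_axioms (ring_on S)"
    by (rule domain_axioms.intro) (auto simp: ring_on_def)
qed

context rational_curve
begin

definition piece :: "nat \<Rightarrow> 'a mpoly set" where
  "piece k = compose \<phi> ` forms n k"

definition coord_ring :: "'a mpoly poly set" where
  "coord_ring = {H. \<forall>k. coeff H k \<in> piece k}"

lemma system_ring_eq: "system_ring (pullback_forms n \<phi>) = ring_on coord_ring"
  by (simp add: system_ring_def coord_ring_def piece_def subspace_power_pullback)

lemma system_grading_eq: "system_grading (pullback_forms n \<phi>) k = (\<lambda>F. monom F k) ` piece k"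
  by (simp add: system_grading_def piece_def subspace_power_pullback)

lemma piece_I: "F \<in> forms n k \<Longrightarrow> compose \<phi> F \<in> piece k"
  by (simp add: piece_def)

lemma piece_E:
  assumes "A \<in> piece k"
  obtains F where "F \<in> forms n k" "A = compose \<phi> F"
  using assms by (auto simp: piece_def)

lemma piece_forms: "A \<in> piece k \<Longrightarrow> A \<in> forms 1 (k * e)"
  by (elim piece_E) (simp only: compose_\<phi>_forms)

lemma piece_0 [simp]: "0 \<in> piece k"
  using piece_I[OF forms_0, of k] by simp

lemma piece_Cst [simp]: "Cst c \<in> piece 0"
  using piece_I[OF forms_Cst, of c] by simp

lemma piece_\<phi>: "i \<le> n \<Longrightarrow> \<phi> i \<in> piece 1"
  using piece_I[OF forms_Var, of i] by simp

lemma piece_add: "A \<in> piece k \<Longrightarrow> B \<in> piece k \<Longrightarrow> A + B \<in> piece k"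
  by (elim piece_E) (metis Cst.subst_add piece_I forms_add)

lemma piece_minus: "A \<in> piece k \<Longrightarrow> - A \<in> piece k"
  by (elim piece_E) (metis Cst.subst_minus piece_I forms_uminus)

lemma piece_mult: "A \<in> piece j \<Longrightarrow> B \<in> piece k \<Longrightarrow> A * B \<in> piece (j + k)"
  by (elim piece_E) (metis Cst.subst_mult piece_I forms_mult)

lemma piece_sum: "(\<And>i. i \<in> I \<Longrightarrow> f i \<in> piece k) \<Longrightarrow> sum f I \<in> piece k"
  by (induction I rule: infinite_finite_induct) (simp_all add: piece_add)

lemma piece_0_E:
  assumes "A \<in> piece 0"
  obtains c where "A = Cst c"
proof -
  obtain F where F: "F \<in> forms n 0" "A = compose \<phi> F"
    using assms by (rule piece_E)
  have "A = compose \<phi> (Cst (Poly_Mapping.lookup F 0))"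
    unfolding F(2) by (subst forms_0_eq_Cst[OF F(1)]) (rule refl)
  then show thesis
    using that by simp
qed

lemma monom_mem_coord_ring: "A \<in> piece k \<Longrightarrow> monom A k \<in> coord_ring"
  by (simp add: coord_ring_def)

sublocale cr: subring_set coord_ring
proof
  show "0 \<in> coord_ring" "1 \<in> coord_ring"
    using piece_Cst[of 1] by (simp_all add: coord_ring_def del: piece_Cst)
  show "a + b \<in> coord_ring" if "a \<in> coord_ring" "b \<in> coord_ring" for a b
    using that by (simp add: coord_ring_def piece_add)
  show "- a \<in> coord_ring" if "a \<in> coord_ring" for a
    using that by (simp add: coord_ring_def piece_minus)
  show "a * b \<in> coord_ring" if ab: "a \<in> coord_ring" "b \<in> coord_ring" for a b
  proof -
    have "coeff (a * b) k \<in> piece k" for k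
      unfolding coeff_mult
    proof (rule piece_sum)
      fix i assume "i \<in> {..k}"
      moreover have "coeff a i * coeff b (k - i) \<in> piece (i + (k - i))"
        using ab by (intro piece_mult) (auto simp: coord_ring_def)
      ultimately show "coeff a i * coeff b (k - i) \<in> piece k"
        by simp
    qed
    then show ?thesis
      by (simp add: coord_ring_def)
  qed
qed

lemma decomposition_iff:
  assumes f: "f \<in> coord_ring"
  shows "decomposition (ring_on coord_ring) (\<lambda>k. (\<lambda>F. monom F k) ` piece k) f c \<longleftrightarrow> c = (\<lambda>k. monom (coeff f k) k)"
proof
  assume "decomposition (ring_on coord_ring) (\<lambda>k. (\<lambda>F. monom F k) ` piece k) f c"
  then have c: "\<And>k. c k \<in> (\<lambda>F. monom F k) ` piece k" and fin: "finite {k. c k \<noteq> 0}"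
    and sum: "f = finsum (ring_on coord_ring) c {k. c k \<noteq> 0}"
    by (auto simp: decomposition_def ring_on_def)
  have c_eq: "c k = monom (coeff (c k) k) k" for k
    using c[of k] by auto
  have "c k \<in> coord_ring" for k
    using c[of k] monom_mem_coord_ring by auto
  then have sum': "f = (\<Sum>k | c k \<noteq> 0. c k)"
    unfolding sum by (intro cr.finsum_ring_on fin)
  show "c = (\<lambda>k. monom (coeff f k) k)"
  proof
    fix k
    have "coeff f k = (\<Sum>j | c j \<noteq> 0. coeff (c j) k)"
      unfolding sum' by (simp add: coeff_sum)
    also have "\<dots> = (\<Sum>j | c j \<noteq> 0. if j = k then coeff (c k) k else 0)"
      by (rule sum.cong[OF refl], subst c_eq) auto
    also have "\<dots> = coeff (c k) k"
      using fin by simp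
    finally show "c k = monom (coeff f k) k"
      using c_eq[of k] by simp
  qed
next
  assume c: "c = (\<lambda>k. monom (coeff f k) k)"
  have set: "{k. c k \<noteq> 0} = {k. coeff f k \<noteq> 0}"
    by (simp add: c)
  have fin: "finite {k. coeff f k \<noteq> 0}"
    by (rule finite_subset[of _ "{..degree f}"]) (auto intro: le_degree)
  have cS: "c k \<in> coord_ring" for k
    using f unfolding c by (auto simp: coord_ring_def)
  have "coeff (\<Sum>k | coeff f k \<noteq> 0. monom (coeff f k) k) j = coeff f j" for j
  proof -
    have "coeff (\<Sum>k | coeff f k \<noteq> 0. monom (coeff f k) k) j = (\<Sum>k | coeff f k \<noteq> 0. if k = j then coeff f j else 0)"
      unfolding coeff_sum by (rule sum.cong) auto
    then show ?thesis
      using fin by simp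
  qed
  then have "f = (\<Sum>k | c k \<noteq> 0. c k)"
    unfolding set by (simp add: poly_eq_iff c)
  also have "\<dots> = finsum (ring_on coord_ring) c {k. c k \<noteq> 0}"
    using fin cS by (intro cr.finsum_ring_on[symmetric]) (simp add: set)
  finally show "decomposition (ring_on coord_ring) (\<lambda>k. (\<lambda>F. monom F k) ` piece k) f c"
    using fin f unfolding decomposition_def by (auto simp: ring_on_def set c coord_ring_def)
qed

lemma hom_part_eq:
  assumes "f \<in> coord_ring"
  shows "hom_part (ring_on coord_ring) (\<lambda>k. (\<lambda>F. monom F k) ` piece k) f = (\<lambda>k. monom (coeff f k) k)"
  unfolding hom_part_def decomposition_iff[OF assms] by simp

lemma generate_coord_ring:
  "generate_ring (ring_on coord_ring) (range (\<lambda>c. [:Cst c:]) \<union> (\<lambda>i. monom (\<phi> i) 1) ` {..n}) = coord_ring"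
proof
  let ?B = "range (\<lambda>c. [:Cst c:]) \<union> (\<lambda>i. monom (\<phi> i) 1) ` {..n}"
  let ?gen = "generate_ring (ring_on coord_ring) ?B"
  interpret cring "ring_on coord_ring"
    by (rule cr.cring_ring_on)
  have const: "[:Cst c:] \<in> coord_ring" for c
    using monom_mem_coord_ring[OF piece_Cst, of c] by (simp add: monom_0)
  have "?B \<subseteq> carrier (ring_on coord_ring)"
    using const monom_mem_coord_ring[OF piece_\<phi>] by auto
  from generate_ring_incl[OF this] show "?gen \<subseteq> coord_ring"
    by simp
  have add: "a + b \<in> ?gen" and mult: "a * b \<in> ?gen" if "a \<in> ?gen" "b \<in> ?gen" for a b
    using generate_ring.eng_add[OF that] generate_ring.eng_mult[OF that] by (simp_all add: ring_on_def)
  have Cst: "[:Cst c:] \<in> ?gen" for c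
    by (rule generate_ring.incl) simp
  from this[of 0] have 0: "0 \<in> ?gen"
    by simp
  have monom: "monom A k \<in> ?gen" if A: "A \<in> piece k" for A k
  proof -
    obtain F where F: "F \<in> forms n k" "A = compose \<phi> F"
      using A by (rule piece_E)
    have "compose \<phi> F \<in> {A. monom A k \<in> ?gen}"
    proof (rule Cst.subst_mem_graded[OF F(1), where W = "\<lambda>k. {A. monom A k \<in> ?gen}"])
      show "p * q \<in> {A. monom A (j + k) \<in> ?gen}"
        if "p \<in> {A. monom A j \<in> ?gen}" "q \<in> {A. monom A k \<in> ?gen}" for j k p q
        using mult[of "monom p j" "monom q k"] that by (simp add: mult_monom)
      show "\<phi> i \<in> {A. monom A 1 \<in> ?gen}" if "i \<le> n" for i
        using generate_ring.incl[of "monom (\<phi> i) 1" ?B "ring_on coord_ring"] that by simp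
    qed (use add 0 Cst in \<open>auto simp: monom_0 simp flip: add_monom\<close>)
    then show ?thesis
      by (simp add: F(2))
  qed
  show "coord_ring \<subseteq> ?gen"
  proof
    fix f assume f: "f \<in> coord_ring"
    have "sum g I \<in> ?gen" if "\<And>i. i \<in> I \<Longrightarrow> g i \<in> ?gen" for g :: "nat \<Rightarrow> 'a mpoly poly" and I
      using that by (induction I rule: infinite_finite_induct) (simp_all add: 0 add del: One_nat_def)
    from this[of "{..degree f}" "\<lambda>i. monom (coeff f i) i"] have "(\<Sum>i\<le>degree f. monom (coeff f i) i) \<in> ?gen"
      using f monom by (simp add: coord_ring_def)
    then show "f \<in> ?gen"
      by (simp add: poly_as_sum_of_monoms)
  qed
qed

lemma fg_graded_domain_coord_ring:
  "fg_graded_domain (\<lambda>c. [:Cst c:]) (ring_on coord_ring) (\<lambda>k. (\<lambda>F. monom F k) ` piece k)"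
  unfolding fg_graded_domain_def
proof (intro conjI allI ballI)
  have const: "[:Cst c:] \<in> coord_ring" for c
    using monom_mem_coord_ring[OF piece_Cst, of c] by (simp add: monom_0)
  show "domain (ring_on coord_ring)"
    by (rule domain_ring_on) unfold_locales
  show "(\<lambda>c. [:Cst c:]) \<in> ring_hom (ring_on UNIV) (ring_on coord_ring)"
    by (rule ring_hom_memI) (use const in \<open>simp_all add: ring_on_def Cst_add Cst_mult one_pCons\<close>)
  show "range (\<lambda>c. [:Cst c:]) \<subseteq> (\<lambda>F. monom F 0) ` piece 0"
    by (auto simp: monom_0)
  fix k
  show "additive_subgroup ((\<lambda>F. monom F k) ` piece k) (ring_on coord_ring)"
  proof (rule cr.additive_subgroup_ring_on)
    show "(\<lambda>F. monom F k) ` piece k \<subseteq> coord_ring"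
      using monom_mem_coord_ring by auto
    show "(\<lambda>F. monom F k) ` piece k \<noteq> {}"
      using piece_0 by blast
    show "a + b \<in> (\<lambda>F. monom F k) ` piece k" if "a \<in> (\<lambda>F. monom F k) ` piece k" "b \<in> (\<lambda>F. monom F k) ` piece k" for a b
      using that piece_add by (auto simp: add_monom)
    show "- a \<in> (\<lambda>F. monom F k) ` piece k" if "a \<in> (\<lambda>F. monom F k) ` piece k" for a
      using that piece_minus by (auto simp: minus_monom)
  qed
next
  fix i j f g assume "f \<in> (\<lambda>F. monom F i) ` piece i" "g \<in> (\<lambda>F. monom F j) ` piece j"
  then show "f \<otimes>\<^bsub>ring_on coord_ring\<^esub> g \<in> (\<lambda>F. monom F (i + j)) ` piece (i + j)"
    using piece_mult by (auto simp: ring_on_def mult_monom)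
next
  fix f assume "f \<in> carrier (ring_on coord_ring)"
  then have "f \<in> coord_ring"
    by simp
  then show "\<exists>!c. decomposition (ring_on coord_ring) (\<lambda>k. (\<lambda>F. monom F k) ` piece k) f c"
    by (simp add: decomposition_iff)
next
  show "\<exists>B\<subseteq>carrier (ring_on coord_ring). finite B \<and> generate_ring (ring_on coord_ring) (range (\<lambda>c. [:Cst c:]) \<union> B) = carrier (ring_on coord_ring)"
    using generate_coord_ring monom_mem_coord_ring[OF piece_\<phi>]
    by (intro exI[of _ "(\<lambda>i. monom (\<phi> i) 1) ` {..n}"]) auto
qed

end

section \<open>The valuation of a point\<close>

context dehomogenization
begin

lemma ord_at_mult:
  assumes "A \<in> forms 1 j" "B \<in> forms 1 k" "A \<noteq> 0" "B \<noteq> 0"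
  shows "ord_at P (A * B) = ord_at P A + ord_at P B"
proof -
  have "dehom A \<noteq> 0" "dehom B \<noteq> 0"
    using assms dehom_eq_0_iff by blast+
  then show ?thesis
    using assms degree_dehom[OF assms(1)] degree_dehom[OF assms(2)]
    by (simp add: ord_at_eq[OF forms_mult[OF assms(1,2)]] ord_at_eq[OF assms(1)] ord_at_eq[OF assms(2)]
        degree_mult_eq)
qed

lemma ord_at_add:
  assumes "A \<in> forms 1 k" "B \<in> forms 1 k" "A \<noteq> 0" "B \<noteq> 0" "A + B \<noteq> 0"
  shows "min (ord_at P A) (ord_at P B) \<le> ord_at P (A + B)"
  using degree_add_le_max[of "dehom A" "dehom B"] assms
  by (simp add: ord_at_eq[OF forms_add[OF assms(1,2)]] ord_at_eq[OF assms(1)] ord_at_eq[OF assms(2)])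

end

lemma finite_nonzero_coeffs: "finite {k. coeff H k \<noteq> 0}"
  by (rule finite_subset[of _ "{..degree H}"]) (auto intro: le_degree)

lemma lowest_coeff_exists:
  assumes "H \<noteq> 0"
  obtains l where "coeff H l \<noteq> 0" "\<And>k. k < l \<Longrightarrow> coeff H k = 0"
proof
  have "coeff H (degree H) \<noteq> 0"
    using assms by simp
  then show "coeff H (LEAST k. coeff H k \<noteq> 0) \<noteq> 0"
    by (rule LeastI)
  show "coeff H k = 0" if "k < (LEAST k. coeff H k \<noteq> 0)" for k
    using not_less_Least[OF that] by simp
qed

lemma point_valuation_ge_iff:
  assumes "H \<noteq> 0"
  shows "\<mu> \<le> point_valuation P H \<longleftrightarrow> (\<forall>k. coeff H k \<noteq> 0 \<longrightarrow> \<mu> \<le> (int k, int (ord_at P (coeff H k))))"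
proof -
  have "{k. coeff H k \<noteq> 0} \<noteq> {}"
    using lowest_coeff_exists[OF assms] by blast
  then show ?thesis
    unfolding point_valuation_def using finite_nonzero_coeffs[of H] by (subst Min_ge_iff) auto
qed

text \<open>In the lexicographic order the minimum is attained at the lowest nonzero coefficient.\<close>

lemma point_valuation_eq:
  assumes "coeff H l \<noteq> 0" "\<And>k. k < l \<Longrightarrow> coeff H k = 0"
  shows "point_valuation P H = (int l, int (ord_at P (coeff H l)))"
  unfolding point_valuation_def
proof (rule Min_eqI)
  fix y assume "y \<in> (\<lambda>k. (int k, int (ord_at P (coeff H k)))) ` {k. coeff H k \<noteq> 0}"
  then obtain k where k: "coeff H k \<noteq> 0" "y = (int k, int (ord_at P (coeff H k)))"
    by blast
  then have "l \<le> k"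
    using assms(2) by (meson not_le)
  then show "(int l, int (ord_at P (coeff H l))) \<le> y"
    unfolding k(2) by (cases "l = k") (auto simp: less_eq_prod_def)
qed (use assms(1) finite_nonzero_coeffs in auto)

lemma point_valuation_monom: "A \<noteq> 0 \<Longrightarrow> point_valuation P (monom A k) = (int k, int (ord_at P A))"
  by (subst point_valuation_eq[of _ k]) simp_all

context pointed_rational_curve
begin

lemma coeff_coord_ring_forms: "H \<in> coord_ring \<Longrightarrow> coeff H k \<in> forms 1 (k * e)"
  using piece_forms[of "coeff H k" k] by (simp add: coord_ring_def)

text \<open>The lowest coefficient of a product is the product of the lowest coefficients, which gives
  multiplicativity; the inequality for sums holds coefficientwise.\<close>

lemma is_valuation_point_valuation: "is_valuation (\<lambda>c. [:Cst c:]) (ring_on coord_ring) (point_valuation P)"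
  unfolding is_valuation_def
proof (intro conjI ballI allI impI)
  fix f g assume "f \<in> carrier (ring_on coord_ring) - {\<zero>\<^bsub>ring_on coord_ring\<^esub>}" "g \<in> carrier (ring_on coord_ring) - {\<zero>\<^bsub>ring_on coord_ring\<^esub>}"
  then have fg: "f \<in> coord_ring" "f \<noteq> 0" "g \<in> coord_ring" "g \<noteq> 0"
    by (auto simp: ring_on_def)
  obtain a where a: "coeff f a \<noteq> 0" "\<And>k. k < a \<Longrightarrow> coeff f k = 0"
    by (rule lowest_coeff_exists[OF fg(2)]) (rule that)
  obtain b where b: "coeff g b \<noteq> 0" "\<And>k. k < b \<Longrightarrow> coeff g k = 0"
    by (rule lowest_coeff_exists[OF fg(4)]) (rule that)
  have low: "coeff (f * g) k = 0" if "k < a + b" for k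
    unfolding coeff_mult
  proof (rule sum.neutral, rule ballI)
    fix i assume "i \<in> {..k}"
    with that have "i < a \<or> k - i < b"
      by auto
    then show "coeff f i * coeff g (k - i) = 0"
      using a(2) b(2) by auto
  qed
  have "coeff (f * g) (a + b) = (\<Sum>i\<le>a + b. if i = a then coeff f a * coeff g b else 0)"
    unfolding coeff_mult
  proof (rule sum.cong[OF refl])
    fix i assume "i \<in> {..a + b}"
    then consider "i < a" | "i = a" | "a + b - i < b"
      by fastforce
    then show "coeff f i * coeff g (a + b - i) = (if i = a then coeff f a * coeff g b else 0)"
      by cases (use a(2) b(2) in auto)
  qed
  then have prod: "coeff (f * g) (a + b) = coeff f a * coeff g b"
    by simp
  have "point_valuation P (f * g) = (int (a + b), int (ord_at P (coeff f a * coeff g b)))"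
    unfolding prod[symmetric] by (rule point_valuation_eq) (use a(1) b(1) low prod in auto)
  also have "\<dots> = point_valuation P f + point_valuation P g"
    using ord_at_mult[OF coeff_coord_ring_forms[OF fg(1)] coeff_coord_ring_forms[OF fg(3)] a(1) b(1)]
    by (simp add: point_valuation_eq[OF a] point_valuation_eq[OF b])
  finally show "point_valuation P (f \<otimes>\<^bsub>ring_on coord_ring\<^esub> g) = point_valuation P f + point_valuation P g"
    by (simp add: ring_on_def)
  assume "f \<oplus>\<^bsub>ring_on coord_ring\<^esub> g \<noteq> \<zero>\<^bsub>ring_on coord_ring\<^esub>"
  then have nz: "f + g \<noteq> 0"
    by (simp add: ring_on_def)
  let ?\<mu> = "min (point_valuation P f) (point_valuation P g)"
  have f_ge: "?\<mu> \<le> (int k, int (ord_at P (coeff f k)))" if "coeff f k \<noteq> 0" for k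
    using point_valuation_ge_iff[OF fg(2), of ?\<mu> P] that by simp
  have g_ge: "?\<mu> \<le> (int k, int (ord_at P (coeff g k)))" if "coeff g k \<noteq> 0" for k
    using point_valuation_ge_iff[OF fg(4), of ?\<mu> P] that by simp
  have "?\<mu> \<le> point_valuation P (f + g)"
    unfolding point_valuation_ge_iff[OF nz]
  proof (intro allI impI)
    fix k assume k: "coeff (f + g) k \<noteq> 0"
    consider "coeff f k = 0" | "coeff g k = 0" | "coeff f k \<noteq> 0" "coeff g k \<noteq> 0"
      by blast
    then show "?\<mu> \<le> (int k, int (ord_at P (coeff (f + g) k)))"
    proof cases
      case 1
      then show ?thesis
        using g_ge[of k] k by simp
    next
      case 2
      then show ?thesis
        using f_ge[of k] k by simp
    next
      case 3
      have "min (ord_at P (coeff f k)) (ord_at P (coeff g k)) \<le> ord_at P (coeff (f + g) k)"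
        using ord_at_add[OF coeff_coord_ring_forms[OF fg(1)] coeff_coord_ring_forms[OF fg(3)] 3] k by simp
      then have "(int k, int (ord_at P (coeff f k))) \<le> (int k, int (ord_at P (coeff (f + g) k)))
        \<or> (int k, int (ord_at P (coeff g k))) \<le> (int k, int (ord_at P (coeff (f + g) k)))"
        by (auto simp: less_eq_prod_def)
      then show ?thesis
        using f_ge[OF 3(1)] g_ge[OF 3(2)] order_trans by blast
    qed
  qed
  then show "?\<mu> \<le> point_valuation P (f \<oplus>\<^bsub>ring_on coord_ring\<^esub> g)"
    by (simp add: ring_on_def)
next
  fix c :: 'a assume "c \<noteq> 0"
  then have "point_valuation P [:Cst c:] = (0, int (ord_at P (Cst c)))"
    by (subst point_valuation_eq[of _ 0]) simp_all
  also have "ord_at P (Cst c) = 0"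
    using ord_at_eq[of "Cst c" 0] \<open>c \<noteq> 0\<close> by simp
  finally show "point_valuation P [:Cst c:] = 0"
    by (simp add: zero_prod_def)
qed

lemma homogeneous_point_valuation:
  "homogeneous_valuation (ring_on coord_ring) (\<lambda>k. (\<lambda>F. monom F k) ` piece k) (point_valuation P)"
  unfolding homogeneous_valuation_def
proof
  fix f assume "f \<in> carrier (ring_on coord_ring) - {\<zero>\<^bsub>ring_on coord_ring\<^esub>}"
  then have "f \<in> coord_ring"
    by simp
  have "{k. monom (coeff f k) k \<noteq> \<zero>\<^bsub>ring_on coord_ring\<^esub>} = {k. coeff f k \<noteq> 0}"
    by (simp add: ring_on_def)
  moreover have "(\<lambda>k. point_valuation P (monom (coeff f k) k)) ` {k. coeff f k \<noteq> 0} =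
      (\<lambda>k. (int k, int (ord_at P (coeff f k)))) ` {k. coeff f k \<noteq> 0}"
    by (rule image_cong) (simp_all add: point_valuation_monom)
  ultimately show "point_valuation P f = Min ((\<lambda>k. point_valuation P
      (hom_part (ring_on coord_ring) (\<lambda>k. (\<lambda>F. monom F k) ` piece k) f k)) `
      {k. hom_part (ring_on coord_ring) (\<lambda>k. (\<lambda>F. monom F k) ` piece k) f k \<noteq> \<zero>\<^bsub>ring_on coord_ring\<^esub>})"
    unfolding hom_part_eq[OF \<open>f \<in> coord_ring\<close>] by (simp only: point_valuation_def)
qed

lemma value_set_eq:
  "value_set (ring_on coord_ring) (point_valuation P) = {(int k, int (ord_at P A)) | k A. A \<in> piece k \<and> A \<noteq> 0}"
proof (intro subset_antisym subsetI)
  fix x assume "x \<in> value_set (ring_on coord_ring) (point_valuation P)"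
  then obtain f where f: "f \<in> coord_ring" "f \<noteq> 0" "x = point_valuation P f"
    by (auto simp: value_set_def ring_on_def)
  obtain a where a: "coeff f a \<noteq> 0" "\<And>k. k < a \<Longrightarrow> coeff f k = 0"
    by (rule lowest_coeff_exists[OF f(2)]) (rule that)
  have "coeff f a \<in> piece a"
    using f(1) by (simp add: coord_ring_def)
  then show "x \<in> {(int k, int (ord_at P A)) | k A. A \<in> piece k \<and> A \<noteq> 0}"
    unfolding f(3) using a(1)
    by (intro CollectI exI[of _ a] exI[of _ "coeff f a"] conjI point_valuation_eq[OF a])
next
  fix x assume "x \<in> {(int k, int (ord_at P A)) | k A. A \<in> piece k \<and> A \<noteq> 0}"
  then obtain k A where A: "A \<in> piece k" "A \<noteq> 0" "x = point_valuation P (monom A k)"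
    using point_valuation_monom[where P = P] by fastforce
  then show "x \<in> value_set (ring_on coord_ring) (point_valuation P)"
    using monom_mem_coord_ring[OF A(1)] by (auto simp: value_set_def ring_on_def)
qed

lemma value_set_bound:
  assumes "x \<in> value_set (ring_on coord_ring) (point_valuation P)"
  shows "\<exists>k a. x = (int k, int a) \<and> a \<le> k * e"
proof -
  obtain k A where A: "A \<in> piece k" "A \<noteq> 0" "x = (int k, int (ord_at P A))"
    using assms unfolding value_set_eq by blast
  have "ord_at P A \<le> k * e"
    using ord_at_eq[OF piece_forms[OF A(1)] A(2)] by simp
  with A(3) show ?thesis
    by blast
qed

lemma value_set_add:
  assumes "x \<in> value_set (ring_on coord_ring) (point_valuation P)" "y \<in> value_set (ring_on coord_ring) (point_valuation P)"
  shows "x + y \<in> value_set (ring_on coord_ring) (point_valuation P)"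
proof -
  obtain j A where A: "A \<in> piece j" "A \<noteq> 0" "x = (int j, int (ord_at P A))"
    using assms(1) unfolding value_set_eq by blast
  obtain k B where B: "B \<in> piece k" "B \<noteq> 0" "y = (int k, int (ord_at P B))"
    using assms(2) unfolding value_set_eq by blast
  have "x + y = (int (j + k), int (ord_at P (A * B)))"
    using ord_at_mult[OF piece_forms[OF A(1)] piece_forms[OF B(1)] A(2) B(2)] by (simp add: A(3) B(3))
  moreover have "A * B \<in> piece (j + k)" "A * B \<noteq> 0"
    using A B by (simp_all add: piece_mult)
  ultimately show ?thesis
    unfolding value_set_eq by blast
qed

lemma value_set_lower: "(1, 0) \<in> value_set (ring_on coord_ring) (point_valuation P)"
proof -
  obtain i where i: "i \<le> n" "eval P (\<phi> i) \<noteq> 0" "degree (dehom (\<phi> i)) = e"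
    using full_degree_element by blast
  have "\<phi> i \<noteq> 0"
    using i(2) by auto
  have "ord_at P (\<phi> i) = 0"
    using ord_at_eq[OF \<phi>[OF i(1)] \<open>\<phi> i \<noteq> 0\<close>] i(3) by simp
  then have "(1, 0) = (int 1, int (ord_at P (\<phi> i)))"
    by simp
  then show ?thesis
    unfolding value_set_eq using piece_\<phi>[OF i(1)] \<open>\<phi> i \<noteq> 0\<close> by blast
qed

lemma dehom_one_element:
  assumes "1 \<in> W k"
  obtains A where "A \<in> piece k" "A \<noteq> 0" "dehom A = 1"
proof -
  obtain F where "F \<in> forms n k" "1 = dehom (compose \<phi> F)"
    using assms by (rule W_E)
  then show thesis
    using that[OF piece_I, of F] by (metis dehom_simps(1) zero_neq_one)
qed

lemma value_set_upper:
  assumes "1 \<in> W k"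
  shows "(int k, int (k * e)) \<in> value_set (ring_on coord_ring) (point_valuation P)"
proof -
  obtain A where A: "A \<in> piece k" "A \<noteq> 0" "dehom A = 1"
    using assms by (rule dehom_one_element)
  have "ord_at P A = k * e"
    using ord_at_eq[OF piece_forms[OF A(1)] A(2)] A(3) by simp
  then have "(int k, int (k * e)) = (int k, int (ord_at P A))"
    by simp
  then show ?thesis
    unfolding value_set_eq using A(1,2) by blast
qed

section \<open>The dimension of the algebra\<close>

text \<open>The monomials in \<open>x, y, z\<close> with exponents at most \<open>N\<close> number \<open>(N + 1)\<^sup>3\<close>, but after
  dehomogenization they lie in a space of polynomials in two variables whose dimension is quadratic
  in \<open>N\<close>.\<close>

lemma algebraic_relation:
  assumes x: "x \<in> coord_ring" and y: "y \<in> coord_ring" and z: "z \<in> coord_ring"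
  shows "\<exists>N c. (\<exists>i\<le>N. \<exists>j\<le>N. \<exists>k\<le>N. c i j k \<noteq> (0 :: 'a)) \<and>
      (\<Sum>i\<le>N. \<Sum>j\<le>N. \<Sum>k\<le>N. [:Cst (c i j k):] * x ^ i * y ^ j * z ^ k) = 0"
proof -
  define D where "D = Max {degree x, degree y, degree z}"
  \<comment> \<open>Both degrees of such a monomial are at most \<open>N E\<close>, and \<open>(N E + 1)\<^sup>2 < (N + 1)\<^sup>3\<close>.\<close>
  define E where "E = 3 * D * e + 3 * D"
  define N where "N = (E + 1) ^ 2"
  define M where "M = N * E"
  let ?I = "{..N} \<times> {..N} \<times> {..N}"
  define f where "f i = x ^ fst i * y ^ fst (snd i) * z ^ snd (snd i)" for i :: "nat \<times> nat \<times> nat"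
  have fS: "f i \<in> coord_ring" for i
    unfolding f_def using x y z by (intro cr.S_mult cr.power_mem)
  have deg_pow: "degree (w ^ l) \<le> D * N" if "degree w \<le> D" "l \<le> N" for w :: "'a mpoly poly" and l
    using degree_power_le[of w l] mult_le_mono[OF that] by linarith
  have D: "degree x \<le> D" "degree y \<le> D" "degree z \<le> D"
    unfolding D_def by (intro Max_ge; simp)+
  have deg: "degree (f i) \<le> 3 * D * N" if "i \<in> ?I" for i
  proof -
    have "degree (f i) \<le> degree (x ^ fst i) + degree (y ^ fst (snd i)) + degree (z ^ snd (snd i))"
      unfolding f_def using degree_mult_le[of "x ^ fst i * y ^ fst (snd i)" "z ^ snd (snd i)"]
        degree_mult_le[of "x ^ fst i" "y ^ fst (snd i)"] by linarith
    also have "\<dots> \<le> D * N + D * N + D * N"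
      using that D by (intro add_mono deg_pow) auto
    finally show ?thesis
      by simp
  qed
  have bound1: "3 * D * N \<le> M" and bound2: "3 * D * N * e \<le> M"
    unfolding M_def E_def by (simp_all add: algebra_simps)
  have "card ({..M} \<times> {..M}) = Suc (N * E) * Suc (N * E)"
    by (simp add: M_def)
  also have "\<dots> \<le> ((N + 1) * (E + 1)) * ((N + 1) * (E + 1))"
    by (intro mult_le_mono) simp_all
  also have "\<dots> = (N + 1) * (N + 1) * N"
  proof -
    have "(N + 1) * (E + 1) * ((N + 1) * (E + 1)) = (N + 1) * (N + 1) * (E + 1) ^ 2"
      by (simp only: power2_eq_square mult_ac)
    then show ?thesis
      by (simp only: N_def[symmetric])
  qed
  also have "\<dots> < (N + 1) * (N + 1) * (N + 1)"
    by simp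
  also have "\<dots> = card ?I"
    by (simp add: card_cartesian_product mult.assoc)
  finally have card: "card ({..M} \<times> {..M}) < card ?I" .
  have "\<exists>c. (\<exists>i\<in>?I. c i \<noteq> 0) \<and> (\<forall>j\<in>{..M} \<times> {..M}. (\<Sum>i\<in>?I. c i * coeff (dehom (coeff (f i) (fst j))) (snd j)) = 0)"
    by (rule homogeneous_system_solution[OF _ _ card]) simp_all
  then obtain c where c: "\<exists>i\<in>?I. c i \<noteq> 0"
    and rel: "\<And>j. j \<in> {..M} \<times> {..M} \<Longrightarrow> (\<Sum>i\<in>?I. c i * coeff (dehom (coeff (f i) (fst j))) (snd j)) = 0"
    by blast
  have sum0: "(\<Sum>i\<in>?I. Cst (c i) * coeff (f i) k) = 0" for k
  proof (cases "k \<le> 3 * D * N")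
    case True
    have mem: "(\<Sum>i\<in>?I. Cst (c i) * coeff (f i) k) \<in> forms 1 (k * e)"
      by (intro forms_sum forms_scale coeff_coord_ring_forms fS)
    have "coeff (dehom (\<Sum>i\<in>?I. Cst (c i) * coeff (f i) k)) l = 0" for l
    proof (cases "l \<le> M")
      case l: True
      have "coeff (dehom (\<Sum>i\<in>?I. Cst (c i) * coeff (f i) k)) l =
          (\<Sum>i\<in>?I. c i * coeff (dehom (coeff (f i) k)) l)"
        by (simp add: dehom_sum coeff_sum)
      then show ?thesis
        using rel[of "(k, l)"] True bound1 l by simp
    next
      case False
      have "degree (dehom (\<Sum>i\<in>?I. Cst (c i) * coeff (f i) k)) \<le> k * e"
        by (rule degree_dehom[OF mem])
      also have "\<dots> \<le> 3 * D * N * e"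
        using True by simp
      finally show ?thesis
        using False bound2 by (intro coeff_eq_0) simp
    qed
    then have "dehom (\<Sum>i\<in>?I. Cst (c i) * coeff (f i) k) = 0"
      by (simp add: poly_eq_iff)
    then show ?thesis
      using dehom_eq_0_iff[OF mem] by simp
  next
    case False
    show ?thesis
    proof (rule sum.neutral, rule ballI)
      fix i assume "i \<in> ?I"
      from deg[OF this] False have "coeff (f i) k = 0"
        by (intro coeff_eq_0) simp
      then show "Cst (c i) * coeff (f i) k = 0"
        by simp
    qed
  qed
  have "(\<Sum>i\<le>N. \<Sum>j\<le>N. \<Sum>k\<le>N. [:Cst (c (i, j, k)):] * x ^ i * y ^ j * z ^ k) = (\<Sum>i\<in>?I. [:Cst (c i):] * f i)"
    by (simp add: sum.cartesian_product case_prod_beta f_def mult.assoc)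
  also have "\<dots> = 0"
    using sum0 by (simp add: poly_eq_iff coeff_sum)
  finally show ?thesis
    using c by (intro exI[of _ N] exI[of _ "\<lambda>i j k. c (i, j, k)"]) auto
qed

lemma krull_dim_coord_ring_le_2: "krull_dim (ring_on coord_ring) \<le> 2"
proof (rule cr.krull_dim_le_2)
  show "scalar_hom (\<lambda>c. [:Cst c :: 'a mpoly:])"
    by unfold_locales (simp_all add: Cst_add Cst_mult one_pCons)
  show "[:Cst c:] \<in> coord_ring" for c
    using monom_mem_coord_ring[OF piece_Cst, of c] by (simp add: monom_0)
qed (rule algebraic_relation)

lemma coeff_0_mult: "coeff (a * b) 0 = coeff a 0 * coeff b 0"
  by (simp add: coeff_mult)

text \<open>The chain consists of zero, the elements all of whose coefficients vanish at \<open>P\<close>, and the elements of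
  positive degree.\<close>

lemma krull_dim_coord_ring_ge_2:
  assumes "1 \<in> W k" "k \<ge> 1"
  shows "2 \<le> krull_dim (ring_on coord_ring)"
proof -
  define p0 p1 p2 where "p0 = {0 :: 'a mpoly poly}"
    and "p1 = {H \<in> coord_ring. map_poly (eval P) H = 0}" and "p2 = {H \<in> coord_ring. coeff H 0 = 0}"
  have map_add: "map_poly (eval P) (a + b) = map_poly (eval P) a + map_poly (eval P) b" for a b
    by (rule poly_eqI) (simp add: coeff_map_poly id.subst_add)
  have map_mult: "map_poly (eval P) (a * b) = map_poly (eval P) a * map_poly (eval P) b" for a b
    by (rule poly_eqI) (simp add: coeff_map_poly coeff_mult id.subst_sum id.subst_mult)
  have map_1: "map_poly (eval P) 1 = 1"
    by (rule poly_eqI) (simp add: coeff_map_poly)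
  have prime: "primeideal p0 (ring_on coord_ring)" "primeideal p1 (ring_on coord_ring)" "primeideal p2 (ring_on coord_ring)"
    unfolding cr.primeideal_iff cr.is_ideal_def p0_def p1_def p2_def
    by (auto simp: map_add map_mult map_1 coeff_0_mult intro: cr.S_add cr.S_mult)
  obtain A where A: "A \<in> piece k" "A \<noteq> 0" "dehom A = 1"
    using assms(1) by (rule dehom_one_element)
  have "eval P A = 0"
    using eval_P[OF piece_forms[OF A(1)]] A(3) assms(2) e_pos by simp
  then have "map_poly (eval P) (monom A k) = 0"
    by (simp add: poly_eq_iff coeff_map_poly)
  then have "monom A k \<in> p1" "monom A k \<notin> p0"
    using monom_mem_coord_ring[OF A(1)] A(2) by (simp_all add: p1_def p0_def)
  moreover have "p0 \<subseteq> p1"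
    by (simp add: p0_def p1_def)
  ultimately have 01: "p0 \<subset> p1"
    by blast
  obtain i where i: "i \<le> n" "eval P (\<phi> i) \<noteq> 0"
    using full_degree_element by blast
  have "coeff (map_poly (eval P) (monom (\<phi> i) 1)) 1 \<noteq> 0"
    using i(2) by (simp add: coeff_map_poly)
  then have "monom (\<phi> i) 1 \<notin> p1"
    by (auto simp: p1_def)
  moreover have "monom (\<phi> i) 1 \<in> p2"
    using monom_mem_coord_ring[OF piece_\<phi>[OF i(1)]] by (simp add: p2_def)
  moreover have "p1 \<subseteq> p2"
  proof
    fix H assume H: "H \<in> p1"
    then have "coeff H 0 \<in> piece 0"
      by (simp add: p1_def coord_ring_def)
    then obtain c where c: "coeff H 0 = Cst c"
      by (rule piece_0_E)
    have "coeff (map_poly (eval P) H) 0 = 0"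
      using H by (simp add: p1_def)
    then have "c = 0"
      by (simp add: coeff_map_poly c)
    with H c show "H \<in> p2"
      by (simp add: p1_def p2_def)
  qed
  ultimately have 12: "p1 \<subset> p2"
    by blast
  define p where "p i = (if i = 0 then p0 else if i = 1 then p1 else p2)" for i :: nat
  have "(\<forall>i\<le>2. primeideal (p i) (ring_on coord_ring)) \<and> (\<forall>i<2. p i \<subset> p (Suc i))"
    using prime 01 12 by (auto simp: p_def less_Suc_eq numeral_2_eq_2)
  then have "enat 2 \<le> krull_dim (ring_on coord_ring)"
    unfolding krull_dim_def by (intro Sup_upper) blast
  then show ?thesis
    by (simp add: numeral_eq_enat)
qed

text \<open>The elements of \<open>L\<close> not vanishing at \<open>P\<close> and the form dehomogenizing to \<open>1\<close> have values on the two
  edges of the cone. This yields finite generation, and rank two for the value group.\<close>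

theorem khovanskii_finite_of_one_mem:
  assumes "1 \<in> W k" "k \<ge> 1"
  shows "khovanskii_finite_embedded n \<phi> (point_valuation P)"
proof -
  have "group_rank (module.span zscale (value_set (ring_on coord_ring) (point_valuation P))) = 2"
    by (rule group_rank_span_eq_2[OF value_set_lower value_set_upper[OF assms(1)]]) (use assms(2) e_pos in simp)
  also have "\<dots> = krull_dim (ring_on coord_ring)"
    by (rule antisym[OF krull_dim_coord_ring_ge_2[OF assms] krull_dim_coord_ring_le_2])
  finally have "full_rank (ring_on coord_ring) (point_valuation P)"
    by (simp add: full_rank_def)
  moreover have "fg_semigroup (value_set (ring_on coord_ring) (point_valuation P))"
    by (rule fg_semigroup_of_edges[OF value_set_bound value_set_add value_set_lower value_set_upper[OF assms(1)]])
      (use assms(2) e_pos in auto)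
  ultimately show ?thesis
    unfolding khovanskii_finite_embedded_def khovanskii_finite_def system_ring_eq
      system_grading_eq[abs_def]
    using fg_graded_domain_coord_ring is_valuation_point_valuation homogeneous_point_valuation by blast
qed

end

section \<open>Khovanskii-finiteness at the singular point\<close>

theorem theorem4p1:
  fixes n d :: nat
    and g :: int
    and X :: "'a::{alg_closed_field, field_char_0} mpoly set"
    and \<phi> :: "nat \<Rightarrow> 'a mpoly"
    and P Q :: "nat \<Rightarrow> 'a"
  assumes curve: "proj_curve n X"
    and nondegenerate: "nondegenerate n X"
    and degree: "scheme_degree n X = of_nat d"
    and genus: "arithmetic_genus n X = of_int g"
    and genus_bound: "of_int g \<le> (of_nat d / 2 :: rat)"
    and normalization: "normalization_map n X \<phi>"
    and singular: "singular_point n X Q"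
    and only_singular: "\<And>q. singular_point n X q \<Longrightarrow> same_point n q Q"
    and P: "P \<in> proj_space 1"
    and unibranch: "\<And>p. p \<in> proj_space 1 \<Longrightarrow>
          same_point n (image_point \<phi> p) Q \<longleftrightarrow> same_point 1 p P"
  shows "khovanskii_finite_embedded n \<phi> (point_valuation P)"
proof -
  have X: "primeideal X (ring_on (mpolys n))"
    using curve by (simp add: proj_curve_def integral_subscheme_def)
  have mor: "morphism_from_P1 n X \<phi>"
    using normalization by (simp add: normalization_map_def)
  then obtain e where e: "\<And>i. i \<le> n \<Longrightarrow> \<phi> i \<in> forms 1 e"
    unfolding morphism_from_P1_def by blast
  obtain G where G: "rational_inverse n X \<phi> G"
    using normalization unfolding normalization_map_def by blast
  then obtain m where m: "G 0 \<in> forms n m" "G 1 \<in> forms n m"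
    unfolding rational_inverse_def by blast
  obtain v where v: "dehomogenization P v"
    using dehomogenization_exists[OF P] by blast
  interpret pointed_rational_curve n e m X \<phi> G P v
  proof (intro pointed_rational_curve.intro v rational_curve.intro)
    show "primeideal X (ring_on (mpolys n))"
      by (rule X)
    show "\<phi> i \<in> forms 1 e" if "i \<le> n" for i
      using that by (rule e)
    show "\<exists>i\<le>n. eval p (\<phi> i) \<noteq> 0" if "p \<in> proj_space 1" for p
      using mor that unfolding morphism_from_P1_def by blast
    show "compose \<phi> F = 0" if "F \<in> X" for F
      using mor that unfolding morphism_from_P1_def by blast
    show "G 0 \<in> forms n m" "G 1 \<in> forms n m"
      by (rule m)+
    show "compose \<phi> (G 0) \<noteq> 0 \<or> compose \<phi> (G 1) \<noteq> 0" "compose \<phi> (G 0) * Var 1 = compose \<phi> (G 1) * Var 0"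
      "\<exists>i\<le>n. compose G (\<phi> i) \<notin> X"
      using G unfolding rational_inverse_def by blast+
    show "compose G (\<phi> i) * Var j - compose G (\<phi> j) * Var i \<in> X" if "i \<le> n" "j \<le> n" for i j
      using G that unfolding rational_inverse_def by blast
  qed
  \<comment> \<open>A point other than \<open>P\<close> is mapped to a point other than \<open>Q\<close>, where the curve is regular.\<close>
  have "regular_local_ring (local_ring n X (image_point \<phi> (affine_point t)))" for t
  proof (rule ccontr)
    assume "\<not> ?thesis"
    then have "singular_point n X (image_point \<phi> (affine_point t))"
      using image_point_mem[OF affine_point_proj] by (simp add: singular_point_def)
    then have "same_point 1 (affine_point t) P"
      using only_singular unibranch[OF affine_point_proj] by blast
    then show False
      using affine_point_neq_P by blast
  qed
  from one_mem_W[OF this] obtain k where "k \<ge> 1" "1 \<in> W k"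
    by blast
  then show ?thesis
    using khovanskii_finite_of_one_mem by blast
qed

end
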